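(* Let $B$ be a finite clean bidirected graph rooted at $r$. Then there is a spanning subgraph $F$ of $B$, rooted at $r$, such that $F$ is a vertex-flame and $\kappa_F^{\alpha}(r,v)=\kappa_B^{\alpha}(r,v)$ for each $v\in V(B)\setminus\{r\}$ and each $\alpha\in\{+,-\}$.
   Context: A bidirected graph $B=(G,\sigma)$ is a loopless multigraph $G$ together with a map $\sigma$ assigning to each half-edge $(e,u)$ ($u$ an endpoint of the edge $e$) a sign $\sigma(e,u)\in\{+,-\}$; subgraphs inherit the signs. An oriented edge $\vec e$ is an edge $e$ with a choice of which endpoint is its tail and which its head. A trail is a sequence $v_0\vec e_1v_1\dots\vec e_\ell v_\ell$ in which the edges $e_i$ are pairwise distinct, $\vec e_i$ has tail $v_{i-1}$ and head $v_i$, and $\sigma(e_{i+1},v_i)=-\sigma(e_i,v_i)$ for $1\le i<\ell$; it is a $v_0$--$v_\ell$ trail, trivial if $\ell=0$. A path is a trail that does not repeat vertices. A $v$--$(w,\alpha)$ path is a path from $v$ to $w$ whose last edge has sign $\alpha$ at $w$. An almost path is a trail that is trivial or becomes a path on removing its last edge (and last vertex). $B$ is rooted if it has a designated root vertex $r$; it is clean if there is no nontrivial $r$--$r$ almost path. $\kappa_B^{\alpha}(v,w)$ is the maximum number of pairwise internally vertex-disjoint (distinct) $v$--$(w,\alpha)$ paths in $B$. A bidirected graph $F$ rooted at $r$ is a vertex-flame if $|E(F)|\le\sum_{v\in V(F)\setminus\{r\}}\sum_{\alpha\in\{+,-\}}\kappa_F^{\alpha}(r,v)$. *)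

theory Defs
  imports Main
begin

datatype sign = Plus | Minus

primrec neg :: "sign \<Rightarrow> sign" where
  "neg Plus = Minus"
| "neg Minus = Plus"

text \<open>
  \<open>sg B e u\<close> is the sign of the half-edge \<open>(e, u)\<close>; it is meaningful only for
  \<open>e \<in> edges B\<close> and \<open>u \<in> ends B e\<close>.
\<close>

record ('v, 'e) bigraph =
  verts :: "'v set"
  edges :: "'e set"
  ends :: "'e \<Rightarrow> 'v set"
  sg :: "'e \<Rightarrow> 'v \<Rightarrow> sign"

definition bidirected_graph :: "('v, 'e) bigraph \<Rightarrow> bool" where
  "bidirected_graph B \<longleftrightarrow> (\<forall>e\<in>edges B. ends B e \<subseteq> verts B \<and> card (ends B e) = 2)"

definition finite_bigraph :: "('v, 'e) bigraph \<Rightarrow> bool" where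
  "finite_bigraph B \<longleftrightarrow> finite (verts B) \<and> finite (edges B)"

definition rooted :: "('v, 'e) bigraph \<Rightarrow> 'v \<Rightarrow> bool" where
  "rooted B r \<longleftrightarrow> bidirected_graph B \<and> r \<in> verts B"

definition subgraph :: "('v, 'e) bigraph \<Rightarrow> ('v, 'e) bigraph \<Rightarrow> bool" where
  "subgraph F B \<longleftrightarrow> bidirected_graph F \<and> verts F \<subseteq> verts B \<and> edges F \<subseteq> edges B \<and>
     (\<forall>e\<in>edges F. ends F e = ends B e \<and> (\<forall>u\<in>ends F e. sg F e u = sg B e u))"

definition spanning_subgraph :: "('v, 'e) bigraph \<Rightarrow> ('v, 'e) bigraph \<Rightarrow> bool" where
  "spanning_subgraph F B \<longleftrightarrow> subgraph F B \<and> verts F = verts B"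

text \<open>
  A trail \<open>v\<^sub>0 e\<^sub>1 v\<^sub>1 \<dots> e\<^sub>l v\<^sub>l\<close> is the pair of the lists \<open>[v\<^sub>0, \<dots>, v\<^sub>l]\<close> and \<open>[e\<^sub>1, \<dots>, e\<^sub>l]\<close>,
  so that the edge \<open>es ! i\<close> is oriented from its tail \<open>vs ! i\<close> to its head \<open>vs ! Suc i\<close>.
  As there are no loops, the vertex list determines the orientations.
\<close>

definition trail :: "('v, 'e) bigraph \<Rightarrow> 'v list \<times> 'e list \<Rightarrow> bool" where
  "trail B = (\<lambda>(vs, es).
     length vs = Suc (length es) \<and> set vs \<subseteq> verts B \<and> set es \<subseteq> edges B \<and> distinct es \<and>
     (\<forall>i<length es. ends B (es ! i) = {vs ! i, vs ! Suc i}) \<and>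
     (\<forall>i. Suc i < length es \<longrightarrow>
        sg B (es ! Suc i) (vs ! Suc i) = neg (sg B (es ! i) (vs ! Suc i))))"

definition trivial_trail :: "'v list \<times> 'e list \<Rightarrow> bool" where
  "trivial_trail = (\<lambda>(vs, es). es = [])"

definition trail_from_to :: "('v, 'e) bigraph \<Rightarrow> 'v \<Rightarrow> 'v \<Rightarrow> 'v list \<times> 'e list \<Rightarrow> bool" where
  "trail_from_to B v w p \<longleftrightarrow> trail B p \<and> hd (fst p) = v \<and> last (fst p) = w"

definition path :: "('v, 'e) bigraph \<Rightarrow> 'v list \<times> 'e list \<Rightarrow> bool" where
  "path B p \<longleftrightarrow> trail B p \<and> distinct (fst p)"

definition signed_path ::
    "('v, 'e) bigraph \<Rightarrow> 'v \<Rightarrow> 'v \<Rightarrow> sign \<Rightarrow> 'v list \<times> 'e list \<Rightarrow> bool" where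
  "signed_path B v w \<alpha> p \<longleftrightarrow> path B p \<and> trail_from_to B v w p \<and>
     \<not> trivial_trail p \<and> sg B (last (snd p)) w = \<alpha>"

definition almost_path :: "('v, 'e) bigraph \<Rightarrow> 'v list \<times> 'e list \<Rightarrow> bool" where
  "almost_path B p \<longleftrightarrow> trail B p \<and>
     (trivial_trail p \<or> path B (butlast (fst p), butlast (snd p)))"

definition clean :: "('v, 'e) bigraph \<Rightarrow> 'v \<Rightarrow> bool" where
  "clean B r \<longleftrightarrow>
     \<not> (\<exists>p. almost_path B p \<and> trail_from_to B r r p \<and> \<not> trivial_trail p)"

definition internal_verts :: "'v list \<times> 'e list \<Rightarrow> 'v set" where
  "internal_verts p = set (butlast (tl (fst p)))"

definition disjoint_signed_paths ::
    "('v, 'e) bigraph \<Rightarrow> 'v \<Rightarrow> 'v \<Rightarrow> sign \<Rightarrow> ('v list \<times> 'e list) set \<Rightarrow> bool" where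
  "disjoint_signed_paths B v w \<alpha> P \<longleftrightarrow> (\<forall>p\<in>P. signed_path B v w \<alpha> p) \<and>
     (\<forall>p\<in>P. \<forall>q\<in>P. p \<noteq> q \<longrightarrow> internal_verts p \<inter> internal_verts q = {})"

text \<open>
  Paths are compared as sequences, edges included; so parallel edges from \<open>v\<close> to \<open>w\<close> with
  sign \<open>\<alpha>\<close> at \<open>w\<close> each count. In a finite graph the maximum exists: see \<open>kappa_attained\<close> and
  \<open>kappa_upper\<close>.
\<close>

definition kappa :: "('v, 'e) bigraph \<Rightarrow> sign \<Rightarrow> 'v \<Rightarrow> 'v \<Rightarrow> nat" where
  "kappa B \<alpha> v w = Max {card P | P. disjoint_signed_paths B v w \<alpha> P}"

definition vertex_flame :: "('v, 'e) bigraph \<Rightarrow> 'v \<Rightarrow> bool" where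
  "vertex_flame F r \<longleftrightarrow> rooted F r \<and>
     card (edges F) \<le> (\<Sum>v\<in>verts F - {r}. \<Sum>\<alpha>\<in>{Plus, Minus}. kappa F \<alpha> r v)"

lemma finite_signed_paths:
  assumes "finite_bigraph B"
  shows "finite {p. signed_path B v w \<alpha> p}"
proof (rule finite_subset)
  let ?n = "card (edges B)"
  show "{p. signed_path B v w \<alpha> p} \<subseteq>
      {vs. set vs \<subseteq> verts B \<and> length vs \<le> Suc ?n} \<times> {es. set es \<subseteq> edges B \<and> length es \<le> ?n}"
    using assms
    by (auto simp: signed_path_def path_def trail_def finite_bigraph_def card_mono
        simp flip: distinct_card)
  show "finite ({vs. set vs \<subseteq> verts B \<and> length vs \<le> Suc ?n} \<times>
      {es. set es \<subseteq> edges B \<and> length es \<le> ?n})"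
    using assms by (simp add: finite_bigraph_def finite_lists_length_le)
qed

lemma finite_kappa_set:
  assumes "finite_bigraph B"
  shows "finite {card P | P. disjoint_signed_paths B v w \<alpha> P}"
proof (rule finite_subset)
  show "{card P | P. disjoint_signed_paths B v w \<alpha> P} \<subseteq> card ` Pow {p. signed_path B v w \<alpha> p}"
    by (auto simp: disjoint_signed_paths_def)
  show "finite (card ` Pow {p. signed_path B v w \<alpha> p})"
    using finite_signed_paths[OF assms] by simp
qed

lemma kappa_attained:
  assumes "finite_bigraph B"
  shows "\<exists>P. finite P \<and> disjoint_signed_paths B v w \<alpha> P \<and> card P = kappa B \<alpha> v w"
proof -
  have "disjoint_signed_paths B v w \<alpha> {}"
    by (simp add: disjoint_signed_paths_def)
  then have "kappa B \<alpha> v w \<in> {card P | P. disjoint_signed_paths B v w \<alpha> P}"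
    unfolding kappa_def by (intro Max_in finite_kappa_set assms) blast
  then obtain P where "disjoint_signed_paths B v w \<alpha> P" "card P = kappa B \<alpha> v w"
    by auto
  moreover from this(1) have "finite P"
    by (intro finite_subset[OF _ finite_signed_paths[OF assms]])
      (auto simp: disjoint_signed_paths_def)
  ultimately show ?thesis by blast
qed

lemma kappa_upper:
  assumes "finite_bigraph B" "disjoint_signed_paths B v w \<alpha> P"
  shows "card P \<le> kappa B \<alpha> v w"
  unfolding kappa_def using assms by (intro Max_ge finite_kappa_set) auto

end

(*
  Split every vertex v other than r into two nodes, one per sign, joined by an edge, and give every
  half-edge at r a leaf of its own. Systems of internally disjoint signed paths from r correspond to
  matchings, and B is clean iff the matching M formed by the edges inside the vertices is maximum.
  The node of v with sign -a lies in the set D of the Gallai-Edmonds decomposition iff there is a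
  path from r to v with last sign a.

  Take F minimal with the same connectivities as B, so that every edge e of F is critical for some
  target. If an end (v, a) of e is not in D, then e can only be traversed towards v, and exchanging
  a path system through e with a maximum system to v shows that e is critical for (v, a) itself; at
  most kappa(v, a) edges are. An edge with both ends in D is not critical as long as its removal
  preserves D: it lies inside a component of D, which is factor-critical and left by at most one
  edge of any maximum matching. Finally, at most as many edges as there are reachable pairs (v, a)
  suffice to produce all of D, by adding edges as long as D grows: an edge whose addition does not
  change D has both ends in one component of D or at most one end in D, and such edges do not change
  D collectively either. Counting these edges once for each reachable pair and the others by
  criticality, one of the latter being already counted at each pair, gives |E(F)| <= sum of kappa.
*)
theory Submission
  imports Defs
begin

section \<open>Matchings and the Gallai--Edmonds set\<close>

text \<open>The obstacle is that different path systems may traverse an edge in opposite directions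
  when both its ends lie in \<open>D\<close>, so it cannot be charged to either end. Such edges must
  be removable without loss. This works because at least two paths to \<open>(w, s)\<close> force
  \<open>Node w s\<close> out of \<open>D\<close>: the edges at the target then stay clear of the
  component that is being rearranged. The leaf set \<open>S\<close> is a parameter because the same
  edges are read in several auxiliary graphs: with leaves only at \<open>r\<close>, where
  \<open>D\<close> is defined and every maximum matching has \<open>n\<close> edges whatever the
  edge set; with leaves also at one target, where matchings encode path systems; and with leaves at
  two targets, where two systems are exchanged. Signs flip between the two readings: a path entering
  \<open>w\<close> with sign \<open>s\<close> occupies \<open>Node w s\<close> and exposes
  \<open>Node w (neg s)\<close>, so reachability of \<open>(w, s)\<close> is membership of the
  opposite node in \<open>D\<close>. All exchange arguments record only which vertices are covered;
  alternating paths never appear explicitly.\<close>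

definition covered :: "('l \<Rightarrow> 'a set) \<Rightarrow> 'l set \<Rightarrow> 'a set" where
  "covered en N = (\<Union>l\<in>N. en l)"

definition disjoint_ends :: "('l \<Rightarrow> 'a set) \<Rightarrow> 'l set \<Rightarrow> bool" where
  "disjoint_ends en N \<longleftrightarrow> (\<forall>l\<in>N. \<forall>l'\<in>N. l \<noteq> l' \<longrightarrow> en l \<inter> en l' = {})"

definition multigraph :: "('l \<Rightarrow> 'a set) \<Rightarrow> 'l set \<Rightarrow> bool" where
  "multigraph en L \<longleftrightarrow> finite L \<and> (\<forall>l\<in>L. card (en l) = 2)"

definition matching :: "('l \<Rightarrow> 'a set) \<Rightarrow> 'l set \<Rightarrow> 'l set \<Rightarrow> bool" where
  "matching en L N \<longleftrightarrow> N \<subseteq> L \<and> disjoint_ends en N"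

definition max_matching :: "('l \<Rightarrow> 'a set) \<Rightarrow> 'l set \<Rightarrow> 'l set \<Rightarrow> bool" where
  "max_matching en L N \<longleftrightarrow> matching en L N \<and> (\<forall>N'. matching en L N' \<longrightarrow> card N' \<le> card N)"

text \<open>The set \<open>D\<close> of the Gallai--Edmonds decomposition.\<close>

definition missable :: "('l \<Rightarrow> 'a set) \<Rightarrow> 'l set \<Rightarrow> 'a set" where
  "missable en L = {x. \<exists>N. max_matching en L N \<and> x \<notin> covered en N}"

lemma covered_insert [simp]: "covered en (insert l N) = en l \<union> covered en N"
  by (simp add: covered_def)

lemma covered_empty [simp]: "covered en {} = {}"
  by (simp add: covered_def)

lemma covered_Un: "covered en (N \<union> N') = covered en N \<union> covered en N'"
  by (simp add: covered_def)

lemma covered_mono: "N \<subseteq> N' \<Longrightarrow> covered en N \<subseteq> covered en N'"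
  by (auto simp: covered_def)

lemma disjoint_ends_subset: "disjoint_ends en N \<Longrightarrow> N' \<subseteq> N \<Longrightarrow> disjoint_ends en N'"
  by (auto simp: disjoint_ends_def)

lemma disjoint_ends_insert:
  "disjoint_ends en N \<Longrightarrow> en l \<inter> covered en N = {} \<Longrightarrow> disjoint_ends en (insert l N)"
  unfolding disjoint_ends_def covered_def by blast

lemma disjoint_ends_Un:
  "disjoint_ends en N \<Longrightarrow> disjoint_ends en N' \<Longrightarrow> covered en N \<inter> covered en N' = {} \<Longrightarrow>
    disjoint_ends en (N \<union> N')"
  unfolding disjoint_ends_def covered_def by blast

lemma covered_diff:
  assumes "disjoint_ends en N" "N' \<subseteq> N"
  shows "covered en (N - N') = covered en N - covered en N'"
proof -
  have False if "l \<in> N - N'" "l' \<in> N'" "x \<in> en l" "x \<in> en l'" for l l' x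
  proof -
    have "l \<in> N" "l' \<in> N" "l \<noteq> l'" using that assms(2) by auto
    then have "en l \<inter> en l' = {}" using assms(1) unfolding disjoint_ends_def by simp
    then show False using that by auto
  qed
  then show ?thesis unfolding covered_def by blast
qed

lemma covered_remove:
  assumes "disjoint_ends en N" "l \<in> N"
  shows "covered en (N - {l}) = covered en N - en l"
  using covered_diff[OF assms(1), of "{l}"] assms(2) by simp

lemma multigraph_subset: "multigraph en L \<Longrightarrow> L' \<subseteq> L \<Longrightarrow> multigraph en L'"
  by (auto simp: multigraph_def intro: finite_subset)

lemma matching_multigraph: "multigraph en L \<Longrightarrow> matching en L N \<Longrightarrow> multigraph en N"
  by (auto simp: matching_def intro: multigraph_subset)

lemma matching_mono: "matching en L N \<Longrightarrow> L \<subseteq> L' \<Longrightarrow> matching en L' N"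
  by (auto simp: matching_def)

lemma card_covered:
  assumes "multigraph en N" "disjoint_ends en N"
  shows "card (covered en N) = 2 * card N" "finite (covered en N)"
proof -
  have fin: "\<forall>l\<in>N. finite (en l)"
    using assms(1) by (auto simp: multigraph_def intro: card_ge_0_finite)
  have "card (\<Union>l\<in>N. en l) = (\<Sum>l\<in>N. card (en l))"
    using assms fin by (intro card_UN_disjoint) (auto simp: multigraph_def disjoint_ends_def)
  then show "card (covered en N) = 2 * card N"
    using assms(1) by (simp add: multigraph_def covered_def)
  show "finite (covered en N)"
    using assms(1) fin by (auto simp: multigraph_def covered_def)
qed

lemma ends_other:
  assumes "multigraph en N" "l \<in> N" "x \<in> en l"
  obtains y where "en l = {x, y}" "x \<noteq> y"
proof -
  have "card (en l) = 2" using assms by (auto simp: multigraph_def)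
  then obtain p q where "en l = {p, q}" "p \<noteq> q" by (meson card_2_iff)
  then show thesis using that assms(3) by (metis insert_commute insert_iff singletonD)
qed

text \<open>
  Swapping two matchings along the component of their symmetric difference that starts at \<open>s\<close>;
  \<open>t\<close> is the other end of that component.
\<close>

definition exchanged ::
    "('l \<Rightarrow> 'a set) \<Rightarrow> 'l set \<Rightarrow> 'l set \<Rightarrow> 'a \<Rightarrow> 'l set \<Rightarrow> 'l set \<Rightarrow> 'a \<Rightarrow> bool" where
  "exchanged en N N' s N1 N1' t \<longleftrightarrow>
    N1 \<union> N1' \<subseteq> N \<union> N' \<and> disjoint_ends en N1 \<and> disjoint_ends en N1' \<and> t \<noteq> s \<and>
    (t \<in> covered en N' \<and> t \<notin> covered en N \<and>
       covered en N1 = covered en N \<union> {s, t} \<and> covered en N1' = covered en N' - {s, t} \<or>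
     t \<in> covered en N \<and> t \<notin> covered en N' \<and>
       covered en N1 = covered en N \<union> {s} - {t} \<and> covered en N1' = covered en N' - {s} \<union> {t})"

text \<open>The component of \<open>s\<close> in the symmetric difference is a path, because only
  \<open>N'\<close> covers \<open>s\<close>. The induction peels off its first two edges,
  \<open>l\<close> in \<open>N'\<close> and \<open>m\<close> in \<open>N\<close>: the far end
  \<open>y\<close> of \<open>m\<close> is then covered by \<open>N' - {l}\<close> and missed by
  \<open>N - {m}\<close>, so it takes over the role of \<open>s\<close>.\<close>

lemma matching_exchange:
  assumes "multigraph en N" "multigraph en N'" "disjoint_ends en N" "disjoint_ends en N'"
    and "s \<in> covered en N'" "s \<notin> covered en N"
  shows "\<exists>N1 N1' t. exchanged en N N' s N1 N1' t"
  using assms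
proof (induction "card N" arbitrary: N N' s rule: less_induct)
  case less
  obtain l where l: "l \<in> N'" "s \<in> en l" using less.prems(5) by (auto simp: covered_def)
  obtain x where x: "en l = {s, x}" "s \<noteq> x" using ends_other[OF less.prems(2) l] .
  have cl: "covered en (N' - {l}) = covered en N' - {s, x}"
    using covered_remove[OF less.prems(4) l(1)] x by simp
  have xN': "x \<in> covered en N'" using l x by (auto simp: covered_def)
  have dl: "disjoint_ends en (N' - {l})" using less.prems(4) by (rule disjoint_ends_subset) auto
  show ?case
  proof (cases "x \<in> covered en N")
    case False
    have "disjoint_ends en (insert l N)"
      using less.prems(3,6) False x by (intro disjoint_ends_insert) auto
    then have "exchanged en N N' s (insert l N) (N' - {l}) x"
      using l x cl dl False xN' by (auto simp: exchanged_def)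
    then show ?thesis by blast
  next
    case True
    then obtain m where m: "m \<in> N" "x \<in> en m" by (auto simp: covered_def)
    obtain y where y: "en m = {x, y}" "x \<noteq> y" using ends_other[OF less.prems(1) m] .
    have cm: "covered en (N - {m}) = covered en N - {x, y}"
      using covered_remove[OF less.prems(3) m(1)] y by simp
    have dm: "disjoint_ends en (N - {m})" using less.prems(3) by (rule disjoint_ends_subset) auto
    have yN: "y \<in> covered en N" using m y by (auto simp: covered_def)
    have ys: "y \<noteq> s" using yN less.prems(6) by auto
    show ?thesis
    proof (cases "y \<in> covered en N'")
      case False
      have "disjoint_ends en (insert l (N - {m}))"
        using dm less.prems(6) x cm by (intro disjoint_ends_insert) auto
      moreover have "disjoint_ends en (insert m (N' - {l}))"
        using dl y cl False by (intro disjoint_ends_insert) auto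
      moreover have "covered en (insert l (N - {m})) = covered en N \<union> {s} - {y}"
        using cm x y ys True less.prems(6) by auto
      moreover have "covered en (insert m (N' - {l})) = covered en N' - {s} \<union> {y}"
        using cl x y ys xN' by auto
      moreover have "insert l (N - {m}) \<union> insert m (N' - {l}) \<subseteq> N \<union> N'" using l m by auto
      ultimately have "exchanged en N N' s (insert l (N - {m})) (insert m (N' - {l})) y"
        unfolding exchanged_def using yN ys False by blast
      then show ?thesis by blast
    next
      case yN': True
      have "card (N - {m}) < card N"
        using m less.prems(1) by (intro card_Diff1_less) (auto simp: multigraph_def)
      moreover have "y \<in> covered en (N' - {l})" "y \<notin> covered en (N - {m})"
        using cl cm yN' y ys by auto
      ultimately obtain N1 N1' t where I: "exchanged en (N - {m}) (N' - {l}) y N1 N1' t"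
        using less.hyps[of "N - {m}" "N' - {l}" y] dm dl
          multigraph_subset[OF less.prems(1), of "N - {m}"]
          multigraph_subset[OF less.prems(2), of "N' - {l}"] by blast
      from I have dj: "disjoint_ends en N1" "disjoint_ends en N1'"
        and sub: "N1 \<union> N1' \<subseteq> N \<union> N'" and ty: "t \<noteq> y"
        unfolding exchanged_def by blast+
      have "t \<noteq> s \<and> t \<noteq> x \<and> {s, x} \<inter> covered en N1 = {} \<and> {x, y} \<inter> covered en N1' = {} \<and>
       (t \<in> covered en N' \<and> t \<notin> covered en N \<and>
           covered en (insert l N1) = covered en N \<union> {s, t} \<and>
           covered en (insert m N1') = covered en N' - {s, t} \<or>
         t \<in> covered en N \<and> t \<notin> covered en N' \<and>
           covered en (insert l N1) = covered en N \<union> {s} - {t} \<and>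
           covered en (insert m N1') = covered en N' - {s} \<union> {t})"
      proof (cases "t \<in> covered en (N' - {l})")
        case t: True
        then have "covered en N1 = covered en N - {x, y} \<union> {y, t}"
          "covered en N1' = covered en N' - {s, x} - {y, t}" "t \<notin> covered en N - {x, y}"
          "t \<in> covered en N' - {s, x}"
          using I cm cl unfolding exchanged_def by metis+
        moreover from this have "t \<notin> covered en N" using ty by blast
        ultimately show ?thesis
          using x y ys ty yN yN' xN' True less.prems(5,6) unfolding covered_insert by auto
      next
        case t: False
        then have "covered en N1 = covered en N - {x, y} \<union> {y} - {t}"
          "covered en N1' = covered en N' - {s, x} - {y} \<union> {t}" "t \<in> covered en N - {x, y}"
          "t \<notin> covered en N' - {s, x}"
          using I cm cl unfolding exchanged_def by metis+
        moreover from this have "t \<notin> covered en N'" using less.prems(6) by blast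
        ultimately show ?thesis
          using x y ys ty yN yN' xN' True less.prems(5,6) unfolding covered_insert by auto
      qed
      then have tsx: "t \<noteq> s" and sN1: "{s, x} \<inter> covered en N1 = {}" "{x, y} \<inter> covered en N1' = {}"
        and cov: "t \<in> covered en N' \<and> t \<notin> covered en N \<and>
           covered en (insert l N1) = covered en N \<union> {s, t} \<and>
           covered en (insert m N1') = covered en N' - {s, t} \<or>
         t \<in> covered en N \<and> t \<notin> covered en N' \<and>
           covered en (insert l N1) = covered en N \<union> {s} - {t} \<and>
           covered en (insert m N1') = covered en N' - {s} \<union> {t}"
        by blast+
      have "disjoint_ends en (insert l N1)" "disjoint_ends en (insert m N1')"
        using dj sN1 x(1) y(1) by (auto intro!: disjoint_ends_insert)
      moreover have "insert l N1 \<union> insert m N1' \<subseteq> N \<union> N'"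
        using sub l m by blast
      ultimately have "exchanged en N N' s (insert l N1) (insert m N1') t"
        unfolding exchanged_def using tsx cov by blast
      then show ?thesis by blast
    qed
  qed
qed

text \<open>The sizes are read off the covered sets, since a matching covers twice as many vertices
  as it has edges. In \<open>gain\<close> the path has an odd number of edges and \<open>N\<close>
  grows at the expense of \<open>N'\<close>, which is impossible for maximum \<open>N\<close>; in
  \<open>loss\<close> it is even, and \<open>s\<close> and \<open>t\<close> trade places.\<close>

lemma matching_exchange_card:
  assumes L: "multigraph en L" and N: "matching en L N" and N': "matching en L N'"
    and "s \<in> covered en N'" "s \<notin> covered en N"
  obtains (gain) N1 N1' t where
    "matching en L N1" "matching en L N1'" "N1 \<union> N1' \<subseteq> N \<union> N'" "t \<noteq> s"
    "t \<in> covered en N'" "t \<notin> covered en N"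
    "covered en N1 = covered en N \<union> {s, t}" "covered en N1' = covered en N' - {s, t}"
    "card N1 = Suc (card N)" "Suc (card N1') = card N'"
  | (loss) N1 N1' t where
    "matching en L N1" "matching en L N1'" "N1 \<union> N1' \<subseteq> N \<union> N'" "t \<noteq> s"
    "t \<in> covered en N" "t \<notin> covered en N'"
    "covered en N1 = covered en N \<union> {s} - {t}" "covered en N1' = covered en N' - {s} \<union> {t}"
    "card N1 = card N" "card N1' = card N'"
proof -
  have mg: "multigraph en N" "multigraph en N'" using matching_multigraph[OF L] N N' by auto
  have dj: "disjoint_ends en N" "disjoint_ends en N'" using N N' by (auto simp: matching_def)
  obtain N1 N1' t where I: "N1 \<union> N1' \<subseteq> N \<union> N'" "disjoint_ends en N1" "disjoint_ends en N1'"
    "t \<noteq> s"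
    "t \<in> covered en N' \<and> t \<notin> covered en N \<and>
       covered en N1 = covered en N \<union> {s, t} \<and> covered en N1' = covered en N' - {s, t} \<or>
     t \<in> covered en N \<and> t \<notin> covered en N' \<and>
       covered en N1 = covered en N \<union> {s} - {t} \<and> covered en N1' = covered en N' - {s} \<union> {t}"
    using matching_exchange[OF mg dj assms(4,5)] unfolding exchanged_def by metis
  have M1: "matching en L N1" "matching en L N1'" using I N N' by (auto simp: matching_def)
  have c: "card (covered en N1) = 2 * card N1" "card (covered en N1') = 2 * card N1'"
    "card (covered en N) = 2 * card N" "card (covered en N') = 2 * card N'"
    using card_covered(1) mg dj I(2,3) matching_multigraph[OF L] M1 by metis+
  have f: "finite (covered en N)" "finite (covered en N')" using card_covered(2) mg dj by metis+
  from I(5) show thesis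
  proof (elim disjE conjE)
    assume t: "t \<in> covered en N'" "t \<notin> covered en N"
      "covered en N1 = covered en N \<union> {s, t}" "covered en N1' = covered en N' - {s, t}"
    have "2 * card N1 = 2 * card N + 2"
      using c t f assms(5) I(4) by (simp add: card_insert_if)
    moreover have "card (covered en N' - {s, t}) = card (covered en N') - card {s, t}"
      using t assms(4) by (intro card_Diff_subset) auto
    moreover have "card {s, t} \<le> card (covered en N')" using t assms(4) f by (intro card_mono) auto
    ultimately show thesis using gain[OF M1 I(1) I(4) t] c t I(4) by simp
  next
    assume t: "t \<in> covered en N" "t \<notin> covered en N'"
      "covered en N1 = covered en N \<union> {s} - {t}" "covered en N1' = covered en N' - {s} \<union> {t}"
    have "2 * card N1 = 2 * card N" using c t f assms(5) I(4) by simp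
    moreover have "2 * card N1' = 2 * card N'"
      using c t f assms(4) I(4) card_gt_0_iff[of "covered en N'"] by (auto simp: card_insert_if)
    ultimately show thesis using loss[OF M1 I(1) I(4) t] by simp
  qed
qed

section \<open>Maximum matchings and the deletion of a vertex outside \<open>D\<close>\<close>

lemma max_matching_exists:
  assumes "multigraph en L"
  obtains N where "max_matching en L N"
proof -
  have "matching en L {}" by (simp add: matching_def disjoint_ends_def)
  moreover have "\<forall>N. matching en L N \<longrightarrow> card N < Suc (card L)"
    using assms by (auto simp: matching_def multigraph_def less_Suc_eq_le intro: card_mono)
  ultimately show thesis
    using ex_has_greatest_nat[of "matching en L" "{}" card "Suc (card L)"] that
    by (auto simp: max_matching_def)
qed

lemma max_matching_card: "max_matching en L N \<Longrightarrow> max_matching en L N' \<Longrightarrow> card N = card N'"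
  by (meson max_matching_def le_antisym)

lemma max_matchingI: "max_matching en L N \<Longrightarrow> matching en L N' \<Longrightarrow> card N \<le> card N' \<Longrightarrow> max_matching en L N'"
  by (meson max_matching_def order_trans)

lemma missableI: "max_matching en L N \<Longrightarrow> x \<notin> covered en N \<Longrightarrow> x \<in> missable en L"
  by (auto simp: missable_def)

lemma matching_insert:
  "matching en L N \<Longrightarrow> l \<in> L \<Longrightarrow> en l \<inter> covered en N = {} \<Longrightarrow> matching en L (insert l N)"
  by (auto simp: matching_def intro: disjoint_ends_insert)

lemma matching_remove: "matching en L N \<Longrightarrow> matching en L (N - N')"
  by (auto simp: matching_def intro: disjoint_ends_subset)

lemma card_insert_uncovered:
  assumes "multigraph en L" "matching en L N" "l \<in> L" "en l \<inter> covered en N = {}"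
  shows "card (insert l N) = Suc (card N)"
proof -
  have "en l \<noteq> {}" using assms(1,3) by (auto simp: multigraph_def)
  then have "l \<notin> N" using assms(4) by (auto simp: covered_def)
  then show ?thesis using assms(1,2) by (auto simp: matching_def multigraph_def finite_subset)
qed

lemma max_matching_no_free_edge:
  assumes "multigraph en L" "max_matching en L N" "l \<in> L"
  shows "en l \<inter> covered en N \<noteq> {}"
proof
  assume e: "en l \<inter> covered en N = {}"
  have m: "matching en L N" using assms(2) by (simp add: max_matching_def)
  show False
    using card_insert_uncovered[OF assms(1) m assms(3) e] matching_insert[OF m assms(3) e] assms(2)
    by (fastforce simp: max_matching_def)
qed

definition del_vertex :: "('l \<Rightarrow> 'a set) \<Rightarrow> 'l set \<Rightarrow> 'a \<Rightarrow> 'l set" where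
  "del_vertex en L a = {l \<in> L. a \<notin> en l}"

lemma matching_del_vertex:
  "matching en (del_vertex en L a) N \<longleftrightarrow> matching en L N \<and> a \<notin> covered en N"
  by (auto simp: matching_def del_vertex_def covered_def)

lemma del_vertex_max_matching:
  assumes L: "multigraph en L" and a: "a \<notin> missable en L" and N: "max_matching en L N"
    and l: "l \<in> N" "a \<in> en l"
  shows "max_matching en (del_vertex en L a) (N - {l})"
proof -
  have mN: "matching en L N" using N by (simp add: max_matching_def)
  have cv: "covered en (N - {l}) = covered en N - en l"
    using mN l by (intro covered_remove) (auto simp: matching_def)
  have fin: "finite N" using matching_multigraph[OF L mN] by (simp add: multigraph_def)
  have "card N' \<le> card (N - {l})" if "matching en (del_vertex en L a) N'" for N'
  proof -
    have m: "matching en L N'" "a \<notin> covered en N'" using that by (auto simp: matching_del_vertex)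
    then have "\<not> card N \<le> card N'"
      using a missableI max_matchingI[OF N] by metis
    then show ?thesis using l fin by simp
  qed
  moreover have "matching en (del_vertex en L a) (N - {l})"
    using matching_remove[OF mN] cv l by (auto simp: matching_del_vertex)
  ultimately show ?thesis by (auto simp: max_matching_def)
qed

text \<open>The stability lemma of Gallai--Edmonds theory. The vertex \<open>a\<close> joins the set
  because no remaining edge meets it. No other vertex does: a maximum matching of the rest that
  misses \<open>x\<close> is exchanged, from \<open>x\<close> on, with a maximum matching that
  misses \<open>p\<close>; if the exchange ends at \<open>a\<close>, adding \<open>e\<close>
  restores the maximum size, with \<open>x\<close> now missed.\<close>

lemma missable_del_vertex:
  assumes L: "multigraph en L" and a: "a \<notin> missable en L"
    and e: "e \<in> L" "en e = {a, p}" "p \<in> missable en L"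
  shows "missable en (del_vertex en L a) = insert a (missable en L)"
proof (intro equalityI subsetI)
  fix x assume "x \<in> insert a (missable en L)"
  moreover have "\<exists>N. max_matching en L N \<and> (x \<in> missable en L \<longrightarrow> x \<notin> covered en N)"
    by (cases "x \<in> missable en L") (auto simp: missable_def intro: max_matching_exists[OF L])
  then obtain N where N: "max_matching en L N" "x \<in> missable en L \<Longrightarrow> x \<notin> covered en N" by blast
  moreover obtain l where l: "l \<in> N" "a \<in> en l"
    using a N(1) by (auto simp: missable_def covered_def)
  moreover have "a \<notin> covered en (N - {l})"
    using covered_remove[of en N l] l N(1) by (auto simp: max_matching_def matching_def)
  ultimately show "x \<in> missable en (del_vertex en L a)"
    using missableI[OF del_vertex_max_matching[OF L a N(1) l], of x]
      covered_mono[of "N - {l}" N en] by auto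
next
  fix x assume "x \<in> missable en (del_vertex en L a)"
  then obtain N where N: "max_matching en (del_vertex en L a) N" "x \<notin> covered en N"
    by (auto simp: missable_def)
  have mN: "matching en L N" "a \<notin> covered en N"
    using N(1) by (auto simp: max_matching_def matching_del_vertex)
  obtain O' where O': "max_matching en L O'" "p \<notin> covered en O'"
    using e(3) by (auto simp: missable_def)
  have mO: "matching en L O'" using O' by (simp add: max_matching_def)
  obtain l where l: "l \<in> O'" "a \<in> en l"
    using a O'(1) by (auto simp: missable_def covered_def)
  have cN: "Suc (card N) = card O'"
  proof -
    have "finite O'" using matching_multigraph[OF L mO] by (simp add: multigraph_def)
    then show ?thesis
      using max_matching_card[OF N(1) del_vertex_max_matching[OF L a O'(1) l]] l
      by (metis card_Suc_Diff1)
  qed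
  show "x \<in> insert a (missable en L)"
  proof (rule ccontr)
    assume "\<not> ?thesis"
    then have xa: "x \<noteq> a" and xD: "x \<notin> missable en L" by auto
    have "x \<in> covered en O'" using xD O'(1) by (auto simp: missable_def)
    from L mN(1) mO this N(2) show False
    proof (cases rule: matching_exchange_card)
      case (gain N1 N1' t)
      show False
      proof (cases "t = a")
        case True
        have "en e \<inter> covered en N1' = {}" using e(2) gain True O'(2) by auto
        then have "matching en L (insert e N1')" "card (insert e N1') = card O'"
          using gain(2,10) e(1) L by (auto intro: matching_insert simp: card_insert_uncovered)
        moreover have "x \<notin> covered en (insert e N1')" using gain True e(2) O'(2) xa \<open>x \<in> covered en O'\<close>
          by auto
        ultimately show False using xD missableI max_matchingI[OF O'(1)] by (metis order_refl)
      next
        case False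
        have "max_matching en L N1" using max_matchingI[OF O'(1) gain(1)] gain cN by simp
        moreover have "a \<notin> covered en N1" using gain mN(2) False xa by auto
        ultimately show False using a by (auto simp: missable_def)
      qed
    next
      case (loss N1 N1' t)
      have "max_matching en L N1'" using max_matchingI[OF O'(1) loss(2)] loss by simp
      moreover have "x \<notin> covered en N1'" using loss by auto
      ultimately show False using xD by (auto simp: missable_def)
    qed
  qed
qed

section \<open>Components of \<open>D\<close>: Gallai's lemma and factor-criticality\<close>

definition missable_step :: "('l \<Rightarrow> 'a set) \<Rightarrow> 'l set \<Rightarrow> 'a \<Rightarrow> 'a \<Rightarrow> bool" where
  "missable_step en L x y \<longleftrightarrow> x \<in> missable en L \<and> y \<in> missable en L \<and> (\<exists>l\<in>L. en l = {x, y})"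

abbreviation linked :: "('l \<Rightarrow> 'a set) \<Rightarrow> 'l set \<Rightarrow> 'a \<Rightarrow> 'a \<Rightarrow> bool" where
  "linked en L \<equiv> (missable_step en L)\<^sup>*\<^sup>*"

lemma missable_step_sym: "missable_step en L x y \<Longrightarrow> missable_step en L y x"
  by (auto simp: missable_step_def insert_commute)

lemma linked_sym: "linked en L x y \<Longrightarrow> linked en L y x"
  by (metis missable_step_sym symp_def symp_rtranclp)

lemma linked_missable: "linked en L x y \<Longrightarrow> x \<in> missable en L \<Longrightarrow> y \<in> missable en L"
  by (induction rule: rtranclp_induct) (auto simp: missable_step_def)

lemma linked_mono:
  assumes "linked en L x y" "missable en L \<subseteq> missable en L'"
    and "\<And>l u v. l \<in> L \<Longrightarrow> en l = {u, v} \<Longrightarrow> u \<in> missable en L \<Longrightarrow> v \<in> missable en L \<Longrightarrow> l \<in> L'"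
  shows "linked en L' x y"
  using assms(1)
proof (rule rtranclp_mono[THEN predicate2D, rotated])
  show "missable_step en L \<le> missable_step en L'"
    using assms(2,3) by (fastforce simp: missable_step_def)
qed

text \<open>Gallai's lemma. A maximum matching that missed \<open>x\<close> and \<open>y\<close>
  would cover the vertex \<open>z\<close> before \<open>y\<close>. Exchanging it at \<open>z\<close>
  with a maximum matching that misses \<open>z\<close> yields one that misses \<open>x\<close> and
  \<open>z\<close>, against the induction hypothesis, or, if the exchange ends at \<open>x\<close>,
  one that leaves the edge between \<open>z\<close> and \<open>y\<close> free.\<close>

lemma gallai:
  assumes L: "multigraph en L" and "linked en L x y" "x \<noteq> y"
    and "max_matching en L N" "x \<notin> covered en N"
  shows "y \<in> covered en N"
  using assms(2-)
proof (induction arbitrary: N rule: rtranclp_induct)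
  case base
  then show ?case by simp
next
  case (step z y)
  obtain l where l: "l \<in> L" "en l = {z, y}" "z \<in> missable en L"
    using step.hyps(2) by (auto simp: missable_step_def)
  show ?case
  proof (rule ccontr)
    assume y: "y \<notin> covered en N"
    have z: "z \<in> covered en N"
      using max_matching_no_free_edge[OF L step.prems(2) l(1)] l(2) y by auto
    then have xz: "x \<noteq> z" using step.prems by auto
    obtain O' where O': "max_matching en L O'" "z \<notin> covered en O'"
      using l(3) by (auto simp: missable_def)
    have m: "matching en L N" "matching en L O'" using step.prems O' by (auto simp: max_matching_def)
    from L m(2,1) z O'(2) show False
    proof (cases rule: matching_exchange_card)
      case (gain N1 N1' t)
      then show False using O'(1) by (auto simp: max_matching_def)
    next
      case (loss N1 N1' t)
      have N1': "max_matching en L N1'" using max_matchingI[OF step.prems(2) loss(2)] loss by simp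
      show False
      proof (cases "t = x")
        case True
        then have "en l \<inter> covered en N1' = {}" using loss l(2) y step.prems(1) by auto
        then show False using max_matching_no_free_edge[OF L N1' l(1)] by simp
      next
        case False
        then show False using step.IH[OF xz N1'] loss step.prems by auto
      qed
    qed
  qed
qed

text \<open>The same argument one edge below the maximum. Here \<open>w\<close> blocks augmentation:
  an addable edge with both ends in \<open>D\<close> would give a maximum matching that misses
  \<open>w\<close>.\<close>

lemma gallai_deficient:
  assumes L: "multigraph en L" and "linked en L x y" "x \<noteq> y" and M: "max_matching en L M"
    and w: "w \<notin> missable en L"
    and "matching en L N" "Suc (card N) = card M" "x \<notin> covered en N" "w \<notin> covered en N"
  shows "y \<in> covered en N"
  using assms(2,3,6-)
proof (induction arbitrary: N rule: rtranclp_induct)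
  case base
  then show ?case by simp
next
  case (step z y)
  obtain l where l: "l \<in> L" "en l = {z, y}" "z \<in> missable en L" "y \<in> missable en L"
    using step.hyps(2) by (auto simp: missable_step_def)
  have no_free: "en l \<inter> covered en N' \<noteq> {}"
    if N': "matching en L N'" "Suc (card N') = card M" "w \<notin> covered en N'" for N'
  proof
    assume "en l \<inter> covered en N' = {}"
    then have "matching en L (insert l N')" "card (insert l N') = card M"
      using N' L l(1) by (auto intro: matching_insert simp: card_insert_uncovered)
    moreover have "w \<notin> covered en (insert l N')" using N' l w by auto
    ultimately show False using w missableI max_matchingI[OF M] by (metis order_refl)
  qed
  show ?case
  proof (rule ccontr)
    assume y: "y \<notin> covered en N"
    have z: "z \<in> covered en N" using no_free[OF step.prems(2,3,5)] l(2) y by auto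
    then have xz: "x \<noteq> z" using step.prems by auto
    obtain O' where O': "max_matching en L O'" "z \<notin> covered en O'"
      using l(3) by (auto simp: missable_def)
    have m: "matching en L O'" using O' by (auto simp: max_matching_def)
    from L m step.prems(2) z O'(2) show False
    proof (cases rule: matching_exchange_card)
      case (gain N1 N1' t)
      then show False using O'(1) by (auto simp: max_matching_def)
    next
      case (loss N1 N1' t)
      \<comment> \<open>\<open>N1\<close> is maximum and misses \<open>t\<close>, so
        \<open>t\<close> is missable and differs from \<open>w\<close>; hence \<open>N1'\<close>
        still misses \<open>w\<close>.\<close>
      have "max_matching en L N1" using max_matchingI[OF O'(1) loss(1)] loss by simp
      from missableI[OF this] have "t \<in> missable en L" using loss by auto
      then have tw: "w \<notin> covered en N1'" using loss w step.prems by auto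
      have cd: "Suc (card N1') = card M" using loss step.prems by simp
      show False
      proof (cases "t = x")
        case True
        then have "en l \<inter> covered en N1' = {}" using loss l(2) y step.prems(1) by auto
        then show False using no_free[OF loss(2) cd tw] by simp
      next
        case False
        then show False using step.IH[OF xz loss(2) cd _ tw] loss step.prems by auto
      qed
    qed
  qed
qed



text \<open>A vertex not matched inside its component becomes uncovered when its partner is deleted.\<close>

lemma gallai_partners:
  assumes L: "multigraph en L" and N: "max_matching en L N"
    and xy: "linked en L x y" "x \<noteq> y" "x \<in> missable en L"
    and x: "x \<notin> covered en N \<or> (\<exists>l\<in>N. \<exists>a. en l = {x, a} \<and> a \<notin> missable en L)"
    and y: "y \<notin> covered en N \<or> (\<exists>l\<in>N. \<exists>a. en l = {y, a} \<and> a \<notin> missable en L)"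
  shows False
proof -
  \<comment> \<open>Deleting a partner \<open>a\<close> outside \<open>D\<close> adds only
    \<open>a\<close> to \<open>D\<close>, keeps all edges between missable vertices and uncovers
    \<open>u\<close>. Done for \<open>x\<close> and then for \<open>y\<close>, this leaves a
    matching that contradicts Gallai's lemma.\<close>
  have release: "\<exists>L' N'. multigraph en L' \<and> max_matching en L' N' \<and> linked en L' u v \<and> u \<in> missable en L' \<and>
      u \<notin> covered en N' \<and> covered en N' \<subseteq> covered en N \<and>
      (v \<notin> covered en N' \<or> (\<exists>l\<in>N'. \<exists>a. en l = {v, a} \<and> a \<notin> missable en L'))"
    if L: "multigraph en L" and N: "max_matching en L N"
      and uv: "linked en L u v" "u \<noteq> v" "u \<in> missable en L"
      and u: "u \<notin> covered en N \<or> (\<exists>l\<in>N. \<exists>a. en l = {u, a} \<and> a \<notin> missable en L)"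
      and v: "v \<notin> covered en N \<or> (\<exists>l\<in>N. \<exists>a. en l = {v, a} \<and> a \<notin> missable en L)"
    for L N u v
  proof (cases "u \<in> covered en N")
    case False
    then show ?thesis using that by blast
  next
    case True
    then obtain l a where l: "l \<in> N" "en l = {u, a}" "a \<notin> missable en L" using u by auto
    have mN: "matching en L N" using N by (simp add: max_matching_def)
    have lL: "l \<in> L" using mN l(1) by (auto simp: matching_def)
    let ?L = "del_vertex en L a"
    have D: "missable en ?L = insert a (missable en L)"
      using missable_del_vertex[OF L l(3) lL, of u] l uv(3) by (simp add: insert_commute)
    have M: "max_matching en ?L (N - {l})"
      using del_vertex_max_matching[OF L l(3) N l(1)] l by simp
    have cv: "covered en (N - {l}) = covered en N - {u, a}"
      using mN l covered_remove[of en N l] by (simp add: matching_def)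
    have "linked en ?L u v"
      using uv(1) by (rule linked_mono) (use D l(3) in \<open>auto simp: del_vertex_def\<close>)
    moreover have "v \<notin> covered en (N - {l}) \<or>
        (\<exists>m\<in>N - {l}. \<exists>b. en m = {v, b} \<and> b \<notin> missable en ?L)"
      using v
    proof (elim disjE bexE exE conjE)
      fix m b assume m: "m \<in> N" "en m = {v, b}" "b \<notin> missable en L"
      have va: "v \<noteq> a" using linked_missable[OF uv(1,3)] l(3) by auto
      have "m \<noteq> l" using m l uv va by (auto simp: doubleton_eq_iff)
      then have "en m \<inter> en l = {}" using m(1) l(1) mN by (auto simp: matching_def disjoint_ends_def)
      then show ?thesis using m \<open>m \<noteq> l\<close> l(2) D by auto
    qed (use cv in auto)
    ultimately show ?thesis
      using M D cv uv multigraph_subset[OF L, of ?L]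
      by (intro exI[of _ "?L"] exI[of _ "N - {l}"]) (auto simp: del_vertex_def)
  qed
  obtain L1 N1 where 1: "multigraph en L1" "max_matching en L1 N1" "linked en L1 x y"
    "x \<in> missable en L1" "x \<notin> covered en N1"
    "y \<notin> covered en N1 \<or> (\<exists>l\<in>N1. \<exists>a. en l = {y, a} \<and> a \<notin> missable en L1)"
    using release[OF L N xy x y] by blast
  obtain L2 N2 where 2: "multigraph en L2" "max_matching en L2 N2" "linked en L2 y x"
    "y \<notin> covered en N2" "covered en N2 \<subseteq> covered en N1"
    using release[OF 1(1,2) linked_sym[OF 1(3)] xy(2)[symmetric] linked_missable[OF 1(3,4)] 1(6)] 1(5)
    by blast
  show False using gallai[OF 2(1,3) xy(2)[symmetric] 2(2,4)] 2(5) 1(5) by blast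
qed

definition component :: "('l \<Rightarrow> 'a set) \<Rightarrow> 'l set \<Rightarrow> 'a \<Rightarrow> 'a set" where
  "component en L x = {y. linked en L x y}"


lemma component_iff: "y \<in> component en L x \<longleftrightarrow> linked en L x y"
  by (simp add: component_def)

lemma component_missable: "x \<in> missable en L \<Longrightarrow> component en L x \<subseteq> missable en L"
  unfolding component_def using linked_missable by fast

text \<open>An edge between two missable vertices never leaves a component. So a vertex not matched
  inside its component is uncovered or has its partner outside \<open>D\<close>, and
  \<open>gallai_partners\<close> excludes two of these.\<close>

lemma component_unmatched_unique:
  assumes L: "multigraph en L" and N: "max_matching en L N" and x: "x \<in> missable en L"
    and "d \<in> component en L x" "\<not> (\<exists>l\<in>N. d \<in> en l \<and> en l \<subseteq> component en L x)"
    and "d' \<in> component en L x" "\<not> (\<exists>l\<in>N. d' \<in> en l \<and> en l \<subseteq> component en L x)"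
  shows "d = d'"
proof (rule ccontr)
  assume ne: "d \<noteq> d'"
  have out: "c \<notin> covered en N \<or> (\<exists>l\<in>N. \<exists>a. en l = {c, a} \<and> a \<notin> missable en L)"
    if c: "c \<in> component en L x" "\<not> (\<exists>l\<in>N. c \<in> en l \<and> en l \<subseteq> component en L x)" for c
  proof (rule ccontr)
    assume n: "\<not> ?thesis"
    then obtain l where l: "l \<in> N" "c \<in> en l" by (auto simp: covered_def)
    have mN: "matching en L N" using N by (simp add: max_matching_def)
    obtain a where a: "en l = {c, a}" using ends_other[OF matching_multigraph[OF L mN] l] .
    then have "a \<in> missable en L" using n l by auto
    then have "missable_step en L c a"
      using a l mN c(1) component_missable[OF x] by (auto simp: missable_step_def matching_def)
    then have "a \<in> component en L x" using c(1) by (auto simp: component_def)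
    then show False using c l a by auto
  qed
  have "linked en L d d'" using assms(4,6) by (meson component_iff linked_sym rtranclp_trans)
  then show False
    using gallai_partners[OF L N _ ne] out[OF assms(4,5)] out[OF assms(6,7)] assms(4)
      component_missable[OF x] by blast
qed

text \<open>Factor-criticality: in a maximum matching that misses \<open>x\<close>, this vertex
  already is the one not matched inside the component.\<close>

lemma component_near_perfect:
  assumes L: "multigraph en L" and x: "x \<in> missable en L"
  obtains N where "N \<subseteq> L" "disjoint_ends en N" "covered en N = component en L x - {x}"
    "\<And>l. l \<in> N \<Longrightarrow> en l \<subseteq> component en L x"
proof -
  let ?K = "component en L x"
  obtain M where M: "max_matching en L M" "x \<notin> covered en M" using x by (auto simp: missable_def)
  have xK: "x \<in> ?K" by (simp add: component_def)
  let ?N = "{l \<in> M. en l \<subseteq> ?K}"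
  have "covered en ?N = ?K - {x}"
  proof (intro equalityI subsetI)
    fix y assume "y \<in> covered en ?N"
    then show "y \<in> ?K - {x}" using M(2) by (auto simp: covered_def)
  next
    fix y assume y: "y \<in> ?K - {x}"
    have "\<not> (\<exists>l\<in>M. x \<in> en l \<and> en l \<subseteq> ?K)" using M(2) by (auto simp: covered_def)
    then have "\<exists>l\<in>M. y \<in> en l \<and> en l \<subseteq> ?K"
      using component_unmatched_unique[OF L M(1) x xK, of y] y by auto
    then show "y \<in> covered en ?N" by (auto simp: covered_def)
  qed
  moreover have "?N \<subseteq> L" "disjoint_ends en ?N"
    using M(1) disjoint_ends_subset[of en M ?N] by (auto simp: max_matching_def matching_def)
  ultimately show thesis using that by blast
qed

lemma component_odd:
  assumes L: "multigraph en L" and x: "x \<in> missable en L"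
  shows "finite (component en L x)" "odd (card (component en L x))"
proof -
  obtain N where N: "N \<subseteq> L" "disjoint_ends en N" "covered en N = component en L x - {x}"
    using component_near_perfect[OF L x] .
  have c: "card (component en L x - {x}) = 2 * card N" "finite (component en L x - {x})"
    using card_covered[OF multigraph_subset[OF L N(1)] N(2)] N(3) by simp_all
  then show f: "finite (component en L x)" by simp
  have "card (component en L x) = Suc (card (component en L x - {x}))"
    using f by (intro card.remove) (simp_all add: component_def)
  then show "odd (card (component en L x))" using c by simp
qed

text \<open>Parity gives existence of \<open>z\<close>, as the component is odd and its inner
  matching edges cover an even number; \<open>component_unmatched_unique\<close> gives that no other
  vertex is left out.\<close>

lemma component_exposed_unique:
  assumes L: "multigraph en L" and N: "max_matching en L N" and x: "x \<in> missable en L"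
  obtains z where "z \<in> component en L x"
    "covered en {l \<in> N. en l \<subseteq> component en L x} = component en L x - {z}"
proof -
  let ?K = "component en L x"
  let ?N = "{l \<in> N. en l \<subseteq> ?K}"
  have mN: "matching en L N" using N by (simp add: max_matching_def)
  have "multigraph en ?N" "disjoint_ends en ?N"
    using matching_multigraph[OF L mN] mN by (auto simp: matching_def multigraph_def disjoint_ends_def)
  then have "even (card (covered en ?N))" using card_covered(1) by fastforce
  then have "covered en ?N \<noteq> ?K" using component_odd(2)[OF L x] by metis
  moreover have sub: "covered en ?N \<subseteq> ?K" by (auto simp: covered_def)
  ultimately obtain z where z: "z \<in> ?K" "z \<notin> covered en ?N" by blast
  have "y \<in> covered en ?N" if "y \<in> ?K" "y \<noteq> z" for y
    using component_unmatched_unique[OF L N x that(1) _ z(1)] z(2) that(2)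
    by (auto simp: covered_def)
  then show thesis using that z sub by blast
qed

section \<open>Edges whose addition leaves \<open>D\<close> unchanged\<close>

text \<open>The disjuncts are positions in the Gallai--Edmonds decomposition: both ends outside
  \<open>D\<close>; one end \<open>b\<close> in the separating set (outside \<open>D\<close> with a
  neighbour in \<open>D\<close>), wherever \<open>a\<close> lies; both ends in one component of
  \<open>D\<close>. Unlike the mere fact that adding \<open>e\<close> keeps \<open>D\<close>, this
  property visibly persists while other harmless edges are added.\<close>

definition harmless :: "('l \<Rightarrow> 'a set) \<Rightarrow> 'l set \<Rightarrow> 'l \<Rightarrow> bool" where
  "harmless en L e \<longleftrightarrow> (\<exists>a b. en e = {a, b} \<and> a \<noteq> b \<and>
     (a \<notin> missable en L \<and> b \<notin> missable en L \<or>
      b \<notin> missable en L \<and> (\<exists>p\<in>missable en L. \<exists>l\<in>L. en l = {b, p}) \<or>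
      a \<in> missable en L \<and> linked en L a b))"

text \<open>Adding \<open>e\<close> to \<open>N\<close> would reach the maximum size. With both ends
  outside \<open>D\<close>, exchanging \<open>N\<close> with \<open>M\<close> at \<open>a\<close>
  covers just one vertex besides \<open>a\<close>, so some maximum matching misses \<open>b\<close>
  or \<open>x\<close>. If \<open>b\<close> has a missable neighbour, \<open>N\<close> is maximum
  after deletion of \<open>b\<close> and the stability lemma applies. Inside one component,
  \<open>gallai_deficient\<close> does.\<close>

lemma harmless_deficient:
  assumes L: "multigraph en L" and h: "harmless en L e" and M: "max_matching en L M"
    and N: "matching en L N" "Suc (card N) = card M" "en e \<inter> covered en N = {}" "x \<notin> covered en N"
    and x: "x \<notin> en e"
  shows "x \<in> missable en L"
proof (rule ccontr)
  assume xD: "x \<notin> missable en L"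
  obtain a b where ab: "en e = {a, b}" "a \<noteq> b" 
     "a \<notin> missable en L \<and> b \<notin> missable en L \<or>
      b \<notin> missable en L \<and> (\<exists>p\<in>missable en L. \<exists>l\<in>L. en l = {b, p}) \<or>
      a \<in> missable en L \<and> linked en L a b"
    using h by (auto simp: harmless_def)
  have mM: "matching en L M" using M by (simp add: max_matching_def)
  from ab(3) show False
  proof (elim disjE conjE bexE)
    assume a: "a \<notin> missable en L" "b \<notin> missable en L"
    have aM: "a \<in> covered en M" "a \<notin> covered en N" using a M N(3) ab by (auto simp: missable_def)
    from L N(1) mM aM show False
    proof (cases rule: matching_exchange_card)
      case (gain N1 M1 t)
      then have N1: "max_matching en L N1" using max_matchingI[OF M] N(2) by simp
      have "b \<notin> covered en N1 \<or> x \<notin> covered en N1" using gain N(3,4) ab x by auto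
      then show False using missableI[OF N1] a xD by blast
    next
      case (loss N1 M1 t)
      then have "max_matching en L M1" using max_matchingI[OF M] by simp
      from missableI[OF this, of a] show False using loss a by auto
    qed
  next
    fix p l assume b: "b \<notin> missable en L" "p \<in> missable en L" "l \<in> L" "en l = {b, p}"
    obtain m where m: "m \<in> M" "b \<in> en m" using b(1) M by (auto simp: missable_def covered_def)
    have "finite M" using matching_multigraph[OF L mM] by (simp add: multigraph_def)
    then have "card (M - {m}) \<le> card N" using m N(2) by simp
    moreover have "matching en (del_vertex en L b) N"
      using N(1,3) ab by (auto simp: matching_del_vertex)
    ultimately have "max_matching en (del_vertex en L b) N"
      using max_matchingI[OF del_vertex_max_matching[OF L b(1) M m]] by blast
    then have "x \<in> insert b (missable en L)"
      using missable_del_vertex[OF L b(1,3,4,2)] N(4) missableI by metis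
    then show False using xD x ab by auto
  next
    assume "a \<in> missable en L" "linked en L a b"
    then show False
      using gallai_deficient[OF L _ ab(2) M xD N(1,2) _ N(4)] N(3) ab(1) by auto
  qed
qed

lemma harmless_no_gain:
  assumes L: "multigraph en L" and h: "harmless en L e" and M: "max_matching en L M"
  shows "en e \<inter> covered en M \<noteq> {}"
proof
  assume "en e \<inter> covered en M = {}"
  moreover obtain a b where ab: "en e = {a, b}" "a \<noteq> b" 
     "b \<notin> missable en L \<or> a \<in> missable en L \<and> linked en L a b"
    using h by (auto simp: harmless_def)
  ultimately show False using M gallai[OF L _ ab(2) M] by (auto simp: missable_def)
qed

text \<open>A matching through \<open>e\<close> is compared with the old ones by taking
  \<open>e\<close> out: \<open>harmless_no_gain\<close> bounds its size, and
  \<open>harmless_deficient\<close> handles the vertices it misses.\<close>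

lemma harmless_insert:
  assumes L: "multigraph en (insert e L)" and e: "e \<notin> L" and h: "harmless en L e"
  shows "missable en (insert e L) = missable en L"
    and "max_matching en L N \<Longrightarrow> max_matching en (insert e L) N"
proof -
  have L': "multigraph en L" using multigraph_subset[OF L] by auto
  have rem: "matching en L (N - {e})" "en e \<inter> covered en (N - {e}) = {}"
    "card N = Suc (card (N - {e}))" 
    if "matching en (insert e L) N" "e \<in> N" for N
  proof -
    show "matching en L (N - {e})" using matching_remove[OF that(1), of "{e}"] by (auto simp: matching_def)
    show "en e \<inter> covered en (N - {e}) = {}"
      using covered_remove[of en N e] that by (auto simp: matching_def)
    have "finite N" using matching_multigraph[OF L that(1)] by (simp add: multigraph_def)
    then show "card N = Suc (card (N - {e}))" using that(2) by (rule card.remove)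
  qed
  show mx: "max_matching en (insert e L) N" if N: "max_matching en L N" for N
  proof -
    have "card N' \<le> card N" if N': "matching en (insert e L) N'" for N'
    proof (cases "e \<in> N'")
      case False
      then have "matching en L N'" using N' by (auto simp: matching_def)
      then show ?thesis using N by (simp add: max_matching_def)
    next
      case True
      note r = rem[OF N' True]
      show ?thesis
      proof (rule ccontr)
        assume "\<not> ?thesis"
        then have "max_matching en L (N' - {e})" using max_matchingI[OF N r(1)] r(3) by simp
        then show False using harmless_no_gain[OF L' h] r(2) by blast
      qed
    qed
    moreover have "matching en (insert e L) N"
      using N matching_mono[of en L N "insert e L"] by (auto simp: max_matching_def)
    ultimately show ?thesis by (simp add: max_matching_def)
  qed
  show "missable en (insert e L) = missable en L"
  proof (intro equalityI subsetI)
    fix x assume "x \<in> missable en L"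
    then show "x \<in> missable en (insert e L)" using mx by (auto simp: missable_def)
  next
    fix x assume "x \<in> missable en (insert e L)"
    then obtain N where N: "max_matching en (insert e L) N" "x \<notin> covered en N"
      by (auto simp: missable_def)
    obtain M where M: "max_matching en L M" using max_matching_exists[OF L'] .
    have c: "card N = card M" using max_matching_card[OF N(1) mx[OF M]] .
    have mN: "matching en (insert e L) N" using N by (simp add: max_matching_def)
    show "x \<in> missable en L"
    proof (cases "e \<in> N")
      case False
      then have "matching en L N" using mN by (auto simp: matching_def)
      then show ?thesis using max_matchingI[OF M] c N(2) missableI by fastforce
    next
      case True
      note r = rem[OF mN True]
      have "x \<notin> covered en (N - {e})" "x \<notin> en e"
        using N(2) True covered_mono[of "N - {e}" N en] by (auto simp: covered_def)
      moreover have "Suc (card (N - {e})) = card M" using r(3) c by simp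
      ultimately show ?thesis using harmless_deficient[OF L' h M r(1) _ r(2)] by blast
    qed
  qed
qed

lemma harmless_mono:
  assumes "harmless en L e" "L \<subseteq> L'" "missable en L' = missable en L"
  shows "harmless en L' e"
proof -
  have "linked en L a b \<Longrightarrow> linked en L' a b" for a b
    by (erule linked_mono) (use assms in auto)
  then show ?thesis using assms unfolding harmless_def by blast
qed

lemma harmless_Un:
  assumes "finite X" "multigraph en (L \<union> X)" "X \<inter> L = {}" "\<And>e. e \<in> X \<Longrightarrow> harmless en L e"
  shows "missable en (L \<union> X) = missable en L"
  using assms
proof (induction X rule: finite_induct)
  case (insert e X)
  have IH: "missable en (L \<union> X) = missable en L"
    using insert by (auto intro: multigraph_subset)
  have "harmless en (L \<union> X) e" using harmless_mono[OF insert.prems(3), of e "L \<union> X"] IH by auto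
  then show ?case
    using harmless_insert(1)[of en e "L \<union> X"] insert.prems(1,2) insert.hyps(2) IH by simp
qed simp

text \<open>
  Two missable vertices in different components cannot be joined harmlessly, because the union of
  two odd components is even.
\<close>

lemma linked_of_missable_insert:
  assumes L: "multigraph en (insert e L)" and e: "en e = {a, b}"
    and D: "missable en (insert e L) = missable en L" and ab: "a \<in> missable en L" "b \<in> missable en L"
  shows "linked en L a b"
proof (rule ccontr)
  assume nl: "\<not> linked en L a b"
  have L': "multigraph en L" using multigraph_subset[OF L] by auto
  let ?A = "component en L a" and ?B = "component en L b"
  have mono: "linked en L x y \<Longrightarrow> linked en (insert e L) x y" for x y
    by (erule linked_mono) (use D in auto)
  have disj: "?A \<inter> ?B = {}"
    using nl by (metis component_iff disjoint_iff linked_sym rtranclp_trans)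
  have st: "missable_step en (insert e L) a b" using ab D e by (auto simp: missable_step_def)
  have "component en (insert e L) a = ?A \<union> ?B"
  proof (intro equalityI subsetI)
    fix y assume "y \<in> component en (insert e L) a"
    then have "linked en (insert e L) a y" by (simp add: component_def)
    then show "y \<in> ?A \<union> ?B"
    proof (induction rule: rtranclp_induct)
      case base
      then show ?case by (simp add: component_def)
    next
      case (step y z)
      then have "missable_step en L y z \<or> {y, z} = {a, b}"
        using D e by (auto simp: missable_step_def)
      then show ?case
      proof
        assume "missable_step en L y z"
        then show ?thesis
          using step.IH unfolding component_def by (blast intro: rtranclp.rtrancl_into_rtrancl)
      next
        assume "{y, z} = {a, b}"
        then have "z = a \<or> z = b" by auto
        then show ?thesis by (auto simp: component_def)
      qed
    qed
  next
    fix y assume "y \<in> ?A \<union> ?B"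
    then have "linked en L a y \<or> linked en L b y" by (auto simp: component_def)
    then show "y \<in> component en (insert e L) a"
      using mono st converse_rtranclp_into_rtranclp by (metis component_iff)
  qed
  moreover have "odd (card (component en (insert e L) a))"
    using component_odd(2)[OF L] ab D by simp
  moreover have "card (?A \<union> ?B) = card ?A + card ?B"
    using component_odd(1)[OF L'] ab disj by (intro card_Un_disjoint) auto
  ultimately show False using component_odd(2)[OF L'] ab by simp
qed

text \<open>Converse of \<open>harmless_insert\<close>. If \<open>u\<close> is missable and
  \<open>v\<close> is not, a maximum matching that misses \<open>u\<close> has an edge
  \<open>l\<close> at \<open>v\<close>; replacing \<open>l\<close> by \<open>e\<close> exposes the
  other end of \<open>l\<close>, which is the missable neighbour sought. Two missable ends are
  settled by parity.\<close>

lemma harmless_of_missable_insert: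
  assumes L: "multigraph en (insert e L)"
    and mx: "\<And>N. max_matching en L N \<Longrightarrow> max_matching en (insert e L) N"
    and D: "missable en (insert e L) = missable en L"
  shows "harmless en L e"
proof -
  have L': "multigraph en L" using multigraph_subset[OF L] by auto
  have "card (en e) = 2" using L by (simp add: multigraph_def)
  then obtain a b where ab: "en e = {a, b}" "a \<noteq> b" by (meson card_2_iff)
  have main: "\<exists>p\<in>missable en L. \<exists>l\<in>L. en l = {v, p}"
    if uv: "en e = {u, v}" "u \<noteq> v" "u \<in> missable en L" "v \<notin> missable en L" for u v
  proof -
    obtain N where N: "max_matching en L N" "u \<notin> covered en N" using uv by (auto simp: missable_def)
    obtain l where l: "l \<in> N" "v \<in> en l" using N uv by (auto simp: missable_def covered_def)
    have mN: "matching en L N" using N by (simp add: max_matching_def)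
    obtain c where c: "en l = {v, c}" "v \<noteq> c" using ends_other[OF matching_multigraph[OF L' mN] l] .
    have cv: "covered en (N - {l}) = covered en N - {v, c}"
      using covered_remove[of en N l] mN l c by (simp add: matching_def)
    have uc: "u \<noteq> c" using N(2) l c by (auto simp: covered_def)
    have m1: "matching en (insert e L) (N - {l})"
      using matching_mono[OF matching_remove[OF mN]] by blast
    have fr: "en e \<inter> covered en (N - {l}) = {}" using cv uv N(2) by auto
    have "card (insert e (N - {l})) = card N"
      using card_insert_uncovered[OF L m1 _ fr] l matching_multigraph[OF L' mN]
      by (metis card_Suc_Diff1 insertI1 multigraph_def)
    then have "max_matching en (insert e L) (insert e (N - {l}))"
      using max_matchingI[OF mx[OF N(1)] matching_insert[OF m1 _ fr]] by simp
    then have "c \<in> missable en L" using missableI[of en "insert e L" _ c] cv uv c uc D by fastforce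
    then show ?thesis using c l mN by (auto simp: matching_def)
  qed
  consider "a \<notin> missable en L" "b \<notin> missable en L" | "a \<in> missable en L" "b \<notin> missable en L"
    | "a \<notin> missable en L" "b \<in> missable en L" | "a \<in> missable en L" "b \<in> missable en L" by blast
  then show ?thesis
  proof cases
    case 1
    then show ?thesis using ab unfolding harmless_def by blast
  next
    case 2
    then show ?thesis using ab main[OF ab 2] unfolding harmless_def by blast
  next
    case 3
    moreover have "en e = {b, a}" using ab by auto
    ultimately show ?thesis using main[of b a] ab(2) unfolding harmless_def by blast
  next
    case 4
    then show ?thesis using linked_of_missable_insert[OF L ab(1) D] ab unfolding harmless_def by blast
  qed
qed

lemma component_insert_linked:
  assumes "linked en L a b" "en e = {a, b}" "missable en (insert e L) = missable en L"
  shows "component en (insert e L) a = component en L a"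
proof (intro equalityI subsetI)
  fix y assume "y \<in> component en (insert e L) a"
  then have "linked en (insert e L) a y" by (simp add: component_def)
  then have "linked en L a y"
  proof (induction rule: rtranclp_induct)
    case (step y z)
    then have "missable_step en L y z \<or> {y, z} = {a, b}"
      using assms(2,3) by (auto simp: missable_step_def)
    then show ?case
    proof
      assume "missable_step en L y z"
      then show ?thesis using step.IH by (rule rtranclp.rtrancl_into_rtrancl[rotated])
    next
      assume "{y, z} = {a, b}"
      then have "z = a \<or> z = b" by auto
      then show ?thesis using assms(1) by auto
    qed
  qed simp
  then show "y \<in> component en L a" by (simp add: component_def)
next
  fix y assume "y \<in> component en L a"
  then have "linked en L a y" by (simp add: component_def)
  then have "linked en (insert e L) a y"
    by (rule linked_mono) (use assms(3) in auto)
  then show "y \<in> component en (insert e L) a" by (simp add: component_def)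
qed

section \<open>Path systems as matchings\<close>

datatype ('v, 'e) half_vertex = Node 'v sign | Leaf 'v 'e

definition half :: "('v, 'e) bigraph \<Rightarrow> ('v \<times> sign) set \<Rightarrow> 'e \<Rightarrow> 'v \<Rightarrow> ('v, 'e) half_vertex" where
  "half B S e x = (if (x, sg B e x) \<in> S then Leaf x e else Node x (sg B e x))"

text \<open>
  Each vertex \<open>v\<close> is split into \<open>Node v Plus\<close> and \<open>Node v Minus\<close>, joined by the edge \<open>Inr v\<close>; a
  half-edge in \<open>S\<close> ends in a leaf of its own. Trails then become paths that alternate with respect
  to the matching of all \<open>Inr v\<close>.
\<close>

definition aux_ends ::
    "('v, 'e) bigraph \<Rightarrow> ('v \<times> sign) set \<Rightarrow> 'e + 'v \<Rightarrow> ('v, 'e) half_vertex set" where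
  "aux_ends B S l = (case l of Inl e \<Rightarrow> half B S e ` ends B e | Inr v \<Rightarrow> {Node v Plus, Node v Minus})"

text \<open>A vertex with even one sign in \<open>S\<close> gets no \<open>Inr\<close> edge, so a
  trail read off a matching can end there but not pass through.\<close>

definition ordinary :: "('v, 'e) bigraph \<Rightarrow> ('v \<times> sign) set \<Rightarrow> 'v set" where
  "ordinary B S = {v \<in> verts B. (v, Plus) \<notin> S \<and> (v, Minus) \<notin> S}"

definition aux_edges :: "('v, 'e) bigraph \<Rightarrow> ('v \<times> sign) set \<Rightarrow> 'e set \<Rightarrow> ('e + 'v) set" where
  "aux_edges B S E = Inl ` E \<union> Inr ` ordinary B S"

lemma aux_ends_simps [simp]:
  "aux_ends B S (Inl e) = half B S e ` ends B e"
  "aux_ends B S (Inr v) = {Node v Plus, Node v Minus}"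
  by (simp_all add: aux_ends_def)

lemma neg_neg [simp]: "neg (neg s) = s" by (cases s) simp_all
lemma neg_neq [simp]: "neg s \<noteq> s" "s \<noteq> neg s" by (cases s; simp)+
lemma neg_eq_iff [simp]: "neg s = neg t \<longleftrightarrow> s = t" by (cases s; cases t) simp_all
lemma sign_cases: "s = t \<or> s = neg t" by (cases s; cases t) simp_all
lemma neq_neg_iff: "s \<noteq> t \<longleftrightarrow> s = neg t" by (cases s; cases t) simp_all

lemma half_eq_iff [simp]: "half B S e x = half B S e y \<longleftrightarrow> x = y"
  by (auto simp: half_def)

lemma half_Leaf: "half B S e x = Leaf y f \<longleftrightarrow> y = x \<and> f = e \<and> (x, sg B e x) \<in> S"
  by (auto simp: half_def)

lemma half_Node: "half B S e x = Node y s \<longleftrightarrow> y = x \<and> s = sg B e x \<and> (x, s) \<notin> S"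
  by (auto simp: half_def)

lemma ordinary_Node: "x \<in> ordinary B S \<Longrightarrow> half B S e x = Node x (sg B e x)"
  by (cases "sg B e x") (auto simp: half_def ordinary_def)

lemma Inr_ends: "aux_ends B S (Inr v) = {Node v s, Node v (neg s)}"
  by (cases s) auto

lemma edge_other_end:
  assumes "bidirected_graph B" "e \<in> edges B" "x \<in> ends B e"
  obtains y where "ends B e = {x, y}" "x \<noteq> y" "x \<in> verts B" "y \<in> verts B"
proof -
  have "card (ends B e) = 2" "ends B e \<subseteq> verts B" using assms by (auto simp: bidirected_graph_def)
  moreover from this obtain p q where "ends B e = {p, q}" "p \<noteq> q" by (meson card_2_iff)
  ultimately show thesis
    using assms(3) that[of p] that[of q] by (cases "x = p") (auto simp: insert_commute)
qed

lemma multigraph_aux: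
  assumes "bidirected_graph B" "finite_bigraph B" "E \<subseteq> edges B"
  shows "multigraph (aux_ends B S) (aux_edges B S E)"
proof -
  have "card (aux_ends B S l) = 2" if "l \<in> aux_edges B S E" for l
    using that assms(1,3)
    by (auto simp: aux_edges_def bidirected_graph_def card_image inj_on_def)
  moreover have "finite (aux_edges B S E)"
    using assms by (auto simp: aux_edges_def ordinary_def finite_bigraph_def intro: finite_subset)
  ultimately show ?thesis by (auto simp: multigraph_def)
qed

lemma Leaf_covered:
  "Leaf x e \<in> covered (aux_ends B S) N \<longleftrightarrow> Inl e \<in> N \<and> x \<in> ends B e \<and> (x, sg B e x) \<in> S"
proof
  assume "Leaf x e \<in> covered (aux_ends B S) N"
  then obtain l where "l \<in> N" "Leaf x e \<in> aux_ends B S l" by (auto simp: covered_def)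
  then show "Inl e \<in> N \<and> x \<in> ends B e \<and> (x, sg B e x) \<in> S"
    by (cases l) (auto simp: half_Leaf eq_commute[of "Leaf x e"])
next
  assume "Inl e \<in> N \<and> x \<in> ends B e \<and> (x, sg B e x) \<in> S"
  then show "Leaf x e \<in> covered (aux_ends B S) N"
    by (auto simp: covered_def half_def intro!: bexI[of _ "Inl e"] image_eqI[of _ _ x])
qed

lemma Node_covered:
  assumes "Node x s \<in> covered (aux_ends B S) N"
  obtains "Inr x \<in> N" | e where "Inl e \<in> N" "x \<in> ends B e" "sg B e x = s" "half B S e x = Node x s"
proof -
  obtain l where l: "l \<in> N" "Node x s \<in> aux_ends B S l" using assms by (auto simp: covered_def)
  show thesis
  proof (cases l)
    case (Inl e)
    then obtain y where "y \<in> ends B e" "half B S e y = Node x s" using l by auto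
    then show thesis using that(2)[of e] l Inl by (auto simp: half_Node)
  next
    case (Inr v)
    then show thesis using that(1) l by auto
  qed
qed

section \<open>From matchings to trails and paths\<close>

definition leaves ::
    "('v, 'e) bigraph \<Rightarrow> ('v \<times> sign) set \<Rightarrow> ('e + 'v) set \<Rightarrow> 'v \<Rightarrow> 'e set" where
  "leaves B S N v = {f. Leaf v f \<in> covered (aux_ends B S) N}"

lemma finite_leaves: "finite N \<Longrightarrow> finite (leaves B S N v)"
  by (rule finite_subset[of _ "Inl -` N"]) (auto simp: leaves_def Leaf_covered finite_vimageI)

lemma trail_single [simp]: "trail B ([v], []) \<longleftrightarrow> v \<in> verts B"
  by (auto simp: trail_def)

lemma trail_Cons:
  "trail B (v # vs, e # es) \<longleftrightarrow> vs \<noteq> [] \<and> trail B (vs, es) \<and> v \<in> verts B \<and> e \<in> edges B \<and>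
     e \<notin> set es \<and> ends B e = {v, hd vs} \<and>
     (es \<noteq> [] \<longrightarrow> sg B (hd es) (hd vs) = neg (sg B e (hd vs)))"
proof (cases vs)
  case Nil
  then show ?thesis by (auto simp: trail_def)
next
  case (Cons w ws)
  have 1: "(\<forall>i<length (e # es). ends B ((e # es) ! i) = {(v # vs) ! i, (v # vs) ! Suc i}) \<longleftrightarrow>
      ends B e = {v, w} \<and> (\<forall>i<length es. ends B (es ! i) = {vs ! i, vs ! Suc i})"
    using Cons by (auto simp: less_Suc_eq_0_disj nth_Cons')
  have 2: "(\<forall>i. Suc i < length (e # es) \<longrightarrow>
        sg B ((e # es) ! Suc i) ((v # vs) ! Suc i) = neg (sg B ((e # es) ! i) ((v # vs) ! Suc i))) \<longleftrightarrow>
      (es \<noteq> [] \<longrightarrow> sg B (hd es) w = neg (sg B e w)) \<and>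
      (\<forall>i. Suc i < length es \<longrightarrow> sg B (es ! Suc i) (vs ! Suc i) = neg (sg B (es ! i) (vs ! Suc i)))"
    (is "?l \<longleftrightarrow> ?r")
  proof
    assume l: ?l
    have "es \<noteq> [] \<longrightarrow> sg B (hd es) w = neg (sg B e w)"
      using l[rule_format, of 0] Cons by (auto simp: hd_conv_nth)
    then show ?r using l[rule_format, of "Suc i" for i] by auto
  next
    assume r: ?r
    show ?l
    proof (intro allI impI)
      fix i assume "Suc i < length (e # es)"
      then show "sg B ((e # es) ! Suc i) ((v # vs) ! Suc i) = neg (sg B ((e # es) ! i) ((v # vs) ! Suc i))"
        using r Cons by (cases i) (auto simp: hd_conv_nth)
    qed
  qed
  show ?thesis
    unfolding trail_def case_prod_conv 1 2 using Cons by auto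
qed

lemma trail_edges_update:
  "E \<subseteq> edges B \<Longrightarrow> trail (B\<lparr>edges := E\<rparr>) p \<longleftrightarrow> trail B p \<and> set (snd p) \<subseteq> E"
  by (cases p) (auto simp: trail_def)

lemma signed_path_edges_update:
  "E \<subseteq> edges B \<Longrightarrow> signed_path (B\<lparr>edges := E\<rparr>) v w s p \<longleftrightarrow> signed_path B v w s p \<and> set (snd p) \<subseteq> E"
  by (auto simp: signed_path_def path_def trail_from_to_def trail_edges_update)

text \<open>
  Following a matching alternately with the edges \<open>Inr y\<close> out of an uncovered node. The vertices
  already visited are those \<open>y\<close> whose edge \<open>Inr y\<close> has been put in, so none is visited twice.
\<close>

definition matching_walk ::
    "('v, 'e) bigraph \<Rightarrow> ('v \<times> sign) set \<Rightarrow> ('e + 'v) set \<Rightarrow> 'v \<Rightarrow> sign \<Rightarrow> 'v list \<Rightarrow> 'e list \<Rightarrow> bool" where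
  "matching_walk B S N x s vs es \<longleftrightarrow>
    trail B (vs, es) \<and> hd vs = x \<and> es \<noteq> [] \<and> Inl ` set es \<subseteq> N \<and> sg B (hd es) x = neg s \<and>
    distinct (butlast vs) \<and> set (butlast vs) \<subseteq> ordinary B S \<and> (\<forall>y\<in>set (butlast vs). Inr y \<notin> N) \<and>
    Leaf (last vs) (last es) \<in> covered (aux_ends B S) N \<and>
    disjoint_ends (aux_ends B S) (N - Inl ` set es \<union> Inr ` set (butlast vs)) \<and>
    covered (aux_ends B S) (N - Inl ` set es \<union> Inr ` set (butlast vs)) =
      insert (Node x s) (covered (aux_ends B S) N - {Leaf (last vs) (last es)})"

text \<open>The edge \<open>g\<close> at \<open>Node x (neg s)\<close> cannot be
  \<open>Inr x\<close>, which would also cover \<open>Node x s\<close>. Replacing \<open>g\<close>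
  by \<open>Inr x\<close> moves the single uncovered node to the far end of \<open>g\<close> and
  leaves one \<open>Inl\<close> edge fewer, until that far end is a leaf.\<close>

lemma matching_walk_exists:
  assumes "bidirected_graph B" "E \<subseteq> edges B" "finite N" "N \<subseteq> aux_edges B S E"
    and "disjoint_ends (aux_ends B S) N" "x \<in> ordinary B S"
    and "\<And>y t. Node y t \<in> covered (aux_ends B S) N \<longleftrightarrow> y \<in> ordinary B S \<and> (y, t) \<noteq> (x, s)"
  shows "\<exists>vs es. matching_walk B S N x s vs es"
  using assms(3-)
proof (induction "card {e. Inl e \<in> N}" arbitrary: N x s rule: less_induct)
  case less
  let ?en = "aux_ends B S"
  have nxs: "Node x (neg s) \<in> covered ?en N" using less.prems(4,5) by simp
  have xs: "Node x s \<notin> covered ?en N" using less.prems(5) by simp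
  have "Node x s \<in> ?en (Inr x)" by (cases s) auto
  then have Inr_x: "Inr x \<notin> N" using xs unfolding covered_def by blast
  then obtain g where g: "Inl g \<in> N" "x \<in> ends B g" "sg B g x = neg s"
    "half B S g x = Node x (neg s)"
    using nxs by (metis Node_covered)
  have gE: "g \<in> edges B" using g(1) less.prems(2) assms(2) by (auto simp: aux_edges_def)
  then obtain y where y: "ends B g = {x, y}" "x \<noteq> y" and eV: "x \<in> verts B" "y \<in> verts B"
    using g(2) edge_other_end[OF assms(1)] by metis
  let ?N = "insert (Inr x) (N - {Inl g})"
  have eg: "?en (Inl g) = {Node x (neg s), half B S g y}" using y g(4) by simp
  have cg: "covered ?en (N - {Inl g}) = covered ?en N - {Node x (neg s), half B S g y}"
    using covered_remove[OF less.prems(3) g(1)] eg by simp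
  have ynx: "half B S g y \<noteq> Node x s" "half B S g y \<noteq> Node x (neg s)"
    using y(2) by (simp_all add: half_Node)
  have inr: "?en (Inr x) = {Node x s, Node x (neg s)}" by (rule Inr_ends)
  have dN: "disjoint_ends ?en ?N"
    using disjoint_ends_subset[OF less.prems(3), of "N - {Inl g}"] cg xs
    by (intro disjoint_ends_insert) (simp_all only: inr, blast+)
  have cN: "covered ?en ?N = insert (Node x s) (covered ?en N - {half B S g y})"
    unfolding covered_insert inr cg using nxs ynx by blast
  have yc: "half B S g y \<in> covered ?en N" using g(1) eg unfolding covered_def by blast
  show ?case
  proof (cases "half B S g y")
    case (Leaf z f)
    then have zf: "z = y" "f = g" by (auto simp: half_Leaf)
    have eq: "N - Inl ` set [g] \<union> Inr ` set (butlast [x, y]) = ?N" by auto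
    have "matching_walk B S N x s [x, y] [g]"
      unfolding matching_walk_def eq
      using y g gE eV less.prems(4) Inr_x dN cN yc Leaf zf by (simp add: trail_Cons)
    then show ?thesis by blast
  next
    case (Node z t)
    then have zt: "z = y" "sg B g y = t" by (auto simp: half_Node)
    have yo: "y \<in> ordinary B S" using yc less.prems(5) zt Node by simp
    have "card {e. Inl e \<in> ?N} < card {e. Inl e \<in> N}"
    proof (rule psubset_card_mono)
      show "finite {e. Inl e \<in> N}"
        using less.prems(1) finite_vimageI[of N Inl] by (simp add: vimage_def)
      show "{e. Inl e \<in> ?N} \<subset> {e. Inl e \<in> N}" using g(1) by auto
    qed
    moreover have "?N \<subseteq> aux_edges B S E"
      using less.prems(2,4) by (auto simp: aux_edges_def)
    moreover have "Node z' t' \<in> covered ?en ?N \<longleftrightarrow> z' \<in> ordinary B S \<and> (z', t') \<noteq> (y, t)" for z' t'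
      unfolding cN using less.prems(4,5) Node zt y(2) by auto
    moreover have "finite ?N" using less.prems(1) by simp
    ultimately obtain vs es where "matching_walk B S ?N y t vs es"
      using less.hyps[of ?N y t] dN yo by blast
    then have I: "trail B (vs, es)" "hd vs = y" "es \<noteq> []" "Inl ` set es \<subseteq> ?N"
      "sg B (hd es) y = neg t" "distinct (butlast vs)" "set (butlast vs) \<subseteq> ordinary B S"
      "\<forall>y\<in>set (butlast vs). Inr y \<notin> ?N" "Leaf (last vs) (last es) \<in> covered ?en ?N"
      "disjoint_ends ?en (?N - Inl ` set es \<union> Inr ` set (butlast vs))"
      "covered ?en (?N - Inl ` set es \<union> Inr ` set (butlast vs)) =
        insert (Node y t) (covered ?en ?N - {Leaf (last vs) (last es)})"
      unfolding matching_walk_def by blast+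
    have vs: "vs \<noteq> []" using I(1) by (auto simp: trail_def)
    have eq: "N - Inl ` set (g # es) \<union> Inr ` set (butlast (x # vs)) =
        ?N - Inl ` set es \<union> Inr ` set (butlast vs)"
      using vs by auto
    have "trail B (x # vs, g # es)"
      using I(1-5) vs y g gE eV zt unfolding trail_Cons by auto
    moreover have "Inl ` set (g # es) \<subseteq> N" using I(4) g(1) by auto
    moreover have "distinct (butlast (x # vs))" "set (butlast (x # vs)) \<subseteq> ordinary B S"
      "\<forall>y\<in>set (butlast (x # vs)). Inr y \<notin> N"
      using I(6,7,8) vs less.prems(4) Inr_x by auto
    moreover have "Leaf (last (x # vs)) (last (g # es)) \<in> covered ?en N"
      using I(3,9) vs unfolding cN by simp
    moreover have "insert (Node y t) (covered ?en ?N - {Leaf (last vs) (last es)}) =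
        insert (Node x s) (covered ?en N - {Leaf (last (x # vs)) (last (g # es))})"
      unfolding cN using Node zt yc I(3) vs by auto
    ultimately have "matching_walk B S N x s (x # vs) (g # es)"
      unfolding matching_walk_def eq using I(10,11) g(3) by simp
    then show ?thesis by blast
  qed
qed

text \<open>Only \<open>butlast vs\<close> is asserted to be distinct, since the trail might return
  to \<open>r\<close>; excluding this is left to cleanness. The last two clauses describe the
  matching after the trail is taken out and the vertices it passes are closed by their
  \<open>Inr\<close> edges.\<close>

definition root_walk ::
    "('v, 'e) bigraph \<Rightarrow> ('v \<times> sign) set \<Rightarrow> ('e + 'v) set \<Rightarrow> 'v \<Rightarrow> 'v list \<Rightarrow> 'e \<Rightarrow> 'e list \<Rightarrow> bool" where
  "root_walk B S N r vs f es \<longleftrightarrow>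
    vs \<noteq> [] \<and> trail B (r # vs, f # es) \<and> Inl ` set (f # es) \<subseteq> N \<and>
    distinct (butlast vs) \<and> set (butlast vs) \<subseteq> ordinary B S \<and> (\<forall>y\<in>set (butlast vs). Inr y \<notin> N) \<and>
    Leaf (last vs) (last (f # es)) \<in> covered (aux_ends B S) N \<and>
    Leaf (last vs) (last (f # es)) \<noteq> Leaf r f \<and>
    disjoint_ends (aux_ends B S) (N - Inl ` set (f # es) \<union> Inr ` set (butlast vs)) \<and>
    covered (aux_ends B S) (N - Inl ` set (f # es) \<union> Inr ` set (butlast vs)) =
      covered (aux_ends B S) N - {Leaf r f, Leaf (last vs) (last (f # es))}"

lemma root_walk_exists:
  assumes B: "bidirected_graph B" "E \<subseteq> edges B"
    and N: "finite N" "N \<subseteq> aux_edges B S E" "disjoint_ends (aux_ends B S) N"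
    and full: "\<And>y t. Node y t \<in> covered (aux_ends B S) N \<longleftrightarrow> y \<in> ordinary B S"
    and f: "Leaf r f \<in> covered (aux_ends B S) N"
  shows "\<exists>vs es. root_walk B S N r vs f es"
proof -
  let ?en = "aux_ends B S"
  have f': "Inl f \<in> N" "r \<in> ends B f" "(r, sg B f r) \<in> S" using f by (auto simp: Leaf_covered)
  have fE: "f \<in> edges B" using f'(1) N(2) B(2) by (auto simp: aux_edges_def)
  then obtain x where x: "ends B f = {r, x}" "r \<noteq> x" and eV: "r \<in> verts B" "x \<in> verts B"
    using f'(2) edge_other_end[OF B(1)] by metis
  have ef: "?en (Inl f) = {Leaf r f, half B S f x}" using x f' by (auto simp: half_def)
  have cf: "covered ?en (N - {Inl f}) = covered ?en N - {Leaf r f, half B S f x}"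
    using covered_remove[OF N(3) f'(1)] ef by simp
  have xc: "half B S f x \<in> covered ?en N" using f'(1) ef unfolding covered_def by blast
  have dN: "disjoint_ends ?en (N - {Inl f})" using disjoint_ends_subset[OF N(3)] by auto
  show ?thesis
  proof (cases "half B S f x")
    case (Leaf z g)
    then have zg: "z = x" "g = f" by (auto simp: half_Leaf)
    have "root_walk B S N r [x] f []"
      unfolding root_walk_def using x f' fE eV cf xc dN Leaf zg by (simp add: trail_Cons)
    then show ?thesis by blast
  next
    case (Node z t)
    then have zt: "z = x" "sg B f x = t" by (auto simp: half_Node)
    have xo: "x \<in> ordinary B S" using xc full zt Node by simp
    have full': "Node y u \<in> covered ?en (N - {Inl f}) \<longleftrightarrow> y \<in> ordinary B S \<and> (y, u) \<noteq> (x, t)" for y u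
      unfolding cf using full Node zt by auto
    have "finite (N - {Inl f})" "N - {Inl f} \<subseteq> aux_edges B S E" using N(1,2) by auto
    then obtain vs es where "matching_walk B S (N - {Inl f}) x t vs es"
      using matching_walk_exists[OF B _ _ dN xo full'] by blast
    then have I: "trail B (vs, es)" "hd vs = x" "es \<noteq> []" "Inl ` set es \<subseteq> N - {Inl f}"
      "sg B (hd es) x = neg t" "distinct (butlast vs)" "set (butlast vs) \<subseteq> ordinary B S"
      "\<forall>y\<in>set (butlast vs). Inr y \<notin> N - {Inl f}"
      "Leaf (last vs) (last es) \<in> covered ?en (N - {Inl f})"
      "disjoint_ends ?en (N - {Inl f} - Inl ` set es \<union> Inr ` set (butlast vs))"
      "covered ?en (N - {Inl f} - Inl ` set es \<union> Inr ` set (butlast vs)) =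
        insert (Node x t) (covered ?en (N - {Inl f}) - {Leaf (last vs) (last es)})"
      unfolding matching_walk_def by blast+
    have vs: "vs \<noteq> []" using I(1) by (auto simp: trail_def)
    have eq: "N - Inl ` set (f # es) \<union> Inr ` set (butlast vs) =
        N - {Inl f} - Inl ` set es \<union> Inr ` set (butlast vs)" by auto
    have "trail B (r # vs, f # es)" using I(1-5) vs x fE eV zt unfolding trail_Cons by auto
    moreover have "Leaf (last vs) (last (f # es)) \<in> covered ?en N"
      "Leaf (last vs) (last (f # es)) \<noteq> Leaf r f" using I(3,9) unfolding cf by auto
    moreover have "insert (Node x t) (covered ?en (N - {Inl f}) - {Leaf (last vs) (last es)}) =
        covered ?en N - {Leaf r f, Leaf (last vs) (last (f # es))}"
      unfolding cf using Node zt xc I(3) by auto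
    moreover have "Inl ` set (f # es) \<subseteq> N" "\<forall>y\<in>set (butlast vs). Inr y \<notin> N"
      using I(4,8) f'(1) by auto
    ultimately have "root_walk B S N r vs f es"
      unfolding root_walk_def eq using I(6,7,10,11) vs by simp
    then show ?thesis by blast
  qed
qed


lemma trail_butlast:
  assumes "trail B (vs, es)" "es \<noteq> []"
  shows "trail B (butlast vs, butlast es)"
  using assms
proof (induction es arbitrary: vs)
  case (Cons e es)
  then obtain v ws where vs: "vs = v # ws" by (cases vs) (auto simp: trail_def)
  show ?case
  proof (cases "es = []")
    case True
    then have "length ws = 1" using Cons.prems vs by (simp add: trail_def)
    then show ?thesis using Cons.prems True vs by (auto simp: trail_Cons length_Suc_conv)
  next
    case False
    then have I: "trail B (butlast ws, butlast es)" using Cons vs by (simp add: trail_Cons)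
    obtain w w' ws' where ws: "ws = w # w' # ws'"
      using Cons.prems False vs by (cases ws; cases "tl ws"; cases es) (auto simp: trail_def)
    show ?thesis
      using I Cons.prems False vs ws
      by (cases es; cases "tl es") (auto simp: trail_Cons dest: in_set_butlastD)
  qed
qed simp

definition targets :: "'v \<Rightarrow> 'v \<Rightarrow> sign \<Rightarrow> ('v \<times> sign) set" where
  "targets r w s = {(r, Plus), (r, Minus), (w, s)}"

text \<open>
  The matchings that represent a system of \<open>card (leaves B (targets r w s) N r)\<close> internally
  disjoint paths from \<open>r\<close> to \<open>w\<close> with last sign \<open>s\<close>. The half-edges at \<open>r\<close>, and those at \<open>w\<close>
  with sign \<open>s\<close>, are vertices of their own.
\<close>

definition path_system ::
    "('v, 'e) bigraph \<Rightarrow> 'v \<Rightarrow> 'e set \<Rightarrow> 'v \<Rightarrow> sign \<Rightarrow> ('e + 'v) set \<Rightarrow> bool" where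
  "path_system B r E w s N \<longleftrightarrow> N \<subseteq> aux_edges B (targets r w s) E \<and>
     disjoint_ends (aux_ends B (targets r w s)) N \<and>
     (\<forall>y t. Node y t \<in> covered (aux_ends B (targets r w s)) N \<longleftrightarrow> y \<in> verts B - {r, w})"

lemma targets_sign: "(r, s) \<in> targets r w t"
  by (cases s) (auto simp: targets_def)

locale clean_rooted =
  fixes B :: "('v, 'e) bigraph" and r :: 'v
  assumes finite_B: "finite_bigraph B" and rooted_B: "rooted B r" and clean_B: "clean B r"
begin

abbreviation restr :: "'e set \<Rightarrow> ('v, 'e) bigraph" where "restr E \<equiv> B\<lparr>edges := E\<rparr>"

abbreviation kap :: "'e set \<Rightarrow> 'v \<Rightarrow> sign \<Rightarrow> nat" where "kap E w s \<equiv> kappa (restr E) s r w"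

lemma bidirected_B: "bidirected_graph B" using rooted_B by (simp add: rooted_def)
lemma root_vert: "r \<in> verts B" using rooted_B by (simp add: rooted_def)

lemma finite_restr: "E \<subseteq> edges B \<Longrightarrow> finite_bigraph (restr E)"
  using finite_B by (auto simp: finite_bigraph_def intro: finite_subset)

lemma ordinary_targets: "ordinary B (targets r w s) = verts B - {r, w}"
  by (cases s) (auto simp: ordinary_def targets_def)

text \<open>The only place where cleanness enters. As \<open>r\<close> is not ordinary, it does not
  occur among the inner vertices, so a returning walk would be a nontrivial almost path from
  \<open>r\<close> to \<open>r\<close>.\<close>

lemma root_walk_no_return:
  assumes w: "root_walk B S N r vs f es" and S: "(r, Plus) \<in> S"
  shows "last vs \<noteq> r"
proof
  assume l: "last vs = r"
  have t: "trail B (r # vs, f # es)" "vs \<noteq> []" "distinct (butlast vs)" "set (butlast vs) \<subseteq> ordinary B S"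
    using w by (simp_all add: root_walk_def)
  have "trail B (butlast (r # vs), butlast (f # es))" using trail_butlast[OF t(1)] by simp
  moreover have "distinct (butlast (r # vs))" using t S by (auto simp: ordinary_def)
  ultimately have "almost_path B (r # vs, f # es)" using t(1) by (simp add: almost_path_def path_def)
  moreover have "trail_from_to B r r (r # vs, f # es)" using t l by (simp add: trail_from_to_def)
  ultimately show False using clean_B unfolding clean_def by (auto simp: trivial_trail_def)
qed

text \<open>Paths are split off one at a time from a root leaf; by cleanness each walk ends at a
  leaf of \<open>w\<close>. The last clause carries the disjointness: the remaining matching
  contains \<open>Inr y\<close> for every inner vertex \<open>y\<close> of the removed path, so
  later paths avoid \<open>y\<close>.\<close>

lemma path_system_paths:
  assumes E: "E \<subseteq> edges B" and w: "w \<in> verts B - {r}" and "path_system B r E w s N"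
  shows "\<exists>P. finite P \<and> card P = card (leaves B (targets r w s) N r) \<and>
    disjoint_signed_paths (restr E) r w s P \<and>
    (\<forall>p\<in>P. Inl ` set (snd p) \<subseteq> N \<and> (\<forall>y\<in>internal_verts p. Inr y \<notin> N))"
  using assms(3)
proof (induction "card (leaves B (targets r w s) N r)" arbitrary: N)
  case 0
  then show ?case by (intro exI[of _ "{}"]) (simp add: disjoint_signed_paths_def)
next
  case (Suc k)
  let ?S = "targets r w s"
  let ?en = "aux_ends B ?S"
  have N: "N \<subseteq> aux_edges B ?S E" "disjoint_ends ?en N"
    and full: "\<And>y t. Node y t \<in> covered ?en N \<longleftrightarrow> y \<in> ordinary B ?S"
    using Suc.prems by (simp_all add: path_system_def ordinary_targets)
  have fN: "finite N"
    using N(1) multigraph_aux[OF bidirected_B finite_B E, of ?S] finite_subset by (auto simp: multigraph_def)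
  obtain f where f: "f \<in> leaves B ?S N r" using Suc.hyps(2) by fastforce
  then have fc: "Leaf r f \<in> covered ?en N" by (simp add: leaves_def)
  obtain vs es where rw: "root_walk B ?S N r vs f es"
    using root_walk_exists[OF bidirected_B E fN N full fc] by blast
  let ?N = "N - Inl ` set (f # es) \<union> Inr ` set (butlast vs)"
  from rw have I: "vs \<noteq> []" "trail B (r # vs, f # es)" "Inl ` set (f # es) \<subseteq> N"
    "distinct (butlast vs)" "set (butlast vs) \<subseteq> ordinary B ?S" "\<forall>y\<in>set (butlast vs). Inr y \<notin> N"
    "Leaf (last vs) (last (f # es)) \<in> covered ?en N" "Leaf (last vs) (last (f # es)) \<noteq> Leaf r f"
    "disjoint_ends ?en ?N"
    "covered ?en ?N = covered ?en N - {Leaf r f, Leaf (last vs) (last (f # es))}"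
    unfolding root_walk_def by blast+
  have nr: "last vs \<noteq> r" using root_walk_no_return[OF rw targets_sign] .
  have "(last vs, sg B (last (f # es)) (last vs)) \<in> ?S" using I(7) by (simp add: Leaf_covered)
  then have lw: "last vs = w" "sg B (last (f # es)) w = s" using nr by (auto simp: targets_def)
  let ?p = "(r # vs, f # es)"
  have esE: "set (f # es) \<subseteq> E" using I(3) N(1) by (auto simp: aux_edges_def)
  have dist: "distinct (r # vs)"
  proof -
    obtain bs where bs: "vs = bs @ [w]" using I(1) lw by (metis append_butlast_last_id)
    then have "distinct bs" "set bs \<subseteq> verts B - {r, w}" using I(4,5) by (simp_all add: ordinary_targets)
    then show ?thesis using bs w by auto
  qed
  have sp: "signed_path (restr E) r w s ?p"
    unfolding signed_path_edges_update[OF E]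
    using I(1,2) lw esE dist
    by (auto simp: signed_path_def path_def trail_from_to_def trivial_trail_def)
  have iv: "internal_verts ?p = set (butlast vs)" by (simp add: internal_verts_def)
  have lv: "leaves B ?S ?N r = leaves B ?S N r - {f}"
    unfolding leaves_def I(10) using lw w by auto
  have "path_system B r E w s ?N"
    using N(1) I(5,9,10) full by (auto simp: path_system_def aux_edges_def ordinary_targets)
  moreover have "k = card (leaves B ?S ?N r)"
    unfolding lv using f Suc.hyps(2) finite_leaves[OF fN] by simp
  ultimately obtain P where P: "finite P" "card P = k" "disjoint_signed_paths (restr E) r w s P"
    "\<forall>p\<in>P. Inl ` set (snd p) \<subseteq> ?N \<and> (\<forall>y\<in>internal_verts p. Inr y \<notin> ?N)"
    using Suc.hyps(1)[of ?N] by blast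
  have pP: "?p \<notin> P" using P(4) by auto
  have dj: "internal_verts ?p \<inter> internal_verts q = {}" if "q \<in> P" for q
    using P(4) that unfolding iv by blast
  have "disjoint_signed_paths (restr E) r w s (insert ?p P)"
    using P(3) sp dj by (auto simp: disjoint_signed_paths_def)
  moreover have "\<forall>p\<in>insert ?p P. Inl ` set (snd p) \<subseteq> N \<and> (\<forall>y\<in>internal_verts p. Inr y \<notin> N)"
    using P(4) I(3,6) iv by auto
  ultimately show ?case
    using P(1,2) pP Suc.hyps(2) by (intro exI[of _ "insert ?p P"]) simp
qed

lemma path_system_kap:
  assumes "E \<subseteq> edges B" "w \<in> verts B - {r}" "path_system B r E w s N"
  shows "card (leaves B (targets r w s) N r) \<le> kap E w s"
proof -
  obtain P where "card P = card (leaves B (targets r w s) N r)" "disjoint_signed_paths (restr E) r w s P"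
    using path_system_paths[OF assms] by blast
  then show ?thesis using kappa_upper[OF finite_restr[OF assms(1)]] by metis
qed


end

section \<open>From disjoint paths to matchings\<close>

lemma trail_edge_ends: "trail B (vs, es) \<Longrightarrow> e \<in> set es \<Longrightarrow> ends B e \<subseteq> set vs"
proof -
  assume t: "trail B (vs, es)" and "e \<in> set es"
  then obtain i where i: "i < length es" "e = es ! i" by (auto simp: in_set_conv_nth)
  then have "i < length vs" "Suc i < length vs" "ends B e = {vs ! i, vs ! Suc i}"
    using t by (auto simp: trail_def)
  then show ?thesis by simp
qed

lemma signed_path_verts:
  assumes "signed_path B v w s p"
  shows "set (fst p) \<subseteq> {v, w} \<union> internal_verts p"
proof -
  obtain vs es where p: "p = (vs, es)" by (cases p)
  have t: "length vs = Suc (length es)" "es \<noteq> []" "hd vs = v" "last vs = w"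
    using assms p
    by (auto simp: signed_path_def path_def trail_def trail_from_to_def trivial_trail_def)
  then obtain ws where ws: "vs = v # ws" by (cases vs) auto
  then have "ws \<noteq> []" "last ws = w" using t by auto
  then obtain bs where "ws = bs @ [w]" by (metis append_butlast_last_id)
  then show ?thesis using p ws by (auto simp: internal_verts_def)
qed

lemma signed_path_single_edge:
  assumes "signed_path B v w s (vs, es)" "e \<in> set es" "ends B e = {v, w}" "v \<noteq> w"
  shows "vs = [v, w]" "es = [e]"
proof -
  have t: "length vs = Suc (length es)" "es \<noteq> []" "hd vs = v" "last vs = w" "distinct vs"
    "\<forall>i<length es. ends B (es ! i) = {vs ! i, vs ! Suc i}"
    using assms(1)
    by (auto simp: signed_path_def path_def trail_def trail_from_to_def trivial_trail_def)
  obtain i where i: "i < length es" "es ! i = e" using assms(2) by (auto simp: in_set_conv_nth)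
  have ends: "{vs ! i, vs ! Suc i} = {v, w}" using t(6) i assms(3) by auto
  have v: "vs ! 0 = v" and w: "vs ! length es = w"
    using t(1,3,4) hd_conv_nth[of vs] last_conv_nth[of vs] by fastforce+
  have "vs ! 0 = vs ! i \<or> vs ! 0 = vs ! Suc i" using ends v by (auto simp: doubleton_eq_iff)
  then have "i = 0" using t(1,5) i(1) nth_eq_iff_index_eq[of vs 0 i] nth_eq_iff_index_eq[of vs 0 "Suc i"] by auto
  have "vs ! length es = vs ! i \<or> vs ! length es = vs ! Suc i" using ends w by (auto simp: doubleton_eq_iff)
  then have "length es = 1"
    using t(1,5) i(1) \<open>i = 0\<close> nth_eq_iff_index_eq[of vs "length es" i]
      nth_eq_iff_index_eq[of vs "length es" "Suc i"] by auto
  then obtain g where "es = [g]" by (metis One_nat_def length_0_conv length_Suc_conv)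
  then show es: "es = [e]" using assms(2) by simp
  obtain a b where "vs = [a, b]" using t(1) es by (auto simp: length_Suc_conv)
  then show "vs = [v, w]" using t(3,4) by simp
qed

text \<open>A shared edge has its ends among the common vertices, which are only \<open>v\<close>
  and \<open>w\<close>. A path that uses an edge between \<open>v\<close> and \<open>w\<close>
  consists of that edge alone, so the two paths would coincide.\<close>

lemma disjoint_signed_paths_edges:
  assumes "disjoint_signed_paths B v w s P" "p \<in> P" "q \<in> P" "p \<noteq> q" "v \<noteq> w" "bidirected_graph B"
  shows "set (snd p) \<inter> set (snd q) = {}"
proof (rule ccontr)
  assume "\<not> ?thesis"
  then obtain e where e: "e \<in> set (snd p)" "e \<in> set (snd q)" by auto
  have sp: "signed_path B v w s p" "signed_path B v w s q" "internal_verts p \<inter> internal_verts q = {}"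
    using assms by (auto simp: disjoint_signed_paths_def)
  have tp: "trail B p" "trail B q" using sp by (auto simp: signed_path_def path_def)
  have eB: "e \<in> edges B" using tp(1) e(1) by (cases p) (auto simp: trail_def)
  have "ends B e \<subseteq> set (fst p)" "ends B e \<subseteq> set (fst q)"
    using trail_edge_ends[of B "fst p" "snd p" e] trail_edge_ends[of B "fst q" "snd q" e] tp e by simp_all
  then have sub: "ends B e \<subseteq> {v, w}"
    using signed_path_verts[OF sp(1)] signed_path_verts[OF sp(2)] sp(3) by blast
  have "card (ends B e) = 2" using assms(6) eB by (simp add: bidirected_graph_def)
  then have "ends B e = {v, w}" using sub assms(5) card_subset_eq[of "{v, w}" "ends B e"] by simp
  then have "p' = ([v, w], [e])" if "signed_path B v w s p'" "e \<in> set (snd p')" for p'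
    using that assms(5) signed_path_single_edge[of B v w s "fst p'" "snd p'" e]
    by (cases p') (simp add: \<open>ends B e = {v, w}\<close>)
  then have "p = ([v, w], [e])" "q = ([v, w], [e])" using sp e by blast+
  then show False using assms(4) by simp
qed

text \<open>The inverse of \<open>matching_walk\<close>. The only node lost is the one at which an
  edge preceding the trail would enter \<open>hd vs\<close>, so prepending that edge restores
  it.\<close>

lemma insert_trail:
  assumes "trail B (vs, es)" "es \<noteq> []" "distinct vs" "set (butlast vs) \<subseteq> ordinary B S"
    and "disjoint_ends (aux_ends B S) N" "Inr ` set (butlast vs) \<subseteq> N"
    and "(last vs, sg B (last es) (last vs)) \<in> S" "Leaf (last vs) (last es) \<notin> covered (aux_ends B S) N"
  shows "disjoint_ends (aux_ends B S) (N - Inr ` set (butlast vs) \<union> Inl ` set es) \<and>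
    covered (aux_ends B S) (N - Inr ` set (butlast vs) \<union> Inl ` set es) =
      insert (Leaf (last vs) (last es))
        (covered (aux_ends B S) N - {Node (hd vs) (neg (sg B (hd es) (hd vs)))})"
  using assms(1-4,6-8)
proof (induction es arbitrary: vs)
  case (Cons e es)
  let ?en = "aux_ends B S"
  obtain x ws where vs: "vs = x # ws" using Cons.prems(1) by (cases vs) (auto simp: trail_def)
  have T: "ws \<noteq> []" "trail B (ws, es)" "ends B e = {x, hd ws}"
    "es \<noteq> [] \<longrightarrow> sg B (hd es) (hd ws) = neg (sg B e (hd ws))"
    using Cons.prems(1) vs by (auto simp: trail_Cons)
  have xw: "x \<notin> set ws" using Cons.prems(3) vs by simp
  have bl: "butlast vs = x # butlast ws" using vs T(1) by simp
  have xo: "x \<in> ordinary B S" using Cons.prems(4) bl by simp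
  have hx: "half B S e x = Node x (sg B e x)" using ordinary_Node[OF xo] .
  have inr: "?en (Inr x) = {Node x (sg B e x), Node x (neg (sg B e x))}" by (rule Inr_ends)
  have ee: "?en (Inl e) = {Node x (sg B e x), half B S e (hd ws)}" using T(3) hx by simp
  show ?case
  proof (cases "es = []")
    case True
    then have ws: "ws = [hd ws]" using T(1,2) by (cases ws) (auto simp: trail_def)
    then have lw: "last ws = hd ws" by (metis last.simps)
    have hy: "half B S e (hd ws) = Leaf (hd ws) e"
      using Cons.prems(6) True vs lw T(1) by (simp add: half_def)
    have c: "covered ?en (N - {Inr x}) = covered ?en N - {Node x (sg B e x), Node x (neg (sg B e x))}"
      using covered_remove[OF assms(5), of "Inr x"] Cons.prems(5) bl inr by simp
    have nx: "Node x (sg B e x) \<in> covered ?en N"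
    proof -
      have "Inr x \<in> N" using Cons.prems(5) bl by auto
      then show ?thesis using inr unfolding covered_def by blast
    qed
    have eq: "N - Inr ` set (butlast vs) \<union> Inl ` set (e # es) = insert (Inl e) (N - {Inr x})"
      unfolding bl using True ws by (cases ws) auto
    have lf: "Leaf (hd ws) e \<notin> covered ?en N" using Cons.prems(7) True vs lw T(1) by simp
    have "disjoint_ends ?en (insert (Inl e) (N - {Inr x}))"
      using disjoint_ends_subset[OF assms(5), of "N - {Inr x}"] c lf
      by (intro disjoint_ends_insert) (auto simp del: aux_ends_simps simp: ee hy)
    moreover have "covered ?en (insert (Inl e) (N - {Inr x})) =
        insert (Leaf (hd ws) e) (covered ?en N - {Node x (neg (sg B e x))})"
      unfolding covered_insert ee hy c using nx by auto
    ultimately show ?thesis unfolding eq using True vs lw T(1) by simp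
  next
    case False
    let ?y = "hd ws"
    let ?N = "N - Inr ` set (butlast ws) \<union> Inl ` set es"
    have "disjoint_ends ?en ?N \<and> covered ?en ?N =
      insert (Leaf (last ws) (last es)) (covered ?en N - {Node ?y (neg (sg B (hd es) ?y))})"
      using Cons.IH[OF T(2) False] Cons.prems vs T(1) bl False by simp
    then have I: "disjoint_ends ?en ?N" "covered ?en ?N =
      insert (Leaf (last ws) (last es)) (covered ?en N - {Node ?y (sg B e ?y)})"
      using T(4) False by simp_all
    have "length ws > 1" using T(2) False by (cases es) (auto simp: trail_def)
    then have yb: "?y \<in> set (butlast ws)" by (cases ws; cases "tl ws") auto
    then have yo: "?y \<in> ordinary B S" using Cons.prems(4) bl by auto
    have hy: "half B S e ?y = Node ?y (sg B e ?y)" using ordinary_Node[OF yo] .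
    have xy: "x \<noteq> ?y" using xw T(1) by (cases ws) auto
    have xN: "Inr x \<in> ?N" using Cons.prems(5) bl xw by (auto dest: in_set_butlastD)
    have c: "covered ?en (?N - {Inr x}) = covered ?en ?N - {Node x (sg B e x), Node x (neg (sg B e x))}"
      using covered_remove[OF I(1) xN] inr by simp
    have nx: "Node x (sg B e x) \<in> covered ?en N"
    proof -
      have "Inr x \<in> N" using Cons.prems(5) bl by auto
      then show ?thesis using inr unfolding covered_def by blast
    qed
    have ny: "Node ?y (sg B e ?y) \<in> covered ?en N"
    proof -
      have "Inr ?y \<in> N" using Cons.prems(5) bl yb by auto
      then show ?thesis using Inr_ends[of B S ?y "sg B e ?y"] unfolding covered_def by blast
    qed
    have eq: "N - Inr ` set (butlast vs) \<union> Inl ` set (e # es) = insert (Inl e) (?N - {Inr x})"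
      unfolding bl by auto
    have "disjoint_ends ?en (insert (Inl e) (?N - {Inr x}))"
      using disjoint_ends_subset[OF I(1), of "?N - {Inr x}"]
      by (intro disjoint_ends_insert) (simp_all only: ee hy c I(2), auto)
    moreover have "covered ?en (insert (Inl e) (?N - {Inr x})) =
        insert (Leaf (last ws) (last es)) (covered ?en N - {Node x (neg (sg B e x))})"
      unfolding covered_insert ee hy c I(2) using nx ny xy by auto
    ultimately show ?thesis unfolding eq using False vs T(1) by simp
  qed
qed simp

definition path_matching ::
    "('v, 'e) bigraph \<Rightarrow> ('v \<times> sign) set \<Rightarrow> ('v list \<times> 'e list) set \<Rightarrow> ('e + 'v) set" where
  "path_matching B S P = Inl ` (\<Union>p\<in>P. set (snd p)) \<union> Inr ` (ordinary B S - (\<Union>p\<in>P. internal_verts p))"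

context clean_rooted
begin

lemma paths_path_system:
  assumes E: "E \<subseteq> edges B" and w: "w \<in> verts B - {r}"
    and "finite P" "disjoint_signed_paths (restr E) r w s P"
  shows "path_system B r E w s (path_matching B (targets r w s) P) \<and>
    card (leaves B (targets r w s) (path_matching B (targets r w s) P) r) = card P \<and>
    card (leaves B (targets r w s) (path_matching B (targets r w s) P) w) = card P"
  using assms(3,4)
proof (induction P rule: finite_induct)
  case empty
  let ?S = "targets r w s"
  have "covered (aux_ends B ?S) (path_matching B ?S {}) = (\<Union>v\<in>verts B - {r, w}. {Node v Plus, Node v Minus})"
    by (auto simp: path_matching_def covered_def ordinary_targets)
  moreover have "disjoint_ends (aux_ends B ?S) (path_matching B ?S {})"
    by (auto simp: path_matching_def disjoint_ends_def)
  moreover have "t = Plus \<or> t = Minus" for t by (cases t) auto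
  ultimately show ?case
    by (auto simp: path_system_def leaves_def path_matching_def aux_edges_def ordinary_targets)
next
  case (insert p P)
  let ?S = "targets r w s"
  let ?en = "aux_ends B ?S"
  let ?N = "path_matching B ?S P" and ?N' = "path_matching B ?S (insert p P)"
  have dP: "disjoint_signed_paths (restr E) r w s P"
    using insert.prems by (auto simp: disjoint_signed_paths_def)
  note IH = insert.IH[OF dP]
  have N: "?N \<subseteq> aux_edges B ?S E" "disjoint_ends ?en ?N"
    "\<And>y t. Node y t \<in> covered ?en ?N \<longleftrightarrow> y \<in> verts B - {r, w}"
    using IH by (simp_all add: path_system_def)
  have fN: "finite ?N"
    using N(1) multigraph_aux[OF bidirected_B finite_B E, of ?S] finite_subset by (auto simp: multigraph_def)
  have sp: "signed_path B r w s p" "set (snd p) \<subseteq> E"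
    using insert.prems signed_path_edges_update[OF E] by (auto simp: disjoint_signed_paths_def)
  obtain ws f es where p: "p = (r # ws, f # es)"
  proof (cases p)
    case (Pair vs es)
    then have "vs \<noteq> []" "es \<noteq> []" "hd vs = r"
      using sp by (auto simp: signed_path_def path_def trail_def trail_from_to_def trivial_trail_def)
    then show thesis using that Pair by (metis list.exhaust_sel)
  qed
  have T: "trail B (r # ws, f # es)" "distinct (r # ws)" "last ws = w" "sg B (last (f # es)) w = s"
    using sp p w by (auto simp: signed_path_def path_def trail_from_to_def split: if_splits)
  have T': "ws \<noteq> []" "trail B (ws, es)" "ends B f = {r, hd ws}"
    "es \<noteq> [] \<longrightarrow> sg B (hd es) (hd ws) = neg (sg B f (hd ws))"
    using T(1) by (auto simp: trail_Cons)
  have iv: "internal_verts p = set (butlast ws)" using p by (simp add: internal_verts_def)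
  have io: "set (butlast ws) \<subseteq> ordinary B ?S"
  proof -
    obtain bs where "ws = bs @ [w]" using T'(1) T(3) by (metis append_butlast_last_id)
    then show ?thesis using T(2) T'(2) by (auto simp: ordinary_targets trail_def)
  qed
  have fresh: "Inl e \<notin> ?N" if "e \<in> set (f # es)" for e
  proof
    assume "Inl e \<in> ?N"
    then obtain q where q: "q \<in> P" "e \<in> set (snd q)" by (auto simp: path_matching_def)
    have "bidirected_graph (restr E)" using bidirected_B E by (auto simp: bidirected_graph_def)
    moreover have "p \<noteq> q" "r \<noteq> w" using q insert.hyps w by auto
    ultimately have "set (snd p) \<inter> set (snd q) = {}"
      using disjoint_signed_paths_edges[OF insert.prems, of p q] q(1) by simp
    then show False using q that p by auto
  qed
  have pij: "internal_verts p \<inter> (\<Union>q\<in>P. internal_verts q) = {}"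
    using insert.prems insert.hyps by (fastforce simp: disjoint_signed_paths_def)
  have iN: "Inr ` set (butlast ws) \<subseteq> ?N"
  proof -
    have "set (butlast ws) \<subseteq> ordinary B ?S - (\<Union>q\<in>P. internal_verts q)" using pij io iv by blast
    then show ?thesis unfolding path_matching_def by blast
  qed
  have N': "?N' = insert (Inl f) (?N - Inr ` set (butlast ws) \<union> Inl ` set es)"
    using p iv by (auto simp: path_matching_def)
  have lr: "Leaf r f \<notin> covered ?en ?N" "Leaf w (last (f # es)) \<notin> covered ?en ?N"
    using fresh by (simp_all add: Leaf_covered)
  have hr: "half B ?S f r = Leaf r f" by (simp add: half_def targets_sign)
  have "disjoint_ends ?en ?N' \<and>
    covered ?en ?N' = covered ?en ?N \<union> {Leaf r f, Leaf w (last (f # es))}"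
  proof (cases "es = []")
    case True
    then have ws: "ws = [w]" using T'(1,2) T(3) by (cases ws) (auto simp: trail_def)
    have hw: "half B ?S f w = Leaf w f" using T(4) True by (simp add: half_def targets_def)
    have N'': "?N' = insert (Inl f) ?N" using N' ws True by simp
    have ef: "?en (Inl f) = {Leaf r f, Leaf w f}" using T'(3) ws hr hw by simp
    show ?thesis unfolding N'' covered_insert ef
      using lr True N(2) by (auto intro!: disjoint_ends_insert simp del: aux_ends_simps simp: ef)
  next
    case False
    let ?M = "?N - Inr ` set (butlast ws) \<union> Inl ` set es" and ?x = "hd ws"
    have "disjoint_ends ?en ?M \<and> covered ?en ?M =
      insert (Leaf (last ws) (last es)) (covered ?en ?N - {Node ?x (neg (sg B (hd es) ?x))})"
      using T T' False io N(2) iN lr(2) by (intro insert_trail) (auto simp: targets_def)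
    then have I: "disjoint_ends ?en ?M"
      "covered ?en ?M = insert (Leaf w (last es)) (covered ?en ?N - {Node ?x (sg B f ?x)})"
      using T(3) T'(4) False by simp_all
    have "length ws > 1" using T'(2) False by (cases es) (auto simp: trail_def)
    then have xb: "?x \<in> set (butlast ws)" by (cases ws; cases "tl ws") auto
    then have xo: "?x \<in> ordinary B ?S" using io by auto
    have ef: "?en (Inl f) = {Leaf r f, Node ?x (sg B f ?x)}"
      using T'(3) hr ordinary_Node[OF xo] by simp
    have xN: "Node ?x (sg B f ?x) \<in> covered ?en ?N" using N(3) xo by (simp add: ordinary_targets)
    have rw: "r \<noteq> w" using w by auto
    then have "?en (Inl f) \<inter> covered ?en ?M = {}"
      unfolding ef I(2) using lr(1) by simp
    from disjoint_ends_insert[OF I(1) this] have "disjoint_ends ?en ?N'" unfolding N' .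
    moreover have "covered ?en ?N' = covered ?en ?N \<union> {Leaf r f, Leaf w (last (f # es))}"
      unfolding N' covered_insert ef I(2) using xN False by auto
    ultimately show ?thesis by simp
  qed
  then have D: "disjoint_ends ?en ?N'"
    "covered ?en ?N' = covered ?en ?N \<union> {Leaf r f, Leaf w (last (f # es))}" by simp_all
  have "leaves B ?S ?N' r = insert f (leaves B ?S ?N r)"
    "leaves B ?S ?N' w = insert (last (f # es)) (leaves B ?S ?N w)"
    unfolding leaves_def D(2) using w by auto
  moreover have "f \<notin> leaves B ?S ?N r" "last (f # es) \<notin> leaves B ?S ?N w"
    using lr by (simp_all add: leaves_def)
  moreover have "?N' \<subseteq> aux_edges B ?S E" unfolding N' using N(1) sp(2) p by (auto simp: aux_edges_def)
  moreover have "Node y t \<in> covered ?en ?N' \<longleftrightarrow> y \<in> verts B - {r, w}" for y t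
    unfolding D(2) using N(3) by auto
  ultimately show ?case
    using D(1) IH insert.hyps finite_leaves[OF fN] by (simp add: path_system_def)
qed

lemma path_system_exists:
  assumes "E \<subseteq> edges B" "w \<in> verts B - {r}"
  obtains N where "path_system B r E w s N" "card (leaves B (targets r w s) N r) = kap E w s"
    "card (leaves B (targets r w s) N w) = kap E w s"
proof -
  obtain P where "finite P" "disjoint_signed_paths (restr E) r w s P" "card P = kap E w s"
    using kappa_attained[OF finite_restr[OF assms(1)]] by blast
  then show thesis using paths_path_system[OF assms, of P s] that by metis
qed

end

section \<open>Changing the set of leaves\<close>

text \<open>The gluing map from a graph with more leaves: a leaf whose half-edge is not in
  \<open>S\<close> returns to its node. Matchings always pull back along it; pushing them forward
  requires injectivity on the covered vertices.\<close>

fun merge_leaf :: "('v, 'e) bigraph \<Rightarrow> ('v \<times> sign) set \<Rightarrow> ('v, 'e) half_vertex \<Rightarrow> ('v, 'e) half_vertex" where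
  "merge_leaf B S (Node x s) = Node x s"
| "merge_leaf B S (Leaf x f) = (if (x, sg B f x) \<in> S then Leaf x f else Node x (sg B f x))"

lemma merge_leaf_half: "S \<subseteq> S' \<Longrightarrow> merge_leaf B S (half B S' e x) = half B S e x"
  by (auto simp: half_def)

lemma merge_leaf_ends: "S \<subseteq> S' \<Longrightarrow> aux_ends B S l = merge_leaf B S ` aux_ends B S' l"
  by (cases l) (auto simp: merge_leaf_half image_image)

lemma merge_leaf_covered:
  assumes "S \<subseteq> S'" shows "covered (aux_ends B S) N = merge_leaf B S ` covered (aux_ends B S') N"
  unfolding covered_def image_UN by (intro SUP_cong refl merge_leaf_ends assms)

lemma disjoint_ends_more_leaves:
  assumes "S \<subseteq> S'" "disjoint_ends (aux_ends B S) N"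
  shows "disjoint_ends (aux_ends B S') N"
  unfolding disjoint_ends_def
proof (intro ballI impI)
  fix l l' assume "l \<in> N" "l' \<in> N" "l \<noteq> l'"
  then have "aux_ends B S l \<inter> aux_ends B S l' = {}" using assms(2) by (auto simp: disjoint_ends_def)
  then show "aux_ends B S' l \<inter> aux_ends B S' l' = {}"
    unfolding merge_leaf_ends[OF assms(1), of B l] merge_leaf_ends[OF assms(1), of B l'] by blast
qed

lemma disjoint_ends_fewer_leaves:
  assumes S: "S \<subseteq> S'" and "disjoint_ends (aux_ends B S') N"
    and inj: "inj_on (merge_leaf B S) (covered (aux_ends B S') N)"
  shows "disjoint_ends (aux_ends B S) N"
  unfolding disjoint_ends_def
proof (intro ballI impI)
  fix l l' assume l: "l \<in> N" "l' \<in> N" "l \<noteq> l'"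
  then have "aux_ends B S' l \<inter> aux_ends B S' l' = {}" using assms(2) by (auto simp: disjoint_ends_def)
  moreover have "aux_ends B S' l \<subseteq> covered (aux_ends B S') N" "aux_ends B S' l' \<subseteq> covered (aux_ends B S') N"
    using l by (auto simp: covered_def)
  ultimately show "aux_ends B S l \<inter> aux_ends B S l' = {}"
    unfolding merge_leaf_ends[OF S] using inj_on_image_Int[OF inj] by (metis image_empty)
qed

lemma merge_no_leaf:
  assumes "S \<subseteq> S'" and "\<And>x f. Leaf x f \<in> covered (aux_ends B S') N \<Longrightarrow> (x, sg B f x) \<in> S"
  shows "covered (aux_ends B S) N = covered (aux_ends B S') N"
    and "disjoint_ends (aux_ends B S') N \<Longrightarrow> disjoint_ends (aux_ends B S) N"
proof -
  have id: "merge_leaf B S h = h" if "h \<in> covered (aux_ends B S') N" for h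
    using assms(2) that by (cases h) auto
  then show "covered (aux_ends B S) N = covered (aux_ends B S') N"
    using merge_leaf_covered[OF assms(1), of B N] by simp
  have "inj_on (merge_leaf B S) (covered (aux_ends B S') N)" using id by (auto intro!: inj_onI)
  then show "disjoint_ends (aux_ends B S') N \<Longrightarrow> disjoint_ends (aux_ends B S) N"
    using disjoint_ends_fewer_leaves[OF assms(1)] by blast
qed

lemma merge_one_leaf:
  assumes S: "S \<subseteq> S'" and "Leaf v g \<in> covered (aux_ends B S') N" "(v, sg B g v) \<notin> S"
    and "\<And>x f. Leaf x f \<in> covered (aux_ends B S') N \<Longrightarrow> Leaf x f \<noteq> Leaf v g \<Longrightarrow> (x, sg B f x) \<in> S"
    and "Node v (sg B g v) \<notin> covered (aux_ends B S') N"
  shows "covered (aux_ends B S) N = insert (Node v (sg B g v)) (covered (aux_ends B S') N - {Leaf v g})"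
    and "disjoint_ends (aux_ends B S') N \<Longrightarrow> disjoint_ends (aux_ends B S) N"
proof -
  let ?C = "covered (aux_ends B S') N"
  have id: "merge_leaf B S h = h" if "h \<in> ?C" "h \<noteq> Leaf v g" for h
    using assms(4) that by (cases h) auto
  have v: "merge_leaf B S (Leaf v g) = Node v (sg B g v)" using assms(3) by simp
  have "?C = insert (Leaf v g) (?C - {Leaf v g})" using assms(2) by auto
  then have "merge_leaf B S ` ?C = insert (Node v (sg B g v)) (merge_leaf B S ` (?C - {Leaf v g}))"
    using v by (metis image_insert)
  also have "merge_leaf B S ` (?C - {Leaf v g}) = ?C - {Leaf v g}" using id by force
  finally show "covered (aux_ends B S) N = insert (Node v (sg B g v)) (?C - {Leaf v g})"
    using merge_leaf_covered[OF S, of B N] by simp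
  have "inj_on (merge_leaf B S) ?C"
  proof (rule inj_onI)
    fix h h' assume h: "h \<in> ?C" "h' \<in> ?C" "merge_leaf B S h = merge_leaf B S h'"
    show "h = h'"
      using h id v assms(5) by (cases "h = Leaf v g"; cases "h' = Leaf v g") auto
  qed
  then show "disjoint_ends (aux_ends B S') N \<Longrightarrow> disjoint_ends (aux_ends B S) N"
    using disjoint_ends_fewer_leaves[OF S] by blast
qed

lemma Leaf_in_covered: "Leaf x f \<in> covered (aux_ends B S) N \<Longrightarrow> (x, sg B f x) \<in> S"
  by (simp add: Leaf_covered)

lemma Node_in_covered_Inl:
  "Node x s \<in> covered (aux_ends B S) N \<Longrightarrow> (x, s) \<in> S \<Longrightarrow> Inr x \<in> N"
  by (erule Node_covered) (auto simp: half_Node)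

lemma Inr_covered: "Inr x \<in> N \<Longrightarrow> Node x s \<in> covered (aux_ends B S) N"
  using Inr_ends[of B S x s] unfolding covered_def by blast

section \<open>Cleanness as maximality of the base matching\<close>

context clean_rooted
begin

abbreviation S0 :: "('v \<times> sign) set" where "S0 \<equiv> {(r, Plus), (r, Minus)}"
abbreviation en0 :: "'e + 'v \<Rightarrow> ('v, 'e) half_vertex set" where "en0 \<equiv> aux_ends B S0"
abbreviation H :: "'e set \<Rightarrow> ('e + 'v) set" where "H E \<equiv> aux_edges B S0 E"
abbreviation D :: "'e set \<Rightarrow> ('v, 'e) half_vertex set" where "D E \<equiv> missable en0 (H E)"
abbreviation n :: nat where "n \<equiv> card (verts B - {r})"

definition nodes :: "'v set \<Rightarrow> ('v, 'e) half_vertex set" where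
  "nodes X = (\<Union>v\<in>X. {Node v Plus, Node v Minus})"

definition base_matching :: "('e + 'v) set" where "base_matching = Inr ` (verts B - {r})"

lemma nodes_iff [simp]: "Node v s \<in> nodes X \<longleftrightarrow> v \<in> X" "Leaf v f \<notin> nodes X"
  by (cases s) (auto simp: nodes_def)

lemma S0_root: "(r, s) \<in> S0" by (cases s) auto

lemma S0_iff: "(x, s) \<in> S0 \<longleftrightarrow> x = r" by (cases s) auto

lemma ordinary_S0: "ordinary B S0 = verts B - {r}" by (auto simp: ordinary_def)

lemma finite_verts: "finite (verts B)" using finite_B by (simp add: finite_bigraph_def)

lemma card_nodes: "finite X \<Longrightarrow> card (nodes X) = 2 * card X" "finite X \<Longrightarrow> finite (nodes X)"
proof -
  assume X: "finite X"
  have "card (\<Union>v\<in>X. {Node v Plus, Node v Minus} :: ('v, 'e) half_vertex set) =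
      (\<Sum>v\<in>X. card {Node v Plus, Node v Minus :: ('v, 'e) half_vertex})"
    using X by (intro card_UN_disjoint) auto
  then show "card (nodes X) = 2 * card X" by (simp add: nodes_def)
  show "finite (nodes X)" using X by (auto simp: nodes_def)
qed

lemma covered_Inr: "covered (aux_ends B S) (Inr ` X) = nodes X"
  by (auto simp: covered_def nodes_def)

lemma disjoint_ends_Inr: "disjoint_ends (aux_ends B S) (Inr ` X)"
  by (auto simp: disjoint_ends_def)

lemma H_multigraph: "E \<subseteq> edges B \<Longrightarrow> multigraph en0 (H E)"
  using multigraph_aux[OF bidirected_B finite_B] .

lemma base_matching: "matching en0 (H E) base_matching" "covered en0 base_matching = nodes (verts B - {r})"
  "card base_matching = n"
  by (auto simp: base_matching_def matching_def covered_Inr disjoint_ends_Inr aux_edges_def ordinary_S0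
      card_image)

lemma node_vert:
  assumes "E \<subseteq> edges B" "N \<subseteq> aux_edges B S E" "Node x s \<in> covered (aux_ends B S) N"
    and "\<And>s. (r, s) \<in> S"
  shows "x \<in> verts B - {r}"
  using assms(3)
proof (cases rule: Node_covered)
  case 1
  then have "x \<in> ordinary B S" using assms(2) by (auto simp: aux_edges_def)
  then show ?thesis using assms(4)[of Plus] by (auto simp: ordinary_def)
next
  case (2 e)
  then have "e \<in> edges B" using assms(1,2) by (auto simp: aux_edges_def)
  then have "x \<in> verts B" using 2 bidirected_B by (auto simp: bidirected_graph_def)
  moreover have "x \<noteq> r" using 2(4) assms(4) by (auto simp: half_Node)
  ultimately show ?thesis by simp
qed

text \<open>A walk from such a leaf would have to end at another leaf, and with leaf set
  \<open>S0\<close> all leaves belong to \<open>r\<close>.\<close>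

lemma full_no_leaf:
  assumes E: "E \<subseteq> edges B" and N: "matching en0 (H E) N"
    and full: "nodes (verts B - {r}) \<subseteq> covered en0 N"
  shows "Leaf r f \<notin> covered en0 N"
proof
  assume f: "Leaf r f \<in> covered en0 N"
  have N': "N \<subseteq> H E" "disjoint_ends en0 N" using N by (auto simp: matching_def)
  have fN: "finite N"
    using matching_multigraph[OF H_multigraph[OF E] N] by (simp add: multigraph_def)
  have "Node y t \<in> covered en0 N \<longleftrightarrow> y \<in> ordinary B S0" for y t
  proof
    show "Node y t \<in> covered en0 N \<Longrightarrow> y \<in> ordinary B S0"
      using node_vert[OF E N'(1) _ S0_root] unfolding ordinary_S0 by blast
    show "y \<in> ordinary B S0 \<Longrightarrow> Node y t \<in> covered en0 N"
      using full nodes_iff(1)[of y t "verts B - {r}"] unfolding ordinary_S0 by blast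
  qed
  from root_walk_exists[OF bidirected_B E fN N' this f] obtain vs es where
    rw: "root_walk B S0 N r vs f es" by blast
  then have "Leaf (last vs) (last (f # es)) \<in> covered en0 N" by (simp add: root_walk_def)
  then have "last vs = r" using Leaf_in_covered S0_iff by metis
  then show False using root_walk_no_return[OF rw] by simp
qed

lemma covered_cases:
  assumes "E \<subseteq> edges B" "N \<subseteq> H E" "h \<in> covered en0 N"
  obtains "h \<in> nodes (verts B - {r})" | f where "h = Leaf r f"
proof (cases h)
  case (Node x s)
  then have "x \<in> verts B - {r}" using assms(3) node_vert[OF assms(1,2) _ S0_root] by simp
  then show thesis using that(1) Node nodes_iff(1) by simp
next
  case (Leaf x f)
  then have "(x, sg B f x) \<in> S0" using assms(3) by (simp add: Leaf_covered)
  then have "x = r" by auto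
  then show thesis using that(2) Leaf by simp
qed

text \<open>Root leaves are exchanged away one at a time against \<open>base_matching\<close>:
  \<open>gain\<close> would cover all nodes together with a root leaf, contrary to
  \<open>full_no_leaf\<close>, and \<open>loss\<close> keeps the size. Without root leaves only the
  \<open>2 * n\<close> nodes remain to be covered.\<close>

lemma matching_card_le:
  assumes E: "E \<subseteq> edges B" and N: "matching en0 (H E) N"
  shows "card N \<le> n"
  using N
proof (induction "card (leaves B S0 N r)" arbitrary: N rule: less_induct)
  case less
  have N': "N \<subseteq> H E" "disjoint_ends en0 N" using less.prems by (auto simp: matching_def)
  have mN: "multigraph en0 N" using matching_multigraph[OF H_multigraph[OF E] less.prems] .
  show ?case
  proof (cases "leaves B S0 N r = {}")
    case True
    then have "covered en0 N \<subseteq> nodes (verts B - {r})"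
      using covered_cases[OF E N'(1)] by (auto simp: leaves_def)
    then have "card (covered en0 N) \<le> 2 * n"
      using card_nodes[of "verts B - {r}"] finite_verts card_mono by (metis finite_Diff)
    then show ?thesis using card_covered(1)[OF mN N'(2)] by simp
  next
    case False
    then obtain f where f: "f \<in> leaves B S0 N r" by auto
    then have fc: "Leaf r f \<in> covered en0 N" by (simp add: leaves_def)
    have nf: "Leaf r f \<notin> covered en0 base_matching" by (simp add: base_matching)
    from H_multigraph[OF E] base_matching(1) less.prems fc nf show ?thesis
    proof (cases rule: matching_exchange_card)
      case (gain N1 N1' t)
      then have "Leaf r f \<notin> covered en0 N1"
        by (intro full_no_leaf[OF E gain(1)]) (auto simp: base_matching)
      then show ?thesis using gain by auto
    next
      case (loss N1 N1' t)
      then have "leaves B S0 N1' r = leaves B S0 N r - {f}"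
        by (auto simp: leaves_def base_matching)
      then have "card (leaves B S0 N1' r) < card (leaves B S0 N r)"
        using f finite_leaves[of N B S0 r] mN by (simp only: multigraph_def card_Diff1_less)
      from less.hyps[OF this loss(2)] show ?thesis using loss(10) by simp
    qed
  qed
qed

lemma base_max_matching: "E \<subseteq> edges B \<Longrightarrow> max_matching en0 (H E) base_matching"
  using base_matching matching_card_le by (simp add: max_matching_def)

lemma max_matching_iff:
  "E \<subseteq> edges B \<Longrightarrow> max_matching en0 (H E) N \<longleftrightarrow> matching en0 (H E) N \<and> card N = n"
  using max_matching_card[OF base_max_matching, of E N] max_matchingI[OF base_max_matching, of E N]
    base_matching(3) by (auto simp: max_matching_def)

lemma H_mono: "E \<subseteq> E' \<Longrightarrow> H E \<subseteq> H E'" by (auto simp: aux_edges_def)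

text \<open>The maximum size is \<open>n\<close> for every edge set, so a maximum matching stays
  maximum when edges are added.\<close>

lemma D_mono:
  assumes "E \<subseteq> E'" "E' \<subseteq> edges B" shows "D E \<subseteq> D E'"
proof
  fix h assume "h \<in> D E"
  then obtain N where "max_matching en0 (H E) N" "h \<notin> covered en0 N" by (auto simp: missable_def)
  then show "h \<in> D E'"
    using max_matching_iff[of E N] max_matching_iff[OF assms(2), of N] assms
      matching_mono[of en0 "H E" N "H E'", OF _ H_mono[OF assms(1)]]
      missableI[of en0 "H E'" N h] by blast
qed

text \<open>\<open>missable\<close> ranges over the whole type and \<open>base_matching\<close>
  covers only nodes, so every leaf lies in \<open>D\<close>, even one of an absent edge. Hence two
  such sets can differ only in nodes.\<close>

lemma not_node_in_D: "E \<subseteq> edges B \<Longrightarrow> h \<notin> nodes (verts B - {r}) \<Longrightarrow> h \<in> D E"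
  using missableI[OF base_max_matching] base_matching(2) by blast

end

lemma Leaf_covered_more:
  "S \<subseteq> S' \<Longrightarrow> Leaf x f \<in> covered (aux_ends B S) N \<Longrightarrow> Leaf x f \<in> covered (aux_ends B S') N"
  by (auto simp: Leaf_covered)

lemma Node_covered_more:
  assumes "Node x s \<in> covered (aux_ends B S) N" "(x, s) \<notin> S'"
  shows "Node x s \<in> covered (aux_ends B S') N"
  using assms(1)
proof (cases rule: Node_covered)
  case 1
  then show ?thesis by (rule Inr_covered)
next
  case (2 e)
  then have "half B S' e x = Node x s" using assms(2) by (simp add: half_def)
  then have "Node x s \<in> aux_ends B S' (Inl e)" using 2 by (auto intro: rev_image_eqI)
  then show ?thesis using 2 unfolding covered_def by blast
qed

lemma Node_covered_fewer:
  assumes "Node x s \<in> covered (aux_ends B S') N" "S \<subseteq> S'"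
  shows "Node x s \<in> covered (aux_ends B S) N"
  using assms(1)
proof (cases rule: Node_covered)
  case 1
  then show ?thesis by (rule Inr_covered)
next
  case (2 e)
  then have "half B S e x = Node x s" using assms(2) by (auto simp: half_def split: if_splits)
  then have "Node x s \<in> aux_ends B S (Inl e)" using 2 by (auto intro: rev_image_eqI)
  then show ?thesis using 2 unfolding covered_def by blast
qed

section \<open>Connectivity and membership in \<open>D\<close>\<close>

context clean_rooted
begin

lemma targets_iff: "w \<noteq> r \<Longrightarrow> (x, t) \<in> targets r w s \<longleftrightarrow> x = r \<or> x = w \<and> t = s"
  by (cases t) (auto simp: targets_def)

lemma S0_targets: "S0 \<subseteq> targets r w s" by (auto simp: targets_def)

lemma finite_aux: "E \<subseteq> edges B \<Longrightarrow> N \<subseteq> aux_edges B S E \<Longrightarrow> finite N"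
  using multigraph_aux[OF bidirected_B finite_B, of E S] finite_subset[of N]
  by (simp add: multigraph_def)

lemma multigraph_sub: "E \<subseteq> edges B \<Longrightarrow> N \<subseteq> aux_edges B S E \<Longrightarrow> multigraph (aux_ends B S) N"
  using multigraph_aux[OF bidirected_B finite_B, of E S] multigraph_subset by blast

lemma targets_cover:
  assumes "E \<subseteq> edges B" "w \<noteq> r" "N \<subseteq> aux_edges B (targets r w s) E"
    and "h \<in> covered (aux_ends B (targets r w s)) N"
  obtains y t where "h = Node y t" "y \<in> verts B - {r}"
  | f where "h = Leaf r f" | f where "h = Leaf w f"
proof (cases h)
  case (Node y t)
  then show thesis using that(1) node_vert[OF assms(1,3) _ targets_sign] assms(4) by metis
next
  case (Leaf x f)
  then have "(x, sg B f x) \<in> targets r w s" using assms(4) Leaf_in_covered by metis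
  then show thesis using that(2,3) Leaf targets_iff[OF assms(2)] by auto
qed

text \<open>Both sides count covered vertices, with 2 added for the two uncovered nodes of
  \<open>w\<close>.\<close>

lemma path_system_card:
  assumes E: "E \<subseteq> edges B" and w: "w \<in> verts B - {r}" and N: "path_system B r E w s N"
  shows "2 * card N + 2 =
    2 * n + card (leaves B (targets r w s) N r) + card (leaves B (targets r w s) N w)"
proof -
  let ?S = "targets r w s"
  let ?C = "covered (aux_ends B ?S) N"
  have N': "N \<subseteq> aux_edges B ?S E" "disjoint_ends (aux_ends B ?S) N"
    "\<And>y t. Node y t \<in> ?C \<longleftrightarrow> y \<in> verts B - {r, w}" using N by (simp_all add: path_system_def)
  have fN: "finite N" using finite_aux[OF E N'(1)] .
  have wr: "w \<noteq> r" using w by auto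
  have "?C = nodes (verts B - {r, w}) \<union> Leaf r ` leaves B ?S N r \<union> Leaf w ` leaves B ?S N w"
  proof (intro equalityI subsetI)
    fix h assume h: "h \<in> ?C"
    from targets_cover[OF E wr N'(1) h]
    show "h \<in> nodes (verts B - {r, w}) \<union> Leaf r ` leaves B ?S N r \<union> Leaf w ` leaves B ?S N w"
      by cases (use h N'(3) in \<open>auto simp: leaves_def\<close>)
  next
    fix h assume "h \<in> nodes (verts B - {r, w}) \<union> Leaf r ` leaves B ?S N r \<union> Leaf w ` leaves B ?S N w"
    then show "h \<in> ?C" using N'(3) by (cases h) (auto simp: leaves_def)
  qed
  moreover have "card (nodes (verts B - {r, w}) \<union> Leaf r ` leaves B ?S N r \<union> Leaf w ` leaves B ?S N w) =
      card (nodes (verts B - {r, w})) + card (leaves B ?S N r) + card (leaves B ?S N w)"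
  proof -
    have "card (nodes (verts B - {r, w}) \<union> (Leaf r ` leaves B ?S N r \<union> Leaf w ` leaves B ?S N w)) =
      card (nodes (verts B - {r, w})) + card (Leaf r ` leaves B ?S N r \<union> Leaf w ` leaves B ?S N w)"
      using finite_verts finite_leaves[OF fN] card_nodes(2) by (intro card_Un_disjoint) auto
    also have "card (Leaf r ` leaves B ?S N r \<union> Leaf w ` leaves B ?S N w) =
        card (Leaf r ` leaves B ?S N r) + card (Leaf w ` leaves B ?S N w)"
      using finite_leaves[OF fN] wr by (intro card_Un_disjoint) auto
    finally show ?thesis by (simp add: card_image inj_on_def Un_assoc)
  qed
  moreover have "card (nodes (verts B - {r, w})) + 2 = 2 * n"
  proof -
    have "verts B - {r, w} = verts B - {r} - {w}" by auto
    then have "card (verts B - {r}) = Suc (card (verts B - {r, w}))"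
      using w finite_verts card.remove[of "verts B - {r}" w] by simp
    then show ?thesis using card_nodes(1)[of "verts B - {r, w}"] finite_verts by simp
  qed
  ultimately show ?thesis using card_covered(1)[OF multigraph_sub[OF E N'(1)] N'(2)] by simp
qed

text \<open>The passage from the graph with target \<open>(w, s)\<close> to the base graph. All
  target leaves would be glued to the single node \<open>Node w s\<close>, so at most one of them,
  \<open>f\<close>, can be kept and the other target edges are dropped.\<close>

lemma remove_target_leaves:
  assumes E: "E \<subseteq> edges B" and w: "w \<in> verts B - {r}"
    and N: "N \<subseteq> aux_edges B (targets r w s) E" "disjoint_ends (aux_ends B (targets r w s)) N"
    and A: "A \<subseteq> leaves B (targets r w s) N w" "A \<subseteq> {f}"
    and ws: "A \<noteq> {} \<longrightarrow> Node w s \<notin> covered (aux_ends B (targets r w s)) N"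
  defines "N' \<equiv> N - Inl ` (leaves B (targets r w s) N w - A)"
  shows "matching en0 (H E) N'"
    and "card N = card N' + card (leaves B (targets r w s) N w - A)"
    and "h \<in> covered en0 N' \<Longrightarrow> h \<in> covered (aux_ends B (targets r w s)) N' \<or> A \<noteq> {} \<and> h = Node w s"
proof -
  let ?S = "targets r w s"
  let ?W = "leaves B ?S N w"
  let ?C = "covered (aux_ends B ?S) N'"
  have wr: "w \<noteq> r" using w by auto
  have fN: "finite N" using finite_aux[OF E N(1)] .
  have W: "Inl ` ?W \<subseteq> N" by (auto simp: leaves_def Leaf_covered)
  have dN': "disjoint_ends (aux_ends B ?S) N'" using disjoint_ends_subset[OF N(2)] by (auto simp: N'_def)
  have lw: "g \<in> A" if "Leaf w g \<in> ?C" for g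
  proof -
    have "Inl g \<in> N'" "w \<in> ends B g" "(w, sg B g w) \<in> ?S" using that by (simp_all add: Leaf_covered)
    then show ?thesis by (auto simp: N'_def leaves_def Leaf_covered)
  qed
  have lf: "x = r \<or> x = w" if "Leaf x g \<in> ?C" for x g
    using Leaf_in_covered[OF that] targets_iff[OF wr] by auto
  have "disjoint_ends en0 N' \<and> (\<forall>h\<in>covered en0 N'. h \<in> ?C \<or> A \<noteq> {} \<and> h = Node w s)"
  proof (cases "A = {}")
    case True
    then have "(x, sg B g x) \<in> S0" if "Leaf x g \<in> ?C" for x g
      using lw lf[OF that] that S0_iff by auto
    then show ?thesis using merge_no_leaf[OF S0_targets] dN' by metis
  next
    case False
    then have Af: "A = {f}" using A(2) by auto
    have f: "Leaf w f \<in> covered (aux_ends B ?S) N" using Af A(1) by (auto simp: leaves_def)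
    then have f': "Inl f \<in> N" "w \<in> ends B f" "(w, sg B f w) \<in> ?S" by (simp_all add: Leaf_covered)
    then have sf: "sg B f w = s" using targets_iff[OF wr] wr by auto
    have "Inl f \<in> N'" using f' Af by (auto simp: N'_def)
    then have fC: "Leaf w f \<in> ?C" using f' by (simp add: Leaf_covered)
    have a1: "Node w (sg B f w) \<notin> ?C"
      using ws False sf covered_mono[of N' N "aux_ends B ?S"] by (auto simp: N'_def)
    have a2: "(x, sg B g x) \<in> S0" if "Leaf x g \<in> ?C" "Leaf x g \<noteq> Leaf w f" for x g
      using lw lf[OF that(1)] that Af S0_iff by auto
    have a3: "(w, sg B f w) \<notin> S0" using wr S0_iff by auto
    show ?thesis
      using merge_one_leaf[OF S0_targets fC a3 a2 a1] dN' sf False by auto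
  qed
  then show "matching en0 (H E) N'"
    "h \<in> covered en0 N' \<Longrightarrow> h \<in> ?C \<or> A \<noteq> {} \<and> h = Node w s"
    using N(1) by (auto simp: matching_def N'_def aux_edges_def ordinary_S0 ordinary_targets)
  have "N = N' \<union> Inl ` (?W - A)" "N' \<inter> Inl ` (?W - A) = {}" using W by (auto simp: N'_def)
  moreover have "finite N'" "finite (Inl ` (?W - A) :: ('e + 'v) set)"
    using fN finite_leaves[OF fN] by (auto simp: N'_def)
  ultimately have "card N = card N' + card (Inl ` (?W - A) :: ('e + 'v) set)"
    using card_Un_disjoint by metis
  then show "card N = card N' + card (?W - A)" by (simp add: card_image)
qed

text \<open>A system of \<open>k\<close> paths has \<open>n + k - 1\<close> edges. Keeping a single
  target edge leaves \<open>n\<close>, and then nothing covers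
  \<open>Node w (neg s)\<close>.\<close>

lemma kap_pos_D:
  assumes E: "E \<subseteq> edges B" and w: "w \<in> verts B - {r}" and k: "kap E w s \<noteq> 0"
  shows "Node w (neg s) \<in> D E"
proof -
  let ?S = "targets r w s"
  obtain N where N: "path_system B r E w s N" "card (leaves B ?S N r) = kap E w s"
    "card (leaves B ?S N w) = kap E w s"
    using path_system_exists[OF E w] .
  obtain f where f: "f \<in> leaves B ?S N w" using N(3) k by fastforce
  have N': "N \<subseteq> aux_edges B ?S E" "disjoint_ends (aux_ends B ?S) N"
    "\<And>y t. Node y t \<in> covered (aux_ends B ?S) N \<longleftrightarrow> y \<in> verts B - {r, w}"
    using N(1) by (simp_all add: path_system_def)
  let ?M = "N - Inl ` (leaves B ?S N w - {f})"
  have A: "{f} \<subseteq> leaves B ?S N w" "{f} \<subseteq> {f}" using f by auto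
  have "{f} \<noteq> {} \<longrightarrow> Node w s \<notin> covered (aux_ends B ?S) N" using N'(3) by simp
  note R = remove_target_leaves[OF E w N'(1,2) A this]
  have "card (leaves B ?S N w - {f}) = kap E w s - 1"
    using f N(3) finite_leaves[OF finite_aux[OF E N'(1)]] by simp
  then have "card ?M = n" using R(2) path_system_card[OF E w N(1)] N(2,3) k by simp
  then have M: "max_matching en0 (H E) ?M" using R(1) max_matching_iff[OF E] by simp
  have "Node w (neg s) \<notin> covered en0 ?M"
    using R(3)[of "Node w (neg s)"] N'(3)[of w "neg s"] covered_mono[of ?M N "aux_ends B ?S"] by auto
  then show ?thesis using missableI[OF M] by simp
qed

text \<open>When all target edges but one are dropped, the far end of a dropped edge
  \<open>g\<close> is missed along with \<open>Node w (neg s)\<close>. If \<open>Node w s\<close>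
  were in \<open>D\<close>, it would link these two through \<open>Inr w\<close> and
  \<open>g\<close>, against Gallai's lemma.\<close>

lemma kap_two_not_D:
  assumes E: "E \<subseteq> edges B" and w: "w \<in> verts B - {r}" and k: "kap E w s \<ge> 2"
  shows "Node w s \<notin> D E"
proof
  assume wD: "Node w s \<in> D E"
  let ?S = "targets r w s"
  obtain N where N: "path_system B r E w s N" "card (leaves B ?S N r) = kap E w s"
    "card (leaves B ?S N w) = kap E w s"
    using path_system_exists[OF E w] .
  obtain f where f: "f \<in> leaves B ?S N w" using N(3) k by fastforce
  have N': "N \<subseteq> aux_edges B ?S E" "disjoint_ends (aux_ends B ?S) N"
    "\<And>y t. Node y t \<in> covered (aux_ends B ?S) N \<longleftrightarrow> y \<in> verts B - {r, w}"
    using N(1) by (simp_all add: path_system_def)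
  let ?M = "N - Inl ` (leaves B ?S N w - {f})"
  have A: "{f} \<subseteq> leaves B ?S N w" "{f} \<subseteq> {f}" using f by auto
  have "{f} \<noteq> {} \<longrightarrow> Node w s \<notin> covered (aux_ends B ?S) N" using N'(3) by simp
  note R = remove_target_leaves[OF E w N'(1,2) A this]
  have c: "card (leaves B ?S N w - {f}) = kap E w s - 1"
    using f N(3) finite_leaves[OF finite_aux[OF E N'(1)]] by simp
  then have "card ?M = n" using R(2) path_system_card[OF E w N(1)] N(2,3) k by simp
  then have M: "max_matching en0 (H E) ?M" using R(1) max_matching_iff[OF E] by simp
  have neg: "Node w (neg s) \<notin> covered en0 ?M"
    using R(3)[of "Node w (neg s)"] N'(3)[of w "neg s"] covered_mono[of ?M N "aux_ends B ?S"] by auto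
  obtain g where g: "g \<in> leaves B ?S N w" "g \<noteq> f"
  proof -
    have "leaves B ?S N w - {f} \<noteq> {}" using c k by (metis card.empty diff_is_0_eq not_one_le_zero numeral_le_one_iff semiring_norm(69) le_trans one_le_numeral)
    then show thesis using that by blast
  qed
  have gc: "Inl g \<in> N" "w \<in> ends B g" "(w, sg B g w) \<in> ?S" using g(1) by (simp_all add: leaves_def Leaf_covered)
  have wr: "w \<noteq> r" using w by auto
  have sg: "sg B g w = s" using gc(3) targets_iff[OF wr] wr by auto
  have gE: "g \<in> E" using gc(1) N'(1) by (auto simp: aux_edges_def)
  then obtain y where y: "ends B g = {w, y}" "w \<noteq> y" using edge_other_end[OF bidirected_B _ gc(2)] E by blast
  have hy: "half B S0 g y = half B ?S g y"
    using y targets_iff[OF wr] S0_iff by (auto simp: half_def)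
  have "Inl g \<notin> ?M" using g by simp
  have "half B ?S g y \<notin> covered (aux_ends B ?S) ?M"
  proof
    assume "half B ?S g y \<in> covered (aux_ends B ?S) ?M"
    then obtain l where l: "l \<in> ?M" "half B ?S g y \<in> aux_ends B ?S l" by (auto simp: covered_def)
    have "l \<noteq> Inl g" "l \<in> N" using l(1) \<open>Inl g \<notin> ?M\<close> by auto
    then have "aux_ends B ?S l \<inter> aux_ends B ?S (Inl g) = {}"
      using N'(2) gc(1) unfolding disjoint_ends_def by blast
    then show False using l(2) y(1) by auto
  qed
  then have hn: "half B S0 g y \<notin> covered en0 ?M"
    using R(3)[of "half B S0 g y"] hy y(2) by (auto simp: half_Node)
  have hD: "half B S0 g y \<in> D E" using missableI[OF M hn] .
  have nD: "Node w (neg s) \<in> D E" using missableI[OF M neg] .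
  have "Inl g \<in> H E" "en0 (Inl g) = {Node w s, half B S0 g y}"
    using gE y(1) sg wr S0_iff by (auto simp: aux_edges_def half_def)
  then have s1: "missable_step en0 (H E) (Node w s) (half B S0 g y)"
    unfolding missable_step_def using wD hD by blast
  have "Inr w \<in> H E" "en0 (Inr w) = {Node w (neg s), Node w s}"
    using w Inr_ends[of B S0 w s] by (auto simp: aux_edges_def ordinary_S0)
  then have s2: "missable_step en0 (H E) (Node w (neg s)) (Node w s)"
    unfolding missable_step_def using wD nD by blast
  have "linked en0 (H E) (Node w (neg s)) (half B S0 g y)" using s1 s2 by auto
  moreover have "Node w (neg s) \<noteq> half B S0 g y" using y(2) by (metis half_Node)
  ultimately show False using gallai[OF H_multigraph[OF E] _ _ M neg] hn by blast
qed

text \<open>Exchanging \<open>base_matching\<close> with a maximum matching that misses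
  \<open>Node w (neg s)\<close>, from that node on, must end at a root leaf. The result
  \<open>M\<close> covers this leaf and all nodes except \<open>Node w (neg s)\<close>; it cannot
  contain \<open>Inr w\<close>, so its edge at \<open>Node w s\<close> is a target edge.\<close>

lemma D_kap_pos:
  assumes E: "E \<subseteq> edges B" and w: "w \<in> verts B - {r}" and d: "Node w (neg s) \<in> D E"
  shows "kap E w s \<noteq> 0"
proof -
  let ?S = "targets r w s"
  have wr: "w \<noteq> r" using w by auto
  obtain N where N: "max_matching en0 (H E) N" "Node w (neg s) \<notin> covered en0 N"
    using d by (auto simp: missable_def)
  have mN: "matching en0 (H E) N" "card N = n" using N(1) max_matching_iff[OF E] by simp_all
  have sc: "Node w (neg s) \<in> covered en0 base_matching" using w by (simp add: base_matching)
  from H_multigraph[OF E] mN(1) base_matching(1) sc N(2) show ?thesis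
  proof (cases rule: matching_exchange_card)
    case (gain N1 M t)
    then show ?thesis using matching_card_le[OF E gain(1)] mN(2) by simp
  next
    case (loss N1 M t)
    have Ms: "M \<subseteq> H E" "disjoint_ends en0 M" using loss(2) by (simp_all add: matching_def)
    have "N \<subseteq> H E" using mN(1) by (simp add: matching_def)
    then obtain f where t: "t = Leaf r f"
      using covered_cases[OF E _ loss(5)] loss(6) base_matching(2) by blast
    have cM: "covered en0 M = nodes (verts B - {r}) - {Node w (neg s)} \<union> {Leaf r f}"
      using loss(8) t base_matching(2) by simp
    have nw: "Inr w \<notin> M" using Inr_covered[of w M "neg s" B S0] cM by auto
    have "M \<subseteq> aux_edges B ?S E"
      using Ms(1) nw by (auto simp: aux_edges_def ordinary_S0 ordinary_targets)
    moreover have "disjoint_ends (aux_ends B ?S) M"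
      using disjoint_ends_more_leaves[OF S0_targets Ms(2)] .
    moreover have "Node y u \<in> covered (aux_ends B ?S) M \<longleftrightarrow> y \<in> verts B - {r, w}" for y u
    proof
      assume a: "Node y u \<in> covered (aux_ends B ?S) M"
      then have b: "Node y u \<in> covered en0 M" by (rule Node_covered_fewer[OF _ S0_targets])
      have "y \<noteq> w"
      proof
        assume "y = w"
        then have "u = s" using b cM sign_cases[of u s] by auto
        then show False using Node_in_covered_Inl[OF a] nw \<open>y = w\<close> targets_iff[OF wr] by blast
      qed
      then show "y \<in> verts B - {r, w}" using b cM by auto
    next
      assume y: "y \<in> verts B - {r, w}"
      then have "Node y u \<in> covered en0 M" using cM by auto
      then show "Node y u \<in> covered (aux_ends B ?S) M"
        by (rule Node_covered_more) (use y targets_iff[OF wr] in auto)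
    qed
    ultimately have "path_system B r E w s M" by (simp add: path_system_def)
    then have "card (leaves B ?S M r) \<le> kap E w s" using path_system_kap[OF E w] by blast
    have "f \<in> leaves B ?S M r"
      using Leaf_covered_more[OF S0_targets, of r f B M] cM by (auto simp: leaves_def)
    moreover have "finite (leaves B ?S M r)"
      by (rule finite_leaves[OF finite_aux[OF E Ms(1)]])
    ultimately have "card (leaves B ?S M r) \<noteq> 0" by auto
    then show ?thesis using \<open>card (leaves B ?S M r) \<le> kap E w s\<close> by simp
  qed
qed

text \<open>Each gap \<open>h\<close> is filled by an exchange with the matching of all
  \<open>Inr\<close> edges outside \<open>w\<close>. This costs at worst a target leaf, which the
  bound does not count. If it cost a root leaf, the other matching, completed by
  \<open>Inr w\<close>, would be a maximum matching that misses \<open>h\<close>, so that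
  \<open>h\<close> would be in \<open>D\<close>.\<close>

lemma kap_ge_of_unreachable_gaps:
  assumes E: "E \<subseteq> edges B" and w: "w \<in> verts B - {r}"
    and "N \<subseteq> aux_edges B (targets r w s) E" "disjoint_ends (aux_ends B (targets r w s)) N"
    and "\<And>t. Node w t \<notin> covered (aux_ends B (targets r w s)) N"
    and "\<And>h. h \<in> nodes (verts B - {r, w}) \<Longrightarrow> h \<notin> covered (aux_ends B (targets r w s)) N \<Longrightarrow> h \<notin> D E"
  shows "card (leaves B (targets r w s) N r) \<le> kap E w s"
  using assms(3-)
proof (induction "card (nodes (verts B - {r, w}) - covered (aux_ends B (targets r w s)) N)"
    arbitrary: N rule: less_induct)
  case less
  let ?S = "targets r w s"
  let ?en = "aux_ends B ?S"
  let ?V = "verts B - {r, w}"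
  have wr: "w \<noteq> r" using w by auto
  have finV: "finite (nodes ?V)" using card_nodes(2) finite_verts by simp
  show ?case
  proof (cases "nodes ?V \<subseteq> covered ?en N")
    case True
    have "Node y t \<in> covered ?en N \<longleftrightarrow> y \<in> ?V" for y t
    proof
      assume a: "Node y t \<in> covered ?en N"
      then have "y \<in> verts B - {r}" using node_vert[OF E less.prems(1) _ targets_sign] by blast
      then show "y \<in> ?V" using a less.prems(3) by auto
    next
      assume "y \<in> ?V"
      then show "Node y t \<in> covered ?en N" using True nodes_iff(1)[of y t ?V] by blast
    qed
    then have "path_system B r E w s N" using less.prems(1,2) by (simp add: path_system_def)
    then show ?thesis using path_system_kap[OF E w] by blast
  next
    case False
    then obtain h where h: "h \<in> nodes ?V" "h \<notin> covered ?en N" by auto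
    let ?M = "Inr ` ?V :: ('e + 'v) set"
    have M: "matching ?en (aux_edges B ?S E) ?M"
      by (auto simp: matching_def disjoint_ends_Inr aux_edges_def ordinary_targets)
    have mN: "matching ?en (aux_edges B ?S E) N" using less.prems(1,2) by (simp add: matching_def)
    have hM: "h \<in> covered ?en ?M" using h by (simp add: covered_Inr)
    have shrink: "card (leaves B ?S N1 r) \<le> kap E w s"
      if N1: "matching ?en (aux_edges B ?S E) N1" "\<And>t. Node w t \<notin> covered ?en N1"
        "covered ?en N \<inter> nodes ?V \<subseteq> covered ?en N1" "h \<in> covered ?en N1" for N1
    proof -
      have "nodes ?V - covered ?en N1 \<subset> nodes ?V - covered ?en N" using N1(3,4) h by auto
      then have "card (nodes ?V - covered ?en N1) < card (nodes ?V - covered ?en N)"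
        using finV by (intro psubset_card_mono) auto
      then show ?thesis
        using less.hyps[of N1] N1 less.prems(4) by (auto simp: matching_def)
    qed
    from multigraph_aux[OF bidirected_B finite_B E] mN M hM h(2) show ?thesis
    proof (cases rule: matching_exchange_card)
      case (gain N1 M1 t)
      have nw: "Node w t' \<noteq> h" "Node w t' \<noteq> t" for t' using h(1) gain(5) by (auto simp: covered_Inr)
      have "leaves B ?S N1 r = leaves B ?S N r"
        using gain(5) h(1) unfolding leaves_def gain(7) by (auto simp: covered_Inr)
      moreover have "card (leaves B ?S N1 r) \<le> kap E w s"
        using gain(1,7) nw less.prems(3) by (intro shrink) auto
      ultimately show ?thesis by simp
    next
      case (loss N1 M1 t)
      have tV: "t \<notin> nodes ?V" using loss(6) by (simp add: covered_Inr)
      from targets_cover[OF E wr less.prems(1) loss(5)] show ?thesis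
      proof cases
        case (1 y u)
        then have "y = w" using tV by auto
        then show ?thesis using 1 loss(5) less.prems(3) by auto
      next
        case (2 f)
        have cM: "covered ?en M1 = nodes ?V - {h} \<union> {Leaf r f}" using loss(8) 2 by (simp add: covered_Inr)
        have Ms: "disjoint_ends ?en M1" "M1 \<subseteq> aux_edges B ?S E" using loss(2) by (simp_all add: matching_def)
        have lf: "(x, sg B g x) \<in> S0" if "Leaf x g \<in> covered ?en M1" for x g
          using that cM S0_iff by auto
        have SS: "S0 \<subseteq> ?S" by (rule S0_targets)
        have c0: "covered en0 M1 = nodes ?V - {h} \<union> {Leaf r f}"
          unfolding cM[symmetric] by (rule merge_no_leaf(1)[OF SS]) (rule lf)
        have "disjoint_ends en0 M1" by (rule merge_no_leaf(2)[OF SS _ Ms(1)]) (rule lf)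
        then have m0: "matching en0 (H E) M1"
          using Ms(2) by (auto simp: matching_def aux_edges_def ordinary_S0 ordinary_targets)
        have wH: "Inr w \<in> H E" using w by (simp add: aux_edges_def ordinary_S0)
        have free: "en0 (Inr w) \<inter> covered en0 M1 = {}" unfolding c0 by simp
        have "card M1 = card ?V" using loss(10) by (simp add: card_image)
        moreover have "Suc (card ?V) = n"
        proof -
          have "verts B - {r, w} = verts B - {r} - {w}" by auto
          then show ?thesis using w finite_verts card.remove[of "verts B - {r}" w] by simp
        qed
        ultimately have "card (insert (Inr w) M1) = n"
          using card_insert_uncovered[OF H_multigraph[OF E] m0 wH free] by simp
        then have mx: "max_matching en0 (H E) (insert (Inr w) M1)"
          using matching_insert[OF m0 wH free] max_matching_iff[OF E] by simp
        have "h \<notin> covered en0 (insert (Inr w) M1)"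
        proof -
          have "h \<noteq> Leaf r f" "h \<noteq> Node w Plus" "h \<noteq> Node w Minus" using h(1) by auto
          then show ?thesis unfolding covered_insert c0 by simp
        qed
        then have "h \<in> D E" using missableI[OF mx] by blast
        then show ?thesis using less.prems(4)[OF h] by simp
      next
        case (3 f)
        have "Node w t' \<noteq> h" for t' using h(1) by auto
        then have "card (leaves B ?S N1 r) \<le> kap E w s"
          using loss(1,4,7) 3 less.prems(3) by (intro shrink) auto
        moreover have "leaves B ?S N1 r = leaves B ?S N r"
          using 3 wr h(1) unfolding leaves_def loss(7) by auto
        ultimately show ?thesis by simp
      qed
    qed
  qed
qed

end

section \<open>Critical edges\<close>

lemma half_covered: "Inl f \<in> N \<Longrightarrow> x \<in> ends B f \<Longrightarrow> half B S f x \<in> covered (aux_ends B S) N"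
  unfolding covered_def by (rule UN_I[of "Inl f"]) simp_all

context clean_rooted
begin

text \<open>Here \<open>h\<close> is the tail end of \<open>e\<close>. Either it is the root leaf of
  \<open>e\<close>, or \<open>M\<close> has given it up for a new root leaf; adding \<open>e\<close>
  then produces one more path to \<open>v\<close>.\<close>

lemma path_system_add_edge:
  assumes N: "path_system B r E v b N" and e: "e \<notin> E" "insert e E \<subseteq> edges B" and v: "v \<in> verts B - {r}"
    and M: "M \<subseteq> aux_edges B (targets r v b) E" "disjoint_ends (aux_ends B (targets r v b)) M"
    and cM: "covered (aux_ends B (targets r v b)) M =
      covered (aux_ends B (targets r v b)) N \<union> X - {h}"
    and ends: "aux_ends B (targets r v b) (Inl e) = {h, Leaf v e}"
    and h: "h = Leaf r e \<and> X = {} \<or>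
      h \<in> covered (aux_ends B (targets r v b)) N \<and>
      (\<exists>f. X = {Leaf r f} \<and> Leaf r f \<notin> covered (aux_ends B (targets r v b)) N)"
  shows "card (leaves B (targets r v b) N r) < kap (insert e E) v b"
proof -
  let ?S = "targets r v b"
  have E: "E \<subseteq> edges B" using e by simp
  have vr: "v \<noteq> r" using v by auto
  have N': "N \<subseteq> aux_edges B ?S E"
    "\<And>y t. Node y t \<in> covered (aux_ends B ?S) N \<longleftrightarrow> y \<in> verts B - {r, v}"
    using N by (simp_all add: path_system_def)
  have ne: "Leaf x e \<notin> covered (aux_ends B ?S) N" for x
    using N'(1) e(1) by (auto simp: Leaf_covered aux_edges_def)
  have free: "aux_ends B ?S (Inl e) \<inter> covered (aux_ends B ?S) M = {}"
  proof -
    have "Leaf v e \<notin> covered (aux_ends B ?S) M" using M(1) e(1) by (auto simp: Leaf_covered aux_edges_def)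
    moreover have "h \<notin> covered (aux_ends B ?S) M" unfolding cM by simp
    ultimately show ?thesis unfolding ends by simp
  qed
  let ?M = "insert (Inl e) M"
  have dM: "disjoint_ends (aux_ends B ?S) ?M" using disjoint_ends_insert[OF M(2) free] .
  obtain f where f: "Leaf r f \<notin> covered (aux_ends B ?S) N"
    "covered (aux_ends B ?S) ?M = covered (aux_ends B ?S) N \<union> {Leaf r f, Leaf v e}"
    using h unfolding covered_insert ends cM
  proof (elim disjE conjE exE)
    assume a: "\<And>f. Leaf r f \<notin> covered (aux_ends B ?S) N \<Longrightarrow>
      {h, Leaf v e} \<union> (covered (aux_ends B ?S) N \<union> X - {h}) =
        covered (aux_ends B ?S) N \<union> {Leaf r f, Leaf v e} \<Longrightarrow> thesis"
      and h: "h = Leaf r e" "X = {}"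
    show thesis by (rule a[of e]) (use ne h in auto)
  next
    fix f
    assume a: "\<And>f. Leaf r f \<notin> covered (aux_ends B ?S) N \<Longrightarrow>
      {h, Leaf v e} \<union> (covered (aux_ends B ?S) N \<union> X - {h}) =
        covered (aux_ends B ?S) N \<union> {Leaf r f, Leaf v e} \<Longrightarrow> thesis"
      and h: "h \<in> covered (aux_ends B ?S) N" "X = {Leaf r f}" "Leaf r f \<notin> covered (aux_ends B ?S) N"
    show thesis by (rule a[of f]) (use h in auto)
  qed
  have "?M \<subseteq> aux_edges B ?S (insert e E)" using M(1) by (auto simp: aux_edges_def)
  then have "path_system B r (insert e E) v b ?M"
    using dM f(2) N'(2) by (simp add: path_system_def)
  then have "card (leaves B ?S ?M r) \<le> kap (insert e E) v b" using path_system_kap[OF e(2) v] by blast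
  moreover have "leaves B ?S ?M r = insert f (leaves B ?S N r)" "f \<notin> leaves B ?S N r"
    using f vr unfolding leaves_def f(2) by auto
  moreover have "finite (leaves B ?S N r)" by (rule finite_leaves[OF finite_aux[OF E N'(1)]])
  ultimately show ?thesis by simp
qed

text \<open>
  An edge \<open>e\<close> that can only be traversed towards \<open>v\<close> and is needed for some target is needed for
  \<open>v\<close>: otherwise a system of paths to the target, cut open at \<open>e\<close>, and a maximum system of paths
  to \<open>v\<close> avoiding \<open>e\<close> are exchanged from the tail of \<open>e\<close> on, which enlarges one of them.
\<close>

lemma arc_critical:
  assumes E: "E \<subseteq> edges B" and e: "e \<in> E" "ends B e = {u, v}" "u \<noteq> v" "v \<noteq> r"
    and bD: "Node v (sg B e v) \<notin> D (E - {e})"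
    and w: "w \<in> verts B - {r}" and crit: "kap (E - {e}) w s < kap E w s"
  shows "kap (E - {e}) v (sg B e v) < kap E v (sg B e v)"
proof (rule ccontr)
  define b where "b = sg B e v"
  define E' where "E' = E - {e}"
  assume "\<not> ?thesis"
  then have nc: "kap E v b \<le> kap E' v b" by (simp add: b_def E'_def)
  note bD = bD[folded b_def E'_def] and crit = crit[folded E'_def]
  have E': "E' \<subseteq> edges B" "e \<notin> E'" "insert e E' = E" using E e(1) by (auto simp: E'_def)
  have eB: "e \<in> edges B" using e E by auto
  have v: "v \<in> verts B - {r}" and uV: "u \<in> verts B"
    using bidirected_B eB e by (auto simp: bidirected_graph_def)
  have wr: "w \<noteq> r" and vr: "v \<noteq> r" using w v by auto
  let ?S = "targets r w s" and ?T = "targets r v b"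
  \<comment> \<open>Leaves at both targets, so that the two systems become matchings of one
    graph.\<close>
  let ?U = "insert (v, b) ?S"
  have SU: "?S \<subseteq> ?U" "?T \<subseteq> ?U" by (auto simp: targets_def)
  have U_iff: "(x, t) \<in> ?U \<longleftrightarrow> x = r \<or> x = w \<and> t = s \<or> x = v \<and> t = b" for x t
    using targets_iff[OF wr] by auto

  obtain N where N: "path_system B r E w s N" "card (leaves B ?S N r) = kap E w s"
    "card (leaves B ?S N w) = kap E w s" using path_system_exists[OF E w] .
  have N': "N \<subseteq> aux_edges B ?S E" "disjoint_ends (aux_ends B ?S) N"
    "\<And>y t. Node y t \<in> covered (aux_ends B ?S) N \<longleftrightarrow> y \<in> verts B - {r, w}"
    using N(1) by (simp_all add: path_system_def)
  have eN: "Inl e \<in> N"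
  proof (rule ccontr)
    assume "Inl e \<notin> N"
    then have "path_system B r E' w s N"
      using N(1) by (auto simp: path_system_def aux_edges_def E'_def)
    then show False using path_system_kap[OF E'(1) w] N(2) crit by fastforce
  qed
  have wv: "w \<noteq> v"
  proof
    assume wv: "w = v"
    have "s \<noteq> b" using nc crit wv by auto
    then have "half B ?S e v = Node v b" using wv vr targets_iff[OF wr] by (simp add: half_def b_def)
    then have "Node v b \<in> aux_ends B ?S (Inl e)" using e(2) by (auto intro: rev_image_eqI)
    then have "Node v b \<in> covered (aux_ends B ?S) N" using eN unfolding covered_def by blast
    then show False using N'(3) wv by simp
  qed
  have hv: "half B ?S e v = Node v b" using wv vr targets_iff[OF wr] by (auto simp: half_def b_def)
  define P where "P = N - {Inl e}"
  have eS: "aux_ends B ?S (Inl e) = {half B ?S e u, Node v b}" using e(2) hv by simp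
  have cP: "covered (aux_ends B ?S) P = covered (aux_ends B ?S) N - {half B ?S e u, Node v b}"
    unfolding P_def using covered_remove[OF N'(2) eN] eS by simp
  have PE: "P \<subseteq> aux_edges B ?S E'" using N'(1) by (auto simp: P_def aux_edges_def E'_def)
  have dP: "disjoint_ends (aux_ends B ?S) P" unfolding P_def using disjoint_ends_subset[OF N'(2)] by auto

  \<comment> \<open>A matching without \<open>e\<close> that keeps all root leaves of
    \<open>N\<close> and has at most the gap \<open>Node v b\<close> contradicts criticality,
    because this gap lies outside \<open>D E'\<close>.\<close>
  have enough: False
    if "M \<subseteq> aux_edges B ?S E'" "disjoint_ends (aux_ends B ?S) M"
      "\<And>t. Node w t \<notin> covered (aux_ends B ?S) M"
      "\<And>h. h \<in> nodes (verts B - {r, w}) \<Longrightarrow> h \<noteq> Node v b \<Longrightarrow> h \<in> covered (aux_ends B ?S) M"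
      "leaves B ?S N r \<subseteq> leaves B ?S M r" for M
  proof -
    have "h \<notin> D E'" if "h \<in> nodes (verts B - {r, w})" "h \<notin> covered (aux_ends B ?S) M" for h
      using that \<open>\<And>h. h \<in> nodes (verts B - {r, w}) \<Longrightarrow> h \<noteq> Node v b \<Longrightarrow> h \<in> covered (aux_ends B ?S) M\<close> bD
      by blast
    then have "card (leaves B ?S M r) \<le> kap E' w s"
      using kap_ge_of_unreachable_gaps[OF E'(1) w that(1-3)] by blast
    moreover have "card (leaves B ?S N r) \<le> card (leaves B ?S M r)"
      using that(5) finite_leaves[OF finite_aux[OF E'(1) that(1)]] card_mono by blast
    ultimately show False using N(2) crit by simp
  qed

  obtain Q where Q: "path_system B r E' v b Q" "card (leaves B ?T Q r) = kap E' v b"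
    using path_system_exists[OF E'(1) v] by blast
  have Q': "Q \<subseteq> aux_edges B ?T E'" "disjoint_ends (aux_ends B ?T) Q"
    "\<And>y t. Node y t \<in> covered (aux_ends B ?T) Q \<longleftrightarrow> y \<in> verts B - {r, v}"
    using Q(1) by (simp_all add: path_system_def)
  have hvT: "half B ?T e v = Leaf v e" using vr targets_iff[OF vr] by (simp add: half_def b_def)

  show False
  proof (cases "u = r \<or> u = w")
    case True
    then show False
    proof
      assume ur: "u = r"
      have huT: "half B ?T e r = Leaf r e" using targets_sign by (simp add: half_def)
      have eT: "aux_ends B ?T (Inl e) = {Leaf r e, Leaf v e}" using e(2) ur huT hvT by simp
      have "Leaf r e \<notin> covered (aux_ends B ?T) Q" using Q'(1) E'(2) by (auto simp: Leaf_covered aux_edges_def)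
      then have "covered (aux_ends B ?T) Q = covered (aux_ends B ?T) Q \<union> {} - {Leaf r e}" by simp
      from path_system_add_edge[OF Q(1) E'(2) _ v Q'(1,2) this eT] Q(2) nc E'(3) E
      show False by simp
    next
      \<comment> \<open>Here \<open>e\<close> leaves the target, so deleting it costs only a target
        leaf and the gap at \<open>v\<close>.\<close>
      assume uw: "u = w"
      have "half B ?S e w \<in> covered (aux_ends B ?S) N" using eN eS uw unfolding covered_def by blast
      then have hl: "half B ?S e w = Leaf w e"
        using N'(3) by (cases "half B ?S e w") (auto simp: half_Leaf half_Node)
      show False
      proof (rule enough[OF PE dP])
        show "Node w t \<notin> covered (aux_ends B ?S) P" for t using N'(3) cP by simp
        show "h \<in> covered (aux_ends B ?S) P" if "h \<in> nodes (verts B - {r, w})" "h \<noteq> Node v b" for h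
          using that N'(3) cP hl uw by (cases h) auto
        show "leaves B ?S N r \<subseteq> leaves B ?S P r" unfolding leaves_def cP using hl uw wr by auto
      qed
    qed
  next
    case False
    then have ur: "u \<noteq> r" "u \<noteq> w" by simp_all
    define g where "g = sg B e u"
    have hu: "half B ?S e u = Node u g" using ur targets_iff[OF wr] by (simp add: half_def g_def)
    have huT: "half B ?T e u = Node u g" using ur e(3) targets_iff[OF vr] by (auto simp: half_def g_def)
    have eT: "aux_ends B ?T (Inl e) = {Node u g, Leaf v e}" using e(2) huT hvT by simp
    note cP = cP[unfolded hu]
    have nodeP: "Node y t \<in> covered (aux_ends B ?S) P \<longleftrightarrow>
        y \<in> verts B - {r, w} \<and> (y, t) \<noteq> (u, g) \<and> (y, t) \<noteq> (v, b)" for y t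
      unfolding cP using N'(3) by auto
    have leavesP: "leaves B ?S P x = leaves B ?S N x" for x unfolding leaves_def cP by simp
    have cPU: "covered (aux_ends B ?U) P = covered (aux_ends B ?S) P"
    proof (rule merge_no_leaf(1)[OF SU(1), symmetric])
      fix x f assume x: "Leaf x f \<in> covered (aux_ends B ?U) P"
      show "(x, sg B f x) \<in> ?S"
      proof (rule ccontr)
        assume n: "(x, sg B f x) \<notin> ?S"
        then have xv: "x = v" "sg B f x = b" using Leaf_in_covered[OF x] by auto
        have "Inl f \<in> P" "x \<in> ends B f" using x by (simp_all add: Leaf_covered)
        moreover have "half B ?S f v = Node v b" using n xv by (simp add: half_def)
        ultimately have "Node v b \<in> covered (aux_ends B ?S) P"
          using xv half_covered[of f P v B ?S] by simp
        then show False using nodeP by simp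
      qed
    qed
    \<comment> \<open>\<open>w\<close> is not ordinary for \<open>?U\<close>, so its
      \<open>Inr\<close> edge has to be taken out; it is put back once the exchange is over.\<close>
    define Q0 where "Q0 = Q - {Inr w}"
    have noInr: "Inr v \<notin> P" "Inr w \<notin> P" "Inr v \<notin> Q0" "Inr w \<notin> Q0"
      using Inr_covered[of v P b B ?S] nodeP PE Q'(1)
      by (auto simp: aux_edges_def ordinary_targets Q0_def)
    have oU: "ordinary B ?U = verts B - {r, w, v}"
      by (cases s; cases b) (auto simp: ordinary_def targets_def)
    have PU: "matching (aux_ends B ?U) (aux_edges B ?U E') P"
    proof -
      have "x \<in> aux_edges B ?U E'" if "x \<in> P" for x
        using that PE noInr unfolding aux_edges_def oU ordinary_targets by (cases x) auto
      then show ?thesis using disjoint_ends_more_leaves[OF SU(1) dP] by (auto simp: matching_def)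
    qed
    have dQ0: "disjoint_ends (aux_ends B ?T) Q0" unfolding Q0_def using disjoint_ends_subset[OF Q'(2)] by auto
    have QU: "matching (aux_ends B ?U) (aux_edges B ?U E') Q0"
    proof -
      have "x \<in> aux_edges B ?U E'" if "x \<in> Q0" for x
        using that Q'(1) noInr unfolding Q0_def aux_edges_def oU ordinary_targets by (cases x) auto
      then show ?thesis using disjoint_ends_more_leaves[OF SU(2) dQ0] by (auto simp: matching_def)
    qed
    have nodeQ: "Node y t \<in> covered (aux_ends B ?U) Q0" if "y \<in> verts B - {r, v, w}" for y t
    proof -
      have "Node y t \<in> covered (aux_ends B ?T) Q" using that Q'(3) by simp
      moreover have "(y, t) \<notin> ?U" using that U_iff by auto
      ultimately have "Node y t \<in> covered (aux_ends B ?U) Q" by (rule Node_covered_more)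
      then show ?thesis
        using that unfolding Q0_def covered_def by auto
    qed
    have nodeQ': "y \<in> verts B - {r, v} \<and> (y, t) \<noteq> (w, s)" if a: "Node y t \<in> covered (aux_ends B ?U) Q0" for y t
    proof -
      have "Node y t \<in> covered (aux_ends B ?U) Q"
        using a covered_mono[of Q0 Q "aux_ends B ?U"] by (auto simp: Q0_def)
      then have "Node y t \<in> covered (aux_ends B ?T) Q" by (rule Node_covered_fewer[OF _ SU(2)])
      moreover have "(y, t) \<noteq> (w, s)" using Node_in_covered_Inl[OF a] noInr U_iff by auto
      ultimately show ?thesis using Q'(3) by simp
    qed
    have sQ: "Node u g \<in> covered (aux_ends B ?U) Q0" using nodeQ uV ur e(3) by simp
    have sP: "Node u g \<notin> covered (aux_ends B ?U) P" using cPU nodeP by simp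

    have conclude: False
      if M: "matching (aux_ends B ?U) (aux_edges B ?U E') M"
        and cM: "\<And>y t. Node y t \<in> covered (aux_ends B ?S) M \<Longrightarrow> y \<noteq> w"
          "\<And>h. h \<in> nodes (verts B - {r, w}) \<Longrightarrow> h \<noteq> Node v b \<Longrightarrow> h \<in> covered (aux_ends B ?S) M"
          "\<And>f. Leaf r f \<in> covered (aux_ends B ?U) P \<Longrightarrow> Leaf r f \<in> covered (aux_ends B ?U) M"
        and d: "disjoint_ends (aux_ends B ?S) M" for M
    proof (rule enough[OF _ d])
      show "M \<subseteq> aux_edges B ?S E'" using M unfolding matching_def aux_edges_def oU ordinary_targets by auto
      show "leaves B ?S N r \<subseteq> leaves B ?S M r"
      proof
        fix f assume "f \<in> leaves B ?S N r"
        then have "Leaf r f \<in> covered (aux_ends B ?U) M"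
          using cM(3) leavesP[of r] cPU by (auto simp: leaves_def)
        then show "f \<in> leaves B ?S M r" using targets_sign by (simp add: leaves_def Leaf_covered)
      qed
    qed (use cM in blast)+

    have small: "covered (aux_ends B ?S) M = covered (aux_ends B ?U) M \<and> disjoint_ends (aux_ends B ?S) M"
      if M: "matching (aux_ends B ?U) (aux_edges B ?U E') M"
        and lv: "\<And>f. Leaf v f \<notin> covered (aux_ends B ?U) M" for M
    proof -
      have "(x, sg B f x) \<in> ?S" if x: "Leaf x f \<in> covered (aux_ends B ?U) M" for x f
        using Leaf_in_covered[OF x] x lv by auto
      then show ?thesis using merge_no_leaf[OF SU(1)] M by (metis matching_def)
    qed
    have noLeafP: "Leaf v f \<notin> covered (aux_ends B ?U) P" for f
    proof
      assume "Leaf v f \<in> covered (aux_ends B ?U) P"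
      then have "Leaf v f \<in> covered (aux_ends B ?S) P" by (simp only: cPU)
      then show False using Leaf_in_covered targets_iff[OF wr] wv vr by metis
    qed
    have LU: "multigraph (aux_ends B ?U) (aux_edges B ?U E')"
      using multigraph_aux[OF bidirected_B finite_B E'(1)] .

    \<comment> \<open>The exchange fills the gap at the tail of \<open>e\<close>. Each ending
      contradicts \<open>enough\<close>, with two exceptions: gaining a node puts
      \<open>Node v b\<close> into \<open>D E'\<close>, and a root leaf lost by \<open>P\<close> is
      gained by \<open>Q\<close>, which \<open>e\<close> then extends.\<close>
    from LU PU QU sQ sP show False
    proof (cases rule: matching_exchange_card)
      case (gain P1 Q1 t)
      have c1: "covered (aux_ends B ?U) P1 = covered (aux_ends B ?S) P \<union> {Node u g, t}"
        using gain(7) unfolding cPU .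
      have noLeaf1: "Leaf v f' \<notin> covered (aux_ends B ?U) P1" if "t \<noteq> Leaf v f'" for f'
        using noLeafP[of f'] that unfolding c1 cPU by simp
      have keep: "Leaf r f' \<in> covered (aux_ends B ?U) P1" if "Leaf r f' \<in> covered (aux_ends B ?U) P" for f'
        using that unfolding c1 cPU by simp
      show False
      proof (cases t)
        case (Leaf x f)
        show False
        proof (cases "x = v")
          case xv: True
          \<comment> \<open>The exchange has reached \<open>v\<close>: once glued, the leaf fills
            the gap \<open>Node v b\<close> without \<open>e\<close>.\<close>
          have lf: "Leaf v f \<in> covered (aux_ends B ?U) P1" using c1 Leaf xv by simp
          have sf: "sg B f v = b" using Leaf_in_covered[OF lf] wv vr U_iff by auto
          have vS: "(v, sg B f v) \<notin> ?S" using wv vr targets_iff[OF wr] by auto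
          have other: "(x', sg B f' x') \<in> ?S"
            if "Leaf x' f' \<in> covered (aux_ends B ?U) P1" "Leaf x' f' \<noteq> Leaf v f" for x' f'
            using Leaf_in_covered[OF that(1)] noLeaf1[of f'] that Leaf xv by auto
          have nb: "Node v (sg B f v) \<notin> covered (aux_ends B ?U) P1"
            using nodeP Leaf e(3) sf unfolding c1 by simp
          have c2: "covered (aux_ends B ?S) P1 =
              insert (Node v (sg B f v)) (covered (aux_ends B ?U) P1 - {Leaf v f})"
            by (rule merge_one_leaf(1)[OF SU(1) lf vS _ nb]) (rule other)
          have d2: "disjoint_ends (aux_ends B ?S) P1"
            by (rule merge_one_leaf(2)[OF SU(1) lf vS _ nb])
              (use other gain(1) in \<open>auto simp: matching_def\<close>)
          show False
          proof (rule conclude[OF gain(1) _ _ keep d2])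
            show "y \<noteq> w" if "Node y t' \<in> covered (aux_ends B ?S) P1" for y t'
              using that nodeP Leaf ur wv unfolding c2 c1 by auto
            show "h \<in> covered (aux_ends B ?S) P1" if "h \<in> nodes (verts B - {r, w})" "h \<noteq> Node v b" for h
              using that nodeP unfolding c2 c1 by (cases h) auto
          qed
        next
          case False
          have sm: "covered (aux_ends B ?S) P1 = covered (aux_ends B ?U) P1"
            "disjoint_ends (aux_ends B ?S) P1"
            using small[OF gain(1)] noLeaf1 Leaf False by auto
          show False
          proof (rule conclude[OF gain(1) _ _ keep sm(2)])
            show "y \<noteq> w" if "Node y t' \<in> covered (aux_ends B ?S) P1" for y t'
              using that nodeP Leaf ur unfolding sm(1) c1 by auto
            show "h \<in> covered (aux_ends B ?S) P1" if "h \<in> nodes (verts B - {r, w})" "h \<noteq> Node v b" for h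
              using that nodeP unfolding sm(1) c1 by (cases h) auto
          qed
        qed
      next
        case (Node y t')
        have "y \<in> verts B - {r, v}" "(y, t') \<noteq> (w, s)" using nodeQ' gain(5) Node by blast+
        moreover have "Node y t' \<notin> covered (aux_ends B ?S) P" "(y, t') \<noteq> (u, g)"
          using gain(4,6) Node cPU by auto
        \<comment> \<open>The nodes of \<open>w\<close> are no gaps for \<open>enough\<close>, so
          this ending is treated separately: keeping one target edge turns \<open>P1\<close> into a
          maximum matching that misses \<open>Node v b\<close>.\<close>
        ultimately have yw: "y = w" "t' = neg s" using nodeP by (auto simp: neq_neg_iff)
        have sm: "covered (aux_ends B ?S) P1 = covered (aux_ends B ?U) P1"
          "disjoint_ends (aux_ends B ?S) P1"
          using small[OF gain(1)] noLeaf1 Node by auto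
        have P1E: "P1 \<subseteq> aux_edges B ?S E'" using gain(1) unfolding matching_def aux_edges_def oU ordinary_targets by auto
        have lw: "leaves B ?S P1 w = leaves B ?S N w"
        proof -
          have "leaves B ?S P1 w = leaves B ?S P w" unfolding leaves_def sm(1) c1 using Node by simp
          then show ?thesis using leavesP by simp
        qed
        have finN: "finite N" by (rule finite_aux[OF E N'(1)])
        obtain f0 where f0: "f0 \<in> leaves B ?S P1 w" using N(3) crit unfolding lw by fastforce
        have A: "{f0} \<subseteq> leaves B ?S P1 w" "{f0} \<subseteq> {f0}" using f0 by auto
        have ws: "{f0} \<noteq> {} \<longrightarrow> Node w s \<notin> covered (aux_ends B ?S) P1"
          using nodeP Node yw ur unfolding sm(1) c1 by simp
        note R = remove_target_leaves[OF E'(1) w P1E sm(2) A ws]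
        let ?M = "P1 - Inl ` (leaves B ?S P1 w - {f0})"
        have "card (leaves B ?S P1 w - {f0}) = kap E w s - 1"
          using f0 N(3) finite_leaves[OF finN] unfolding lw by simp
        moreover have "card P1 = card N"
          using gain(9) card.remove[OF finN eN] unfolding P_def by simp
        ultimately have "card ?M = n"
          using R(2) path_system_card[OF E w N(1)] N(2,3) crit by simp
        then have M: "max_matching en0 (H E') ?M" using R(1) max_matching_iff[OF E'(1)] by simp
        have "Node v b \<notin> covered (aux_ends B ?S) P1" using nodeP Node yw wv e(3) unfolding sm(1) c1 by simp
        then have "Node v b \<notin> covered en0 ?M"
          using R(3)[of "Node v b"] wv covered_mono[of ?M P1 "aux_ends B ?S"] by auto
        then show False using missableI[OF M] bD by blast
      qed
    next
      case (loss P1 Q1 t)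
      have c1: "covered (aux_ends B ?U) P1 = covered (aux_ends B ?S) P \<union> {Node u g} - {t}"
        using loss(7) unfolding cPU .
      have noLeaf1: "Leaf v f' \<notin> covered (aux_ends B ?U) P1" for f'
        using noLeafP[of f'] unfolding c1 cPU by simp
      have sm: "covered (aux_ends B ?S) P1 = covered (aux_ends B ?U) P1"
        "disjoint_ends (aux_ends B ?S) P1"
        using small[OF loss(1)] noLeaf1 by auto
      have P1E: "P1 \<subseteq> aux_edges B ?S E'" using loss(1) unfolding matching_def aux_edges_def oU ordinary_targets by auto
      show False
      proof (cases t)
        case (Leaf x f)
        have "x \<noteq> v" using noLeafP loss(5) Leaf by auto
        moreover have "(x, sg B f x) \<in> ?U" using Leaf_in_covered loss(5) Leaf by metis
        ultimately consider "x = r" | "x = w" using U_iff by auto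
        then show False
        proof cases
          case 2
          have keep: "Leaf r f' \<in> covered (aux_ends B ?U) P1"
            if "Leaf r f' \<in> covered (aux_ends B ?U) P" for f'
            using that Leaf 2 wr unfolding c1 cPU by simp
          show False
          proof (rule conclude[OF loss(1) _ _ keep sm(2)])
            show "y \<noteq> w" if "Node y t' \<in> covered (aux_ends B ?S) P1" for y t'
              using that nodeP ur unfolding sm(1) c1 by auto
            show "h \<in> covered (aux_ends B ?S) P1" if "h \<in> nodes (verts B - {r, w})" "h \<noteq> Node v b" for h
              using that nodeP Leaf unfolding sm(1) c1 by (cases h) auto
          qed
        next
          case 1
          let ?I = "merge_leaf B ?T" and ?C = "covered (aux_ends B ?U) Q0"
          have Q0E: "Q0 \<subseteq> aux_edges B ?T E'" using Q'(1) by (auto simp: Q0_def)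
          \<comment> \<open>\<open>Q0\<close> has disjoint ends before and after gluing, so both
            covered sets have twice its size; hence the gluing map is injective on
            \<open>?C\<close>.\<close>
          have "card (?I ` ?C) = card ?C"
            using card_covered(1)[OF multigraph_sub[OF E'(1) Q0E] dQ0]
              card_covered(1)[OF matching_multigraph[OF LU QU]] QU
            unfolding merge_leaf_covered[OF SU(2), symmetric] by (simp add: matching_def)
          moreover have "finite ?C"
            using card_covered(2)[OF matching_multigraph[OF LU QU]] QU by (simp add: matching_def)
          ultimately have inj: "inj_on ?I ?C" by (intro eq_card_imp_inj_on)
          have Ir: "?I (Leaf r f) = Leaf r f" using targets_sign by simp
          have Ir': "h = Leaf r f" if "?I h = Leaf r f" for h
            using that by (cases h) (auto split: if_splits)
          have cQ1: "covered (aux_ends B ?U) Q1 = ?C - {Node u g} \<union> {Leaf r f}"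
            using loss(8) Leaf 1 by simp
          have "inj_on ?I (covered (aux_ends B ?U) Q1)"
          proof (rule inj_onI)
            fix h h' assume h: "h \<in> covered (aux_ends B ?U) Q1" "h' \<in> covered (aux_ends B ?U) Q1"
              "?I h = ?I h'"
            show "h = h'"
            proof (cases "h = Leaf r f \<or> h' = Leaf r f")
              case True
              then show ?thesis using h(3) Ir Ir' by metis
            next
              case False
              then show ?thesis using h cQ1 inj by (auto dest: inj_onD)
            qed
          qed
          then have dQ1: "disjoint_ends (aux_ends B ?T) Q1"
            using disjoint_ends_fewer_leaves[OF SU(2)] loss(2) by (auto simp: matching_def)
          have "?I ` (?C - {Node u g}) = ?I ` ?C - ?I ` {Node u g}"
            using inj sQ by (intro inj_on_image_set_diff[of _ ?C]) auto
          then have cTQ1: "covered (aux_ends B ?T) Q1 =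
              covered (aux_ends B ?T) Q0 - {Node u g} \<union> {Leaf r f}"
            unfolding merge_leaf_covered[OF SU(2)] cQ1 image_Un using Ir by simp
          have rQ: "Leaf r f \<notin> covered (aux_ends B ?T) Q"
          proof
            assume "Leaf r f \<in> covered (aux_ends B ?T) Q"
            then have "Inl f \<in> Q0" "r \<in> ends B f" by (simp_all add: Leaf_covered Q0_def)
            moreover have "(r, sg B f r) \<in> ?U" using U_iff by blast
            ultimately have "Leaf r f \<in> ?C" unfolding Leaf_covered by blast
            then show False using loss(6) Leaf 1 by simp
          qed
          have uQ: "Node u g \<in> covered (aux_ends B ?T) Q" using Q'(3) uV ur e(3) by simp
          have Q1E: "Q1 \<subseteq> aux_edges B ?T E'"
            using loss(2) unfolding matching_def aux_edges_def oU ordinary_targets by auto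
          have "\<exists>M. M \<subseteq> aux_edges B ?T E' \<and> disjoint_ends (aux_ends B ?T) M \<and>
            covered (aux_ends B ?T) M = covered (aux_ends B ?T) Q \<union> {Leaf r f} - {Node u g}"
          proof (cases "Inr w \<in> Q")
            case False
            then have "Q0 = Q" by (simp add: Q0_def)
            then show ?thesis using Q1E dQ1 cTQ1 by (intro exI[of _ Q1]) auto
          next
            case True
            have c0: "covered (aux_ends B ?T) Q0 = covered (aux_ends B ?T) Q - {Node w Plus, Node w Minus}"
              unfolding Q0_def using covered_remove[OF Q'(2) True] by simp
            have free: "aux_ends B ?T (Inr w) \<inter> covered (aux_ends B ?T) Q1 = {}"
              unfolding cTQ1 c0 by auto
            have "insert (Inr w) Q1 \<subseteq> aux_edges B ?T E'" using True Q'(1) Q1E by auto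
            moreover have "covered (aux_ends B ?T) (insert (Inr w) Q1) =
                covered (aux_ends B ?T) Q \<union> {Leaf r f} - {Node u g}"
              unfolding covered_insert cTQ1 c0 using Q'(3) w wv ur by auto
            ultimately show ?thesis using disjoint_ends_insert[OF dQ1 free] by blast
          qed
          then obtain M where M: "M \<subseteq> aux_edges B ?T E'" "disjoint_ends (aux_ends B ?T) M"
            "covered (aux_ends B ?T) M = covered (aux_ends B ?T) Q \<union> {Leaf r f} - {Node u g}"
            by blast
          have "card (leaves B ?T Q r) < kap (insert e E') v b"
            by (rule path_system_add_edge[OF Q(1) E'(2) _ v M eT])
              (use E E'(3) uQ rQ in auto)
          then show False using Q(2) nc E'(3) by simp
        qed
      next
        case (Node y t')
        have y: "y \<in> verts B - {r, w}" "(y, t') \<noteq> (v, b)"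
          using loss(5) nodeP unfolding Node cPU by auto
        moreover have "y = v" using loss(6) nodeQ[of y t'] y unfolding Node by auto
        \<comment> \<open>Now both nodes of \<open>v\<close> are free, so \<open>Inr v\<close> can
          be inserted and closes the gap at \<open>v\<close> as well.\<close>
        ultimately have yv: "y = v" "t' = neg b" by (auto simp: neq_neg_iff)
        have inr: "aux_ends B ?S (Inr v) = {Node v b, Node v (neg b)}" by (rule Inr_ends)
        have free: "aux_ends B ?S (Inr v) \<inter> covered (aux_ends B ?S) P1 = {}"
          unfolding inr sm(1) c1 using nodeP Node yv e(3) by auto
        show False
        proof (rule enough[of "insert (Inr v) P1"])
          show "insert (Inr v) P1 \<subseteq> aux_edges B ?S E'"
            using P1E v wv by (auto simp: aux_edges_def ordinary_targets)
          show "disjoint_ends (aux_ends B ?S) (insert (Inr v) P1)"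
            using disjoint_ends_insert[OF sm(2) free] .
          show "Node w t'' \<notin> covered (aux_ends B ?S) (insert (Inr v) P1)" for t''
            unfolding covered_insert inr sm(1) c1 using nodeP wv ur by auto
          show "h \<in> covered (aux_ends B ?S) (insert (Inr v) P1)"
            if "h \<in> nodes (verts B - {r, w})" "h \<noteq> Node v b" for h
            unfolding covered_insert inr sm(1) c1 using that nodeP Node yv by (cases h) auto
          show "leaves B ?S N r \<subseteq> leaves B ?S (insert (Inr v) P1) r"
          proof -
            have "leaves B ?S P r \<subseteq> leaves B ?S (insert (Inr v) P1) r"
              unfolding leaves_def covered_insert sm(1) c1 using Node by auto
            then show ?thesis using leavesP by simp
          qed
        qed
      qed
    qed
  qed
qed


lemma kap_mono:
  assumes "E' \<subseteq> E" "E \<subseteq> edges B" "w \<in> verts B - {r}"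
  shows "kap E' w s \<le> kap E w s"
proof -
  obtain N where N: "path_system B r E' w s N" "card (leaves B (targets r w s) N r) = kap E' w s"
    using path_system_exists[of E' w s] assms by blast
  have "aux_edges B (targets r w s) E' \<subseteq> aux_edges B (targets r w s) E"
    using assms(1) by (auto simp: aux_edges_def)
  then have "path_system B r E w s N" using N(1) unfolding path_system_def by blast
  then show ?thesis using path_system_kap[OF assms(2,3)] N(2) by metis
qed

section \<open>Edges inside a component of \<open>D\<close>\<close>

lemma critical_in_system:
  assumes E: "E \<subseteq> edges B" and w: "w \<in> verts B - {r}" and crit: "kap (E - {e}) w s < kap E w s"
    and N: "path_system B r E w s N" "card (leaves B (targets r w s) N r) = kap E w s"
  shows "Inl e \<in> N"
proof (rule ccontr)
  assume "Inl e \<notin> N"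
  then have "path_system B r (E - {e}) w s N" using N(1) by (auto simp: path_system_def aux_edges_def)
  then show False using path_system_kap[of "E - {e}" w s N] E w N(2) crit by fastforce
qed

lemma H_insert: "H (insert e E) = insert (Inl e) (H E)" by (auto simp: aux_edges_def)

text \<open>
  The component containing both ends of \<open>e\<close> is left by at most one edge of any maximum matching,
  so the matching can be rearranged inside it without \<open>e\<close>.
\<close>

lemma not_critical_inside_component:
  assumes E: "E \<subseteq> edges B" and e: "e \<in> E" "ends B e = {u, v}"
    and DE: "D (E - {e}) = D E" and D: "half B S0 e u \<in> D E" "half B S0 e v \<in> D E"
    and w: "w \<in> verts B - {r}"
  shows "\<not> kap (E - {e}) w s < kap E w s"
proof
  assume crit: "kap (E - {e}) w s < kap E w s"
  define E' where "E' = E - {e}"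
  note crit' = crit[folded E'_def] and DE = DE[folded E'_def]
  have E': "E' \<subseteq> edges B" "insert e E' = E" "e \<notin> E'" using E e(1) by (auto simp: E'_def)
  have wr: "w \<noteq> r" using w by auto
  let ?S = "targets r w s"
  \<comment> \<open>Since \<open>D\<close> is unchanged, \<open>(w, s)\<close> stays reachable
    without \<open>e\<close>. The drop therefore starts from at least 2, which puts
    \<open>Node w s\<close> outside \<open>D\<close>.\<close>
  have "kap E' w s \<noteq> 0"
    using kap_pos_D[OF E w, of s] D_kap_pos[OF E'(1) w, of s] crit' DE by auto
  then have k2: "kap E w s \<ge> 2" using crit' by simp
  have wD: "Node w s \<notin> D E" using kap_two_not_D[OF E w k2] .
  obtain N where N: "path_system B r E w s N" "card (leaves B ?S N r) = kap E w s"
    "card (leaves B ?S N w) = kap E w s" using path_system_exists[OF E w] .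
  have N': "N \<subseteq> aux_edges B ?S E" "disjoint_ends (aux_ends B ?S) N"
    "\<And>y t. Node y t \<in> covered (aux_ends B ?S) N \<longleftrightarrow> y \<in> verts B - {r, w}"
    using N(1) by (simp_all add: path_system_def)
  have eN: "Inl e \<in> N" using critical_in_system[OF E w crit N(1,2)] .
  define W where "W = leaves B ?S N w"
  define N0 where "N0 = N - Inl ` W"
  have WN: "Inl ` W \<subseteq> N" by (auto simp: W_def leaves_def Leaf_covered)
  \<comment> \<open>In the base graph a target edge has the end \<open>Node w s\<close>, which is
    not in \<open>D\<close>, whereas both ends of \<open>e\<close> are.\<close>
  have eW: "e \<notin> W"
  proof
    assume "e \<in> W"
    then have a: "w \<in> ends B e" "(w, sg B e w) \<in> ?S" by (simp_all add: W_def leaves_def Leaf_covered)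
    then have "half B S0 e w = Node w s" using targets_iff[OF wr] wr S0_iff by (auto simp: half_def)
    then show False using a(1) e(2) D wD by auto
  qed
  have R: "matching en0 (H E) N0" "card N = card N0 + card W"
    "h \<in> covered en0 N0 \<Longrightarrow> h \<in> covered (aux_ends B ?S) N0" for h
    using remove_target_leaves[OF E w N'(1,2), of "{}"] by (auto simp: N0_def W_def)
  have nw: "Node w t \<notin> covered en0 N0" for t
    using R(3)[of "Node w t"] N'(3)[of w t] covered_mono[of N0 N "aux_ends B ?S"] by (auto simp: N0_def)
  let ?N1 = "insert (Inr w) N0"
  have wH: "Inr w \<in> H E" using w by (simp add: aux_edges_def ordinary_S0)
  have free: "en0 (Inr w) \<inter> covered en0 N0 = {}" using nw by simp
  have m1: "matching en0 (H E) ?N1" using matching_insert[OF R(1) wH free] .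
  have "card ?N1 = n"
    using card_insert_uncovered[OF H_multigraph[OF E] R(1) wH free] R(2) path_system_card[OF E w N(1)]
      N(2,3) k2 by (simp add: W_def)
  then have N1: "max_matching en0 (H E) ?N1" using m1 max_matching_iff[OF E] by simp
  let ?a = "half B S0 e u" and ?c = "half B S0 e v"
  have ee: "en0 (Inl e) = {?a, ?c}" using e(2) by simp
  have LE: "H E = insert (Inl e) (H E')" using H_insert[of e E'] E'(2) by simp
  have mL: "multigraph en0 (insert (Inl e) (H E'))" using H_multigraph[OF E] LE by simp
  have DL: "missable en0 (insert (Inl e) (H E')) = D E'" using DE LE by simp
  have aD: "?a \<in> D E'" "?c \<in> D E'" using D DE by simp_all
  \<comment> \<open>By parity the ends of \<open>e\<close> are already linked without
    \<open>e\<close>, so the component \<open>K\<close> is the same in both graphs.\<close>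
  have lk: "linked en0 (H E') ?a ?c" using linked_of_missable_insert[OF mL ee DL aD] .
  define K where "K = component en0 (H E') ?a"
  have KE: "component en0 (H E) ?a = K"
    using component_insert_linked[of en0 "H E'" ?a ?c "Inl e", OF lk ee DL] LE by (simp add: K_def)
  have aK: "?a \<in> K" "?c \<in> K" using lk by (simp_all add: K_def component_def)
  have KD: "K \<subseteq> D E" using component_missable[OF aD(1)] DE by (simp add: K_def)
  obtain z where z: "z \<in> K" "covered en0 {l \<in> ?N1. en0 l \<subseteq> K} = K - {z}"
    by (rule component_exposed_unique[OF H_multigraph[OF E] N1 D(1), unfolded KE])
  have zl: "linked en0 (H E') ?a z" using z(1) by (simp add: K_def component_def)
  have Kz: "component en0 (H E') z = K"
  proof -
    have "linked en0 (H E') z y \<longleftrightarrow> linked en0 (H E') ?a y" for y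
      using rtranclp_trans[OF zl, of y] rtranclp_trans[OF linked_sym[OF zl], of y] by blast
    then show ?thesis by (simp add: K_def component_def)
  qed
  have zD: "z \<in> D E'" using z(1) KD DE by auto
  \<comment> \<open>Factor-criticality is applied in the graph without \<open>e\<close>:
    \<open>M\<close> covers exactly what the inner edges of \<open>?N1\<close> cover, so the
    replacement does not affect the rest of the system.\<close>
  obtain M where M: "M \<subseteq> H E'" "disjoint_ends en0 M" "covered en0 M = K - {z}"
    by (rule component_near_perfect[OF H_multigraph[OF E'(1)] zD, unfolded Kz])
  let ?X = "{l \<in> ?N1. en0 l \<subseteq> K}"
  have d1: "disjoint_ends en0 ?N1" using m1 by (simp add: matching_def)
  have cX: "covered en0 (?N1 - ?X) = covered en0 ?N1 - (K - {z})"
    using covered_diff[OF d1, of ?X] z(2) by auto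
  define N2 where "N2 = (?N1 - ?X) \<union> M"
  have sub: "K - {z} \<subseteq> covered en0 ?N1" using z(2) covered_mono[of ?X ?N1 en0] by auto
  have c2: "covered en0 N2 = covered en0 ?N1"
    unfolding N2_def covered_Un cX M(3) using sub by blast
  have d2: "disjoint_ends en0 N2"
    unfolding N2_def
    by (rule disjoint_ends_Un[OF disjoint_ends_subset[OF d1] M(2)]) (use cX M(3) in auto)
  have "Node w s \<in> en0 (Inr w)" by (cases s) auto
  then have wX: "Inr w \<in> ?N1 - ?X" using wD KD by auto
  then have w2: "Inr w \<in> N2" by (simp add: N2_def)
  have "Inl e \<in> ?X" using eN eW aK ee by (auto simp: N0_def)
  have N2E: "N2 \<subseteq> H E'"
  proof
    fix l assume l: "l \<in> N2"
    show "l \<in> H E'"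
    proof (cases "l \<in> M")
      case True
      then show ?thesis using M(1) by blast
    next
      case False
      then have "l \<in> ?N1" "l \<notin> ?X" using l unfolding N2_def by blast+
      moreover from this have "l \<noteq> Inl e" using \<open>Inl e \<in> ?X\<close> by metis
      moreover have "?N1 \<subseteq> insert (Inl e) (H E')" using m1 LE by (simp add: matching_def)
      ultimately show ?thesis by blast
    qed
  qed
  define M0 where "M0 = N2 - {Inr w}"
  have cM0: "covered en0 M0 = covered en0 N0"
    unfolding M0_def covered_remove[OF d2 w2] c2 using free by auto
  have S: "S0 \<subseteq> ?S" by (rule S0_targets)
  have same: "covered en0 Y = covered (aux_ends B ?S) Y" if "\<And>t. Node w t \<notin> covered en0 Y" for Y
  proof (rule merge_no_leaf(1)[OF S])
    fix x f assume x: "Leaf x f \<in> covered (aux_ends B ?S) Y"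
    show "(x, sg B f x) \<in> S0"
    proof (rule ccontr)
      assume n: "(x, sg B f x) \<notin> S0"
      have "x \<noteq> r" using n unfolding S0_iff .
      then have xw: "x = w" using Leaf_in_covered[OF x] unfolding targets_iff[OF wr] by blast
      have "Inl f \<in> Y" "x \<in> ends B f" using x by (simp_all add: Leaf_covered)
      then have "half B S0 f w \<in> covered en0 Y" using half_covered xw by metis
      moreover have "half B S0 f w = Node w (sg B f w)" using n xw by (simp add: half_def)
      ultimately show False using that by simp
    qed
  qed
  have cS: "covered (aux_ends B ?S) M0 = covered (aux_ends B ?S) N0"
    using same[of M0] same[of N0] cM0 nw by simp
  have "disjoint_ends en0 M0" unfolding M0_def using disjoint_ends_subset[OF d2] by auto
  then have dM0: "disjoint_ends (aux_ends B ?S) M0" by (rule disjoint_ends_more_leaves[OF S])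
  let ?P = "M0 \<union> Inl ` W"
  have NP: "N = N0 \<union> Inl ` W" using WN by (auto simp: N0_def)
  have cW: "covered (aux_ends B ?S) N0 \<inter> covered (aux_ends B ?S) (Inl ` W) = {}"
    unfolding N0_def covered_diff[OF N'(2) WN] by auto
  have dP: "disjoint_ends (aux_ends B ?S) ?P"
    by (rule disjoint_ends_Un[OF dM0 disjoint_ends_subset[OF N'(2) WN]]) (use cS cW in simp)
  have cP: "covered (aux_ends B ?S) ?P = covered (aux_ends B ?S) N"
    unfolding NP covered_Un cS by simp
  have "W \<subseteq> E'" using WN N'(1) eW by (auto simp: aux_edges_def E'_def)
  moreover have "M0 \<subseteq> aux_edges B ?S E'"
    using N2E unfolding M0_def aux_edges_def ordinary_S0 ordinary_targets by auto
  ultimately have "?P \<subseteq> aux_edges B ?S E'" by (auto simp: aux_edges_def)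
  then have "path_system B r E' w s ?P" using dP cP N'(3) by (simp add: path_system_def)
  then have "card (leaves B ?S ?P r) \<le> kap E' w s" using path_system_kap[OF E'(1) w] by blast
  moreover have "leaves B ?S ?P r = leaves B ?S N r" unfolding leaves_def cP ..
  ultimately show False using N(2) crit' by simp
qed

section \<open>Sparse reachability and the final count\<close>

text \<open>
  Adding edges one at a time as long as this makes a new node missable. When no single edge does,
  then all edges are harmless and hence all of them together add nothing.
\<close>

lemma sparse_reachability:
  assumes E: "E \<subseteq> edges B"
  obtains E' where "E' \<subseteq> E" "D E' = D E" "card E' \<le> card (nodes (verts B - {r}) \<inter> D E)"
proof -
  let ?V = "nodes (verts B - {r})"
  let ?P = "\<lambda>X. X \<subseteq> E \<and> card X \<le> card (?V \<inter> D X)"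
  have fE: "finite E" using E finite_B by (auto simp: finite_bigraph_def intro: finite_subset)
  have fV: "finite ?V" using card_nodes(2) finite_verts by simp
  \<comment> \<open>Extremal form of the process: \<open>X\<close> is a largest set satisfying the
    inequality. An edge that enlarges \<open>D X\<close> raises its left side by one and its right
    side by at least one, so it could be added.\<close>
  have "?P {}" by simp
  moreover have "\<forall>X. ?P X \<longrightarrow> card X < Suc (card E)"
    using fE by (auto simp: less_Suc_eq_le intro: card_mono)
  ultimately obtain X where X: "?P X" "\<And>Y. ?P Y \<Longrightarrow> card Y \<le> card X"
    using ex_has_greatest_nat[of ?P "{}" card "Suc (card E)"] by blast
  have XB: "X \<subseteq> edges B" using X(1) E by auto
  have fX: "finite X" using X(1) fE finite_subset by blast
  have stable: "D (insert e X) = D X" if e: "e \<in> E - X" for e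
  proof (rule ccontr)
    assume ne: "D (insert e X) \<noteq> D X"
    have eX: "insert e X \<subseteq> edges B" using e XB E by auto
    have sub: "D X \<subseteq> D (insert e X)" using D_mono[OF _ eX] by blast
    then obtain h where h: "h \<in> D (insert e X)" "h \<notin> D X" using ne by blast
    then have "h \<in> ?V" using not_node_in_D[OF XB] by blast
    then have "?V \<inter> D X \<subset> ?V \<inter> D (insert e X)" using h sub by blast
    then have "card (?V \<inter> D X) < card (?V \<inter> D (insert e X))"
      using fV by (intro psubset_card_mono) auto
    then have "?P (insert e X)" using X(1) e fX by auto
    then have "card (insert e X) \<le> card X" by (rule X(2))
    then show False using e fX by simp
  qed
  let ?R = "Inl ` (E - X) :: ('e + 'v) set"
  have HR: "H X \<union> ?R = H E" using X(1) by (auto simp: aux_edges_def)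
  have "D E = D X"
    unfolding HR[symmetric]
  proof (rule harmless_Un)
    show "finite ?R" using fE by simp
    show "multigraph en0 (H X \<union> ?R)" using H_multigraph[OF E] HR by simp
    show "?R \<inter> H X = {}" by (auto simp: aux_edges_def)
    fix l assume "l \<in> ?R"
    then obtain e where e: "l = Inl e" "e \<in> E - X" by auto
    have eX: "insert e X \<subseteq> edges B" using e XB E by auto
    show "harmless en0 (H X) l"
      unfolding e(1)
    proof (rule harmless_of_missable_insert)
      show "multigraph en0 (insert (Inl e) (H X))" using H_multigraph[OF eX] H_insert by metis
      show "missable en0 (insert (Inl e) (H X)) = D X" using stable[OF e(2)] H_insert by metis
      show "max_matching en0 (insert (Inl e) (H X)) N" if "max_matching en0 (H X) N" for N
        using that max_matching_iff[OF XB] max_matching_iff[OF eX] H_insert[of e X]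
          matching_mono[of en0 "H X" N "insert (Inl e) (H X)"] by auto
    qed
  qed
  then show thesis using that[of X] X(1) by simp
qed

lemma flame_bound:
  assumes E: "E \<subseteq> edges B"
    and crit: "\<And>e. e \<in> E \<Longrightarrow> \<exists>w\<in>verts B - {r}. \<exists>s. kap (E - {e}) w s < kap E w s"
  shows "card E \<le> (\<Sum>v\<in>verts B - {r}. \<Sum>s\<in>{Plus, Minus}. kap E v s)"
proof -
  let ?V = "verts B - {r}"
  have fE: "finite E" using E finite_B by (auto simp: finite_bigraph_def intro: finite_subset)
  obtain E' where E': "E' \<subseteq> E" "D E' = D E" "card E' \<le> card (nodes ?V \<inter> D E)"
    using sparse_reachability[OF E] .
  have E'B: "E' \<subseteq> edges B" using E' E by auto
  define T where "T = {(v, s). v \<in> ?V \<and> kap E v s \<noteq> 0}"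
  have UNIV_sign: "(UNIV :: sign set) = {Plus, Minus}" using sign.exhaust by auto
  have fS: "finite (UNIV :: sign set)" unfolding UNIV_sign by simp
  have TV: "T \<subseteq> ?V \<times> UNIV" by (auto simp: T_def)
  have fVU: "finite (?V \<times> (UNIV :: sign set))" using finite_verts fS by blast
  have fT: "finite T" by (rule finite_subset[OF TV fVU])
  \<comment> \<open>A node \<open>Node v t\<close> in \<open>D\<close> stands for the reachable pair
    \<open>(v, neg t)\<close>.\<close>
  have reach: "card (nodes ?V \<inter> D E) \<le> card T"
  proof (rule surj_card_le[OF fT])
    show "nodes ?V \<inter> D E \<subseteq> (\<lambda>(v, s). Node v (neg s)) ` T"
    proof
      fix h assume h: "h \<in> nodes ?V \<inter> D E"
      then obtain v t where v: "h = Node v t" "v \<in> ?V" by (cases h) auto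
      then have "kap E v (neg t) \<noteq> 0" using D_kap_pos[OF E, of v "neg t"] h by simp
      then have "(v, neg t) \<in> T" using v by (simp add: T_def)
      then show "h \<in> (\<lambda>(v, s). Node v (neg s)) ` T" using v by (force intro: rev_image_eqI)
    qed
  qed
  define C where "C = (\<lambda>(v, b). {e \<in> E. v \<in> ends B e \<and> sg B e v = b \<and> kap (E - {e}) v b < kap E v b})"
  \<comment> \<open>Only at these pairs does an incident edge have a forced direction, towards
    \<open>v\<close>, so that \<open>arc_critical\<close> makes it critical for the pair
    itself.\<close>
  define A where "A = {(v, b) \<in> T. Node v b \<notin> D E}"
  have AT: "A \<subseteq> T" by (auto simp: A_def)
  have fA: "finite A" by (rule finite_subset[OF AT fT])
  have arc: "e \<in> C (v, b)"
    if e: "e \<in> E" "v \<in> ends B e" "v \<in> ?V" "sg B e v = b" and nD: "Node v b \<notin> D E" for e v b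
  proof -
    obtain u where u: "ends B e = {v, u}" "v \<noteq> u" using edge_other_end[OF bidirected_B _ e(2)] e(1) E by blast
    obtain w s where w: "w \<in> ?V" "kap (E - {e}) w s < kap E w s" using crit[OF e(1)] by blast
    have "Node v (sg B e v) \<notin> D (E - {e})" using nD e(4) D_mono[of "E - {e}" E] E by auto
    moreover have "ends B e = {u, v}" using u by auto
    ultimately have "kap (E - {e}) v (sg B e v) < kap E v (sg B e v)"
      using arc_critical[OF E e(1) _ _ _ _ w] u(2) e(3) by auto
    then show ?thesis using e by (simp add: C_def)
  qed
  have C_card: "card (C p - E') \<le> (case p of (v, b) \<Rightarrow> kap E v b - 1)" if p: "p \<in> A" for p
  proof -
    obtain v b where vb: "p = (v, b)" by (cases p)
    then have v: "v \<in> ?V" "kap E v b \<noteq> 0" "Node v b \<notin> D E" using p by (auto simp: A_def T_def)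
    have vr: "v \<noteq> r" using v(1) by auto
    obtain N where N: "path_system B r E v b N" "card (leaves B (targets r v b) N r) = kap E v b"
      "card (leaves B (targets r v b) N v) = kap E v b" using path_system_exists[OF E v(1)] .
    have "C p \<subseteq> leaves B (targets r v b) N v"
    proof
      fix e assume e: "e \<in> C p"
      then have "Inl e \<in> N" using critical_in_system[OF E v(1) _ N(1,2)] by (auto simp: C_def vb)
      then show "e \<in> leaves B (targets r v b) N v"
        using e vr by (auto simp: leaves_def Leaf_covered C_def vb targets_iff)
    qed
    moreover have "finite (leaves B (targets r v b) N v)" using N(3) v(2) by (metis card.infinite)
    ultimately have Ck: "card (C p) \<le> kap E v b" "finite (C p)"
      using card_mono N(3) finite_subset by metis+
    \<comment> \<open>Source of the \<open>- 1\<close>: \<open>E'\<close> still reaches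
      \<open>(v, b)\<close>, so it contains an edge \<open>f\<close> ending there, and
      \<open>f\<close> is critical for the pair too. It is already counted in
      \<open>E'\<close>.\<close>
    have "Node v (neg b) \<in> D E'" using kap_pos_D[OF E v(1,2)] E'(2) by simp
    then have "kap E' v b \<noteq> 0" using D_kap_pos[OF E'B v(1)] by simp
    moreover obtain N' where N': "path_system B r E' v b N'"
      "card (leaves B (targets r v b) N' v) = kap E' v b" using path_system_exists[OF E'B v(1)] .
    ultimately obtain f where f: "f \<in> leaves B (targets r v b) N' v" by fastforce
    then have f': "Inl f \<in> N'" "v \<in> ends B f" "(v, sg B f v) \<in> targets r v b"
      by (simp_all add: leaves_def Leaf_covered)
    have fE': "f \<in> E'" using f'(1) N'(1) by (auto simp: path_system_def aux_edges_def)
    have "sg B f v = b" using f'(3) targets_iff[OF vr] vr by auto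
    then have "f \<in> C p" using arc[of f v b] f'(2) v fE' E'(1) unfolding vb by auto
    then have "C p - E' \<subset> C p" using fE' by auto
    then have "card (C p - E') < card (C p)" using Ck(2) by (rule psubset_card_mono[rotated])
    then show ?thesis using Ck(1) unfolding vb by simp
  qed
  have cover: "E - E' \<subseteq> (\<Union>p\<in>A. C p - E')"
  proof
    fix e assume e: "e \<in> E - E'"
    then have eE: "e \<in> E" by simp
    then have "card (ends B e) = 2" using bidirected_B E by (auto simp: bidirected_graph_def)
    then obtain u v where uv: "ends B e = {u, v}" "u \<noteq> v" by (meson card_2_iff)
    \<comment> \<open>As \<open>e\<close> is outside \<open>E'\<close>, the set for
      \<open>E - {e}\<close> is squeezed between two equal sets; this is what
      \<open>not_critical_inside_component\<close> requires.\<close>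
    have "D E' \<subseteq> D (E - {e})" using D_mono[of E' "E - {e}"] e E E'(1) by auto
    moreover have "D (E - {e}) \<subseteq> D E" using D_mono[of "E - {e}" E] E by auto
    ultimately have DE: "D (E - {e}) = D E" using E'(2) by simp
    obtain w s where w: "w \<in> ?V" "kap (E - {e}) w s < kap E w s" using crit[OF eE] by blast
    have "\<not> (half B S0 e u \<in> D E \<and> half B S0 e v \<in> D E)"
      using not_critical_inside_component[OF E eE uv(1) DE _ _ w(1)] w(2) by blast
    then obtain x where x: "x \<in> ends B e" "half B S0 e x \<notin> D E" using uv by auto
    have "half B S0 e x \<in> nodes ?V" using x(2) not_node_in_D[OF E] by blast
    then have hx: "half B S0 e x = Node x (sg B e x)" "x \<in> ?V"
      by (cases "half B S0 e x"; auto simp: half_Node half_Leaf)+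
    have eC: "e \<in> C (x, sg B e x)" using arc[OF eE x(1) hx(2) refl] x(2) hx(1) by simp
    then have "(x, sg B e x) \<in> A" using hx x(2) by (auto simp: C_def A_def T_def)
    then show "e \<in> (\<Union>p\<in>A. C p - E')" using eC e by blast
  qed
  have fC: "finite (\<Union>p\<in>A. C p - E')"
  proof -
    have "finite (C p)" for p using fE by (cases p) (simp add: C_def)
    then show ?thesis using fA by simp
  qed
  have "card (E - E') \<le> card (\<Union>p\<in>A. C p - E')" using cover fC by (rule card_mono[rotated])
  also have "\<dots> \<le> (\<Sum>p\<in>A. card (C p - E'))" using card_UN_le[OF fA] .
  also have "\<dots> \<le> (\<Sum>p\<in>A. case p of (v, b) \<Rightarrow> kap E v b - 1)" using C_card by (rule sum_mono)
  also have "\<dots> \<le> (\<Sum>p\<in>T. case p of (v, b) \<Rightarrow> kap E v b - 1)"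
    using fT by (intro sum_mono2) (auto simp: A_def)
  finally have 1: "card (E - E') \<le> (\<Sum>p\<in>T. case p of (v, b) \<Rightarrow> kap E v b - 1)" .
  have "card E = card E' + card (E - E')"
    using E'(1) fE by (metis card_Diff_subset card_mono finite_subset le_add_diff_inverse)
  also have "\<dots> \<le> (\<Sum>p\<in>T. 1) + (\<Sum>p\<in>T. case p of (v, b) \<Rightarrow> kap E v b - 1)"
    using 1 E'(3) reach by simp
  \<comment> \<open>Each pair in \<open>T\<close> has nonzero connectivity, so the truncated
    subtraction is exact and \<open>1 + (kap E v b - 1)\<close> is \<open>kap E v b\<close>.\<close>
  also have "\<dots> = (\<Sum>p\<in>T. case p of (v, b) \<Rightarrow> kap E v b)"
    unfolding sum.distrib[symmetric] by (intro sum.cong) (auto simp: T_def)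
  also have "\<dots> \<le> (\<Sum>p\<in>?V \<times> UNIV. case p of (v, b) \<Rightarrow> kap E v b)"
    by (rule sum_mono2[OF fVU TV]) auto
  also have "\<dots> = (\<Sum>v\<in>?V. \<Sum>s\<in>{Plus, Minus}. kap E v s)"
    unfolding UNIV_sign by (rule sum.cartesian_product[symmetric])
  finally show ?thesis .
qed

end

theorem theorem7p9:
  fixes B :: "('v, 'e) bigraph" and r :: 'v
  assumes "finite_bigraph B"
    and "rooted B r"
    and "clean B r"
  shows "\<exists>F :: ('v, 'e) bigraph. spanning_subgraph F B \<and> rooted F r \<and> vertex_flame F r \<and>
           (\<forall>v\<in>verts B - {r}. \<forall>\<alpha>. kappa F \<alpha> r v = kappa B \<alpha> r v)"
proof -
  interpret clean_rooted B r using assms by unfold_locales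
  let ?P = "\<lambda>E. E \<subseteq> edges B \<and> (\<forall>v\<in>verts B - {r}. \<forall>s. kap E v s = kappa B s r v)"
  have "?P (edges B)" by simp
  then obtain E where E: "?P E" "\<And>E'. ?P E' \<Longrightarrow> card E \<le> card E'"
    using ex_has_least_nat[of ?P "edges B" card] by blast
  have EB: "E \<subseteq> edges B" using E(1) by simp
  have fE: "finite E" using EB finite_B by (auto simp: finite_bigraph_def intro: finite_subset)
  \<comment> \<open>By \<open>kap_mono\<close> a connectivity that changes on deleting
    \<open>e\<close> must drop strictly, which is the form of criticality used in
    \<open>flame_bound\<close>.\<close>
  have "\<exists>w\<in>verts B - {r}. \<exists>s. kap (E - {e}) w s < kap E w s" if e: "e \<in> E" for e
  proof (rule ccontr)
    assume n: "\<not> ?thesis"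
    have "kap (E - {e}) w s = kap E w s" if "w \<in> verts B - {r}" for w s
      using n that kap_mono[of "E - {e}" E w s] EB by (metis Diff_subset le_neq_implies_less)
    then have "?P (E - {e})" using E(1) by auto
    then have "card E \<le> card (E - {e})" by (rule E(2))
    then show False using e fE by (metis card_Diff1_less not_le)
  qed
  then have "card E \<le> (\<Sum>v\<in>verts B - {r}. \<Sum>s\<in>{Plus, Minus}. kap E v s)"
    using flame_bound[OF EB] by blast
  moreover have "bidirected_graph (restr E)" using bidirected_B EB by (auto simp: bidirected_graph_def)
  ultimately have "spanning_subgraph (restr E) B \<and> rooted (restr E) r \<and> vertex_flame (restr E) r"
    using EB root_vert
    by (simp add: spanning_subgraph_def subgraph_def rooted_def vertex_flame_def)
  then show ?thesis using E(1) by blast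
qed

end
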